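(* Let $n\ge 3$ and let $\Omega\subset\mathbb{R}^n$ be a bounded domain with smooth boundary containing the origin. Let $u$ be a solution to $$-\Delta u=0\ \text{ in }\mathbb{R}^n\setminus\overline\Omega,\qquad u=1\ \text{ on }\partial\Omega,\qquad u(x)\to 0\ \text{ as }|x|\to\infty ,$$ satisfying $$\frac{H}{n-1}\le\frac{|Du|}{(n-2)\,u}\qquad\text{on }\{u=c\},$$ for some $0<c\le 1$ such that $\{u=c\}$ is a regular level set. Then $\Omega$ is a ball and $u$ is rotationally symmetric.
   Context: $D$ and $\Delta$ are the Euclidean gradient and Laplacian. $\{u=c\}$ denotes $\{x\in\mathbb{R}^n\setminus\Omega: u(x)=c\}$; it is regular if $Du\neq 0$ at each of its points. $H$ is the mean curvature of the hypersurface $\{u=c\}$ with respect to the normal pointing towards the interior of $\{u\le c\}$, that is $\nu=-Du/|Du|$: the sum of the $n-1$ principal curvatures (not their average), with the sign convention that a round sphere with its outward normal has positive mean curvature; $H=D^2u(\nu,\nu)/|Du|$. Rotationally symmetric means depending only on the distance to the center of the ball $\Omega$.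
   Formalization: For c<1 the exterior of the closure of Ω is assumed connected (a spherical shell, with u=1 in its hole, is otherwise a counterexample); for c=1, u is assumed C² up to ∂Ω, so that Du and H make sense there (this follows from elliptic regularity). *)

theory Defs
  imports "HOL-Analysis.Analysis"
begin

text \<open>
  All derivatives are taken within a set \<open>S\<close>. At interior points of \<open>S\<close> they are the usual
  ones; if \<open>S\<close> is the complement of an open set with smooth boundary, they are the (unique)
  one-sided derivatives at the boundary points, and \<open>Ck_on k S\<close> is the class of functions that
  are \<open>k\<close> times continuously differentiable up to the boundary.
\<close>

definition pd :: "'a::euclidean_space set \<Rightarrow> 'a \<Rightarrow> ('a \<Rightarrow> real) \<Rightarrow> 'a \<Rightarrow> real" where
  "pd S b f x = frechet_derivative f (at x within S) b"

primrec Ck_on :: "nat \<Rightarrow> 'a::euclidean_space set \<Rightarrow> ('a \<Rightarrow> real) \<Rightarrow> bool" where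
  "Ck_on 0 S f \<longleftrightarrow> continuous_on S f"
| "Ck_on (Suc k) S f \<longleftrightarrow> f differentiable_on S \<and> (\<forall>b\<in>Basis. Ck_on k S (pd S b f))"

definition grad :: "'a::euclidean_space set \<Rightarrow> ('a \<Rightarrow> real) \<Rightarrow> 'a \<Rightarrow> 'a" where
  "grad S f x = (\<Sum>b\<in>Basis. pd S b f x *\<^sub>R b)"

definition laplacian :: "'a::euclidean_space set \<Rightarrow> ('a \<Rightarrow> real) \<Rightarrow> 'a \<Rightarrow> real" where
  "laplacian S f x = (\<Sum>b\<in>Basis. pd S b (pd S b f) x)"

text \<open>Smooth boundary, by local defining functions; the set lies locally on one side of its
  boundary.\<close>

definition smooth_boundary :: "'a::euclidean_space set \<Rightarrow> bool" where
  "smooth_boundary \<Omega> \<longleftrightarrow>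
     (\<forall>p\<in>frontier \<Omega>. \<exists>U \<rho>. open U \<and> p \<in> U \<and> (\<forall>k. Ck_on k U \<rho>) \<and>
        (\<forall>x\<in>U. grad U \<rho> x \<noteq> 0) \<and> \<Omega> \<inter> U = {x\<in>U. \<rho> x < 0})"

definition level_set :: "'a set \<Rightarrow> ('a \<Rightarrow> real) \<Rightarrow> real \<Rightarrow> 'a set" where
  "level_set S u c = {x\<in>S. u x = c}"

definition regular_level_set :: "'a::euclidean_space set \<Rightarrow> ('a \<Rightarrow> real) \<Rightarrow> real \<Rightarrow> bool" where
  "regular_level_set S u c \<longleftrightarrow> (\<forall>x\<in>level_set S u c. grad S u x \<noteq> 0)"

definition unit_normal :: "'a::euclidean_space set \<Rightarrow> ('a \<Rightarrow> real) \<Rightarrow> 'a \<Rightarrow> 'a" where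
  "unit_normal S u x = - (grad S u x /\<^sub>R norm (grad S u x))"

definition tangent_proj :: "'a::euclidean_space set \<Rightarrow> ('a \<Rightarrow> real) \<Rightarrow> 'a \<Rightarrow> 'a \<Rightarrow> 'a" where
  "tangent_proj S u x v = v - (v \<bullet> unit_normal S u x) *\<^sub>R unit_normal S u x"

text \<open>The shape operator of the level set of \<open>u\<close> through \<open>x\<close> is the differential of the unit
  normal, restricted to the tangent space. The sign is such that spheres with their outward
  normal have positive principal curvatures.\<close>

definition shape_operator :: "'a::euclidean_space set \<Rightarrow> ('a \<Rightarrow> real) \<Rightarrow> 'a \<Rightarrow> 'a \<Rightarrow> 'a" where
  "shape_operator S u x = frechet_derivative (unit_normal S u) (at x within S)"

text \<open>The trace of the shape operator over the tangent space, i.e. the sum (not the average) of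
  the principal curvatures: for a linear map \<open>A\<close> and the orthogonal projection \<open>P\<close> onto a
  subspace \<open>T\<close>, the trace of the compression of \<open>A\<close> to \<open>T\<close> is the sum of \<open>A (P b) \<bullet> P b\<close> over an
  orthonormal basis of the whole space.\<close>

definition mean_curvature :: "'a::euclidean_space set \<Rightarrow> ('a \<Rightarrow> real) \<Rightarrow> 'a \<Rightarrow> real" where
  "mean_curvature S u x =
     (\<Sum>b\<in>Basis. shape_operator S u x (tangent_proj S u x b) \<bullet> tangent_proj S u x b)"

end

theory Submission
  imports Defs
begin

text \<open>
  Write \<open>n\<close> for the dimension, \<open>g = Du\<close>, \<open>a = n / (n - 2)\<close> and \<open>P = |g|\<^sup>2 u^(-a-1)\<close>. For the radial
  solution \<open>|x - z|^(2 - n)\<close> the function \<open>P\<close> is constant. In general \<open>u P = |g|\<^sup>2 u^(-a)\<close> is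
  subharmonic, by a Bochner formula in which everything completes to a square
  (\<open>bochner_gradient_quotient\<close>); the square vanishes only if the Hessian of \<open>u\<close> is the one of a
  radial solution.

  For harmonic \<open>u\<close> the mean curvature of a level set is \<open>D\<^sup>2 u (\<nu>, \<nu>) / |g|\<close>
  (\<open>mean_curvature_harmonic_level\<close>). Hence the curvature bound on \<open>{u = c}\<close> says precisely that \<open>P\<close> does
  not increase in the direction of \<open>Du\<close> there, that is, does not decrease when one moves into
  \<open>{u < c}\<close>. Let \<open>M\<close> be the maximum of \<open>P\<close> on the compact set \<open>{u = c}\<close>. The function
  \<open>u (P - M)\<close> is subharmonic, nonpositive on \<open>{u = c}\<close> and at most \<open>0\<close> in the limit at infinity, so it
  is nonpositive on \<open>{u < c}\<close>. If it were negative throughout, a Hopf type comparison with the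
  barrier \<open>c - u\<close> at a maximum point of \<open>P\<close> would contradict the sign of the derivative. So it
  vanishes at an interior point, hence nearby, and \<open>u\<close> is radial on some ball
  (\<open>locally_radial_of_curvature_bound\<close>, \<open>radial_of_extremal_gradient\<close>).

  Unique continuation (\<open>harmonic_unique_continuation\<close>) spreads the radial formula over the connected
  exterior, and the boundary condition \<open>u = 1\<close> then places the frontier of \<open>\<Omega>\<close> on a sphere
  (\<open>ball_of_locally_radial\<close>). The behaviour at infinity enters only through the bounds of \<open>u\<close> by
  multiples of \<open>|x|^(2 - n)\<close> and the resulting gradient decay.

  Smoothness of harmonic functions, gradient estimates, the maximum principle and unique
  continuation all come from one mean value property with the polynomial weights
  \<open>(max 0 (1 - |y|\<^sup>2))^k\<close>, proved by integration by parts.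
\<close>

section \<open>Bump functions and integration by parts\<close>

definition bump :: "nat \<Rightarrow> 'a::euclidean_space \<Rightarrow> real" where
  "bump k y = (max 0 (1 - y \<bullet> y)) ^ k"

text \<open>On a box, parameter integrals of continuous functions can be differentiated under the integral
  sign. The bumps live in the unit ball; the side length leaves room for translates by unit
  vectors.\<close>

abbreviation bump_box :: "'a::euclidean_space set" where
  "bump_box \<equiv> cbox (- (2 *\<^sub>R One)) (2 *\<^sub>R One)"

lemma has_real_derivative_pos_part_power:
  "((\<lambda>x::real. max 0 x ^ Suc (Suc k)) has_real_derivative real (Suc (Suc k)) * max 0 x ^ Suc k) (at x)"
proof (cases x "0::real" rule: linorder_cases)
  case less
  have "((\<lambda>x::real. 0::real) has_real_derivative 0) (at x)" by simp
  then show ?thesis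
    by (rule has_field_derivative_transform_within_open[where S="{..<0}", THEN DERIV_cong])
       (use less in auto)
next
  case greater
  have "((\<lambda>x::real. x ^ Suc (Suc k)) has_real_derivative real (Suc (Suc k)) * x ^ Suc k) (at x)"
    using DERIV_pow[of "Suc (Suc k)" x] by simp
  then show ?thesis
    by (rule has_field_derivative_transform_within_open[where S="{0<..}", THEN DERIV_cong])
       (use greater in auto)
next
  case equal
  have "((\<lambda>h::real. max 0 h ^ Suc (Suc k) / h) \<longlongrightarrow> 0) (at 0)"
  proof (rule Lim_null_comparison)
    show "\<forall>\<^sub>F h in at (0::real). norm (max 0 h ^ Suc (Suc k) / h) \<le> \<bar>h\<bar> ^ Suc k"
    proof (rule always_eventually, rule allI)
      fix h :: real
      show "norm (max 0 h ^ Suc (Suc k) / h) \<le> \<bar>h\<bar> ^ Suc k"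
        by (cases "h > 0") (simp_all add: max_absorb1 del: power_Suc, simp)
    qed
    show "((\<lambda>h::real. \<bar>h\<bar> ^ Suc k) \<longlongrightarrow> 0) (at 0)"
      by (rule tendsto_eq_intros refl | simp)+
  qed
  then show ?thesis using equal by (simp add: DERIV_def)
qed

lemma has_real_derivative_bump_line:
  "((\<lambda>s. bump (Suc (Suc k)) (y + s *\<^sub>R e)) has_real_derivative
     - (2 * real (Suc (Suc k)) * bump (Suc k) y * (y \<bullet> e))) (at 0)"
proof -
  have "((\<lambda>s. 1 - (y + s *\<^sub>R e) \<bullet> (y + s *\<^sub>R e)) has_real_derivative - (2 * (y \<bullet> e))) (at 0)"
    unfolding has_field_derivative_def
    by (auto intro!: derivative_eq_intros simp: inner_commute algebra_simps)
  from DERIV_chain2[OF has_real_derivative_pos_part_power[of k] this]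
  show ?thesis unfolding bump_def by (rule DERIV_cong) (simp add: algebra_simps)
qed

lemma continuous_on_bump [continuous_intros]: "continuous_on S (bump k)"
  unfolding bump_def by (intro continuous_intros)

lemma bump_nonneg: "bump k y \<ge> 0" by (simp add: bump_def)

lemma bump_eq_0: "norm y \<ge> 1 \<Longrightarrow> bump (Suc k) y = 0"
proof -
  assume "norm y \<ge> 1"
  then have "1 \<le> y \<bullet> y" using power_mono[of 1 "norm y" 2] by (simp add: dot_square_norm)
  then show ?thesis by (simp add: bump_def)
qed

lemma bump_pos: "norm y < 1 \<Longrightarrow> bump k y > 0"
proof -
  assume "norm y < 1"
  then have "y \<bullet> y < 1" using power_strict_mono[of "norm y" 1 2] by (simp add: dot_square_norm)
  then show ?thesis by (simp add: bump_def)
qed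

lemma mem_bump_box: "norm (y::'a::euclidean_space) \<le> 2 \<Longrightarrow> y \<in> bump_box"
  by (auto simp: mem_box) (smt (verit) Basis_le_norm)+

lemma norm_bump_box: "y \<in> bump_box \<Longrightarrow> norm (y::'a::euclidean_space) \<le> 2 * real DIM('a)"
proof -
  assume "y \<in> bump_box"
  then have "\<And>b. b \<in> Basis \<Longrightarrow> \<bar>y \<bullet> b\<bar> \<le> 2" by (auto simp: mem_box abs_le_iff)
  then have "(\<Sum>b\<in>Basis. \<bar>y \<bullet> b\<bar>) \<le> (\<Sum>b\<in>(Basis::'a set). 2)" by (intro sum_mono) auto
  then show ?thesis using norm_le_l1[of y] by simp
qed

lemma eventually_line_in_open:
  fixes y :: "'a::real_normed_vector"
  assumes "open S" "y \<in> S"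
  shows "\<forall>\<^sub>F t in nhds (0::real). y + t *\<^sub>R e \<in> S"
proof -
  have "open ((\<lambda>t::real. y + t *\<^sub>R e) -` S)"
    by (intro open_vimage assms(1) continuous_intros)
  then have "\<forall>\<^sub>F t in nhds 0. t \<in> (\<lambda>t::real. y + t *\<^sub>R e) -` S"
    by (rule eventually_nhds_in_open) (use assms(2) in simp)
  then show ?thesis by simp
qed

text \<open>The integral of a compactly supported function does not change under translation, so
  differentiating it along a translation and moving the derivative under the integral gives \<open>0\<close>.\<close>

lemma integral_derivative_compact_support:
  fixes \<psi> \<psi>' :: "'a::euclidean_space \<Rightarrow> real"
  assumes d: "\<And>y. ((\<lambda>t. \<psi> (y + t *\<^sub>R e)) has_real_derivative \<psi>' y) (at 0)"
    and c: "continuous_on UNIV \<psi>" "continuous_on UNIV \<psi>'"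
    and z: "\<And>y. norm y \<ge> 1 \<Longrightarrow> \<psi> y = 0" and e: "norm e \<le> 1"
  shows "integral bump_box \<psi>' = 0"
proof -
  let ?U = "{-1<..<1::real}"
  have "((\<lambda>t. integral bump_box (\<lambda>y. \<psi> (y + t *\<^sub>R e))) has_real_derivative
         integral bump_box (\<lambda>y. \<psi>' (y + 0 *\<^sub>R e))) (at 0 within ?U)"
  proof (rule leibniz_rule_field_derivative)
    fix t y
    have "((\<lambda>s. \<psi> ((y + t *\<^sub>R e) + s *\<^sub>R e)) has_real_derivative \<psi>' (y + t *\<^sub>R e)) (at (0 + 0))"
      using d[of "y + t *\<^sub>R e"] by simp
    then have "((\<lambda>s. \<psi> (y + s *\<^sub>R e)) has_real_derivative \<psi>' (y + t *\<^sub>R e)) (at t)"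
      using DERIV_at_within_shift[of "\<lambda>s. \<psi> (y + s *\<^sub>R e)" "\<psi>' (y + t *\<^sub>R e)" t 0 UNIV]
      by (simp add: algebra_simps)
    then show "((\<lambda>s. \<psi> (y + s *\<^sub>R e)) has_real_derivative \<psi>' (y + t *\<^sub>R e)) (at t within ?U)"
      by (rule has_field_derivative_at_within)
  next
    show "(\<lambda>y. \<psi> (y + t *\<^sub>R e)) integrable_on bump_box" for t
      by (intro integrable_continuous continuous_on_compose2[OF c(1)] continuous_intros) auto
    show "continuous_on (?U \<times> bump_box) (\<lambda>(t, y). \<psi>' (y + t *\<^sub>R e))"
      unfolding split_beta
      by (intro continuous_on_compose2[OF c(2)] continuous_intros) auto
  qed auto
  moreover have "integral bump_box (\<lambda>y. \<psi> (y + t *\<^sub>R e)) = integral bump_box \<psi>" if t: "t \<in> ?U" for t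
  proof -
    have te: "norm (t *\<^sub>R e) \<le> 1" using t e mult_mono[of "\<bar>t\<bar>" 1 "norm e" 1] by auto
    let ?c = "t *\<^sub>R e" and ?a = "- (2 *\<^sub>R One)::'a" and ?b = "2 *\<^sub>R One::'a"
    have supp: "\<psi> (y + ?c) = 0" if "y \<notin> cbox (?a - ?c) (?b - ?c) \<or> y \<notin> bump_box" for y
    proof (rule ccontr)
      assume "\<psi> (y + ?c) \<noteq> 0"
      then have n: "norm (y + ?c) < 1" using z by force
      then have "y + ?c \<in> bump_box" by (intro mem_bump_box) auto
      moreover have "y \<in> bump_box"
        using n te norm_triangle_ineq4[of "y + ?c" ?c] by (intro mem_bump_box) simp
      ultimately show False using that by (auto simp: mem_box algebra_simps)
    qed
    have i: "(\<lambda>y. \<psi> (y + s *\<^sub>R e)) integrable_on bump_box" for s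
      by (intro integrable_continuous continuous_on_compose2[OF c(1)] continuous_intros) auto
    have "(\<psi> has_integral integral bump_box \<psi>) bump_box"
      using i[of 0] by (simp add: integrable_integral)
    from has_integral_affinity'[OF this zero_less_one, of ?c]
    have "((\<lambda>y. \<psi> (y + ?c)) has_integral integral bump_box \<psi>) (cbox (?a - ?c) (?b - ?c))"
      by simp
    then have 1: "((\<lambda>y. \<psi> (y + ?c)) has_integral integral bump_box \<psi>) UNIV"
      by (rule has_integral_on_superset) (use supp in auto)
    have "((\<lambda>y. \<psi> (y + ?c)) has_integral integral bump_box (\<lambda>y. \<psi> (y + ?c))) UNIV"
      by (rule has_integral_on_superset[OF integrable_integral[OF i]]) (use supp in auto)
    with 1 show ?thesis by (metis has_integral_unique)
  qed
  note const = this
  have "((\<lambda>t. integral bump_box (\<lambda>y. \<psi> (y + t *\<^sub>R e))) has_real_derivative 0) (at 0)"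
  proof (rule has_field_derivative_transform_within_open)
    show "((\<lambda>_. integral bump_box \<psi>) has_real_derivative 0) (at 0)" by simp
    show "integral bump_box \<psi> = integral bump_box (\<lambda>y. \<psi> (y + t *\<^sub>R e))" if "t \<in> ?U" for t
      using const[OF that] by (rule sym)
  qed auto
  moreover have "at (0::real) within ?U = at 0" by (rule at_within_open) auto
  ultimately show ?thesis using DERIV_unique by simp blast
qed

text \<open>The product of the two functions vanishes outside the unit ball, hence extends by \<open>0\<close> from the
  ball of radius \<open>2\<close> to a continuously differentiable function on the whole space, whose directional
  derivative has integral \<open>0\<close>.\<close>

lemma integration_by_parts_bump:
  fixes p P \<phi> \<phi>' :: "'a::euclidean_space \<Rightarrow> real"
  assumes p: "\<And>y. norm y < 2 \<Longrightarrow> ((\<lambda>t. p (y + t *\<^sub>R e)) has_real_derivative P y) (at 0)"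
    and cp: "continuous_on (ball 0 2) p" "continuous_on (ball 0 2) P"
    and q: "\<And>y. ((\<lambda>t. \<phi> (y + t *\<^sub>R e)) has_real_derivative \<phi>' y) (at 0)"
    and cq: "continuous_on UNIV \<phi>" "continuous_on UNIV \<phi>'"
    and z: "\<And>y. norm y \<ge> 1 \<Longrightarrow> \<phi> y = 0" "\<And>y. norm y \<ge> 1 \<Longrightarrow> \<phi>' y = 0" and e: "norm e \<le> 1"
  shows "integral bump_box (\<lambda>y. \<phi> y * P y + \<phi>' y * p y) = 0"
proof -
  let ?\<psi> = "\<lambda>y. if norm y < 1 then \<phi> y * p y else 0"
  let ?\<psi>' = "\<lambda>y. if norm y < 1 then \<phi> y * P y + \<phi>' y * p y else 0"
  have open1: "open (- cball 0 1 :: 'a set)" by auto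
  have un: "ball 0 2 \<union> - cball 0 1 = (UNIV::'a set)" by auto
  have "continuous_on (ball 0 2) ?\<psi>" 
  proof (rule continuous_on_eq)
    show "continuous_on (ball 0 2) (\<lambda>y. \<phi> y * p y)"
      by (intro continuous_intros cp continuous_on_subset[OF cq(1)]) auto
  qed (use z in auto)
  moreover have "continuous_on (- cball 0 1) ?\<psi>"
    by (rule continuous_on_eq[where f="\<lambda>_. 0"]) auto
  ultimately have c1: "continuous_on UNIV ?\<psi>"
    using continuous_on_open_Un[OF open_ball open1] un by metis
  have "continuous_on (ball 0 2) ?\<psi>'" 
  proof (rule continuous_on_eq)
    show "continuous_on (ball 0 2) (\<lambda>y. \<phi> y * P y + \<phi>' y * p y)"
      by (intro continuous_intros cp continuous_on_subset[OF cq(1)] continuous_on_subset[OF cq(2)]) auto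
  qed (use z in auto)
  moreover have "continuous_on (- cball 0 1) ?\<psi>'"
    by (rule continuous_on_eq[where f="\<lambda>_. 0"]) auto
  ultimately have c2: "continuous_on UNIV ?\<psi>'"
    using continuous_on_open_Un[OF open_ball open1] un by metis
  have "integral bump_box ?\<psi>' = 0"
  proof (rule integral_derivative_compact_support[of ?\<psi> e])
    fix y
    show "((\<lambda>t. ?\<psi> (y + t *\<^sub>R e)) has_real_derivative ?\<psi>' y) (at 0)"
    proof (cases "norm y < 2")
      case True
      have "\<forall>\<^sub>F t in nhds 0. y + t *\<^sub>R e \<in> ball 0 2"
        using True by (intro eventually_line_in_open) auto
      then have ev: "\<forall>\<^sub>F t in nhds 0. ?\<psi> (y + t *\<^sub>R e) = \<phi> (y + t *\<^sub>R e) * p (y + t *\<^sub>R e)"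
        by eventually_elim (use z in auto)
      have "((\<lambda>t. \<phi> (y + t *\<^sub>R e) * p (y + t *\<^sub>R e)) has_real_derivative \<phi> y * P y + \<phi>' y * p y) (at 0)"
        using DERIV_mult[OF q[of y] p[OF True]] by (simp add: algebra_simps)
      moreover have "\<phi> y * P y + \<phi>' y * p y = ?\<psi>' y" using z by auto
      ultimately show ?thesis using DERIV_cong_ev[OF refl ev refl] by simp
    next
      case False
      then have "y \<in> - cball 0 1" by auto
      then have "\<forall>\<^sub>F t in nhds 0. y + t *\<^sub>R e \<in> - cball 0 1"
        using open1 by (intro eventually_line_in_open)
      then have ev: "\<forall>\<^sub>F t in nhds 0. ?\<psi> (y + t *\<^sub>R e) = 0"
        by eventually_elim auto
      show ?thesis using DERIV_cong_ev[OF refl ev refl] False by simp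
    qed
  next
    show "continuous_on UNIV ?\<psi>" "continuous_on UNIV ?\<psi>'" "norm e \<le> 1" by fact+
  qed auto
  moreover have "?\<psi>' = (\<lambda>y. \<phi> y * P y + \<phi>' y * p y)"
    using z by fastforce
  ultimately show ?thesis by simp
qed

section \<open>Twice differentiable functions and mean values\<close>

text \<open>Gradient and Hessian are explicit arguments, so that the Laplacian of a composite expression can
  be read off from its Hessian. The Hessian is a bounded linear function: this makes its continuity
  the one needed for differentiating under the integral.\<close>

definition has_C2 :: "'a::euclidean_space set \<Rightarrow> ('a \<Rightarrow> real) \<Rightarrow> ('a \<Rightarrow> 'a) \<Rightarrow> ('a \<Rightarrow> 'a \<Rightarrow>\<^sub>L 'a) \<Rightarrow> bool" where
  "has_C2 S f g H \<longleftrightarrow>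
     (\<forall>x\<in>S. (f has_derivative (\<lambda>w. g x \<bullet> w)) (at x) \<and> (g has_derivative blinfun_apply (H x)) (at x)) \<and>
     continuous_on S H"

definition blinfun_trace :: "('a::euclidean_space \<Rightarrow>\<^sub>L 'a) \<Rightarrow> real" where
  "blinfun_trace A = (\<Sum>b\<in>Basis. A b \<bullet> b)"

lemma has_C2D:
  assumes "has_C2 S f g H" "x \<in> S"
  shows "(f has_derivative (\<lambda>w. g x \<bullet> w)) (at x)" "(g has_derivative blinfun_apply (H x)) (at x)"
  using assms by (auto simp: has_C2_def)

lemma has_C2_continuous:
  assumes "has_C2 S f g H"
  shows "continuous_on S f" "continuous_on S g" "continuous_on S H"
proof -
  show "continuous_on S f"
    by (rule has_derivative_continuous_on, rule has_derivative_at_withinI, rule has_C2D(1)[OF assms])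
  show "continuous_on S g"
    by (rule has_derivative_continuous_on, rule has_derivative_at_withinI, rule has_C2D(2)[OF assms])
  show "continuous_on S H" using assms by (simp add: has_C2_def)
qed

lemma has_C2_subset: "has_C2 S f g H \<Longrightarrow> T \<subseteq> S \<Longrightarrow> has_C2 T f g H"
  unfolding has_C2_def by (blast intro: continuous_on_subset)

lemma continuous_on_blinfun_trace [continuous_intros]:
  "continuous_on S H \<Longrightarrow> continuous_on S (\<lambda>x. blinfun_trace (H x))"
  unfolding blinfun_trace_def by (intro continuous_intros)

text \<open>The rank one map \<open>w \<mapsto> (b \<bullet> w) a\<close>, which appears in Hessians of products and powers.\<close>

definition outer_product :: "'a::euclidean_space \<Rightarrow> 'a \<Rightarrow> 'a \<Rightarrow>\<^sub>L 'a" where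
  "outer_product a b = blinfun_scaleR_left a o\<^sub>L blinfun_inner_right b"

lemma outer_product_apply [simp]: "blinfun_apply (outer_product a b) w = (b \<bullet> w) *\<^sub>R a"
  by (simp add: outer_product_def)

lemma continuous_on_outer_product [continuous_intros]:
  fixes a b :: "'b::t2_space \<Rightarrow> 'a::euclidean_space"
  shows "continuous_on S a \<Longrightarrow> continuous_on S b \<Longrightarrow> continuous_on S (\<lambda>x. outer_product (a x) (b x))"
  by (intro continuous_on_blinfun_componentwise) (auto intro!: continuous_intros)

lemma blinfun_trace_simps [simp]:
  "blinfun_trace (A + B) = blinfun_trace A + blinfun_trace B"
  "blinfun_trace (c *\<^sub>R A) = c * blinfun_trace A"
  "blinfun_trace 0 = 0"
  "blinfun_trace (id_blinfun :: 'a \<Rightarrow>\<^sub>L 'a) = real DIM('a)"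
  "blinfun_trace (outer_product a (b::'a::euclidean_space)) = a \<bullet> b"
proof -
  show "blinfun_trace (outer_product a b) = a \<bullet> b"
    unfolding blinfun_trace_def euclidean_inner[of a b] by (simp add: mult.commute inner_commute)
qed (simp_all add: blinfun_trace_def blinfun.add_left blinfun.scaleR_left inner_add_left sum.distrib sum_distrib_left)

lemma has_C2_const: "has_C2 S (\<lambda>_. c) (\<lambda>_. 0) (\<lambda>_. 0)"
  by (auto simp: has_C2_def zero_blinfun.rep_eq)

lemma has_C2_add:
  assumes A: "has_C2 S f g H" and B: "has_C2 S f' g' H'"
  shows "has_C2 S (\<lambda>x. f x + f' x) (\<lambda>x. g x + g' x) (\<lambda>x. H x + H' x)"
  unfolding has_C2_def
proof (intro conjI ballI)
  fix x assume x: "x \<in> S"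
  show "((\<lambda>x. f x + f' x) has_derivative (\<lambda>w. (g x + g' x) \<bullet> w)) (at x)"
    using has_derivative_add[OF has_C2D(1)[OF A x] has_C2D(1)[OF B x]] by (simp add: inner_add_left)
  show "((\<lambda>x. g x + g' x) has_derivative blinfun_apply (H x + H' x)) (at x)"
    using has_derivative_add[OF has_C2D(2)[OF A x] has_C2D(2)[OF B x]]
    by (rule has_derivative_eq_rhs) (auto simp: blinfun.add_left)
qed (intro continuous_intros has_C2_continuous[OF A] has_C2_continuous[OF B])

lemma has_C2_mult:
  assumes A: "has_C2 S f g H" and B: "has_C2 S f' g' H'"
  shows "has_C2 S (\<lambda>x. f x * f' x) (\<lambda>x. f x *\<^sub>R g' x + f' x *\<^sub>R g x)
    (\<lambda>x. f x *\<^sub>R H' x + f' x *\<^sub>R H x + outer_product (g' x) (g x) + outer_product (g x) (g' x))"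
  unfolding has_C2_def
proof (intro conjI ballI)
  fix x assume x: "x \<in> S"
  show "((\<lambda>x. f x * f' x) has_derivative (\<lambda>w. (f x *\<^sub>R g' x + f' x *\<^sub>R g x) \<bullet> w)) (at x)"
    using has_derivative_mult[OF has_C2D(1)[OF A x] has_C2D(1)[OF B x]]
    by (rule has_derivative_eq_rhs) (auto simp: inner_add_left)
  show "((\<lambda>x. f x *\<^sub>R g' x + f' x *\<^sub>R g x) has_derivative
     blinfun_apply (f x *\<^sub>R H' x + f' x *\<^sub>R H x + outer_product (g' x) (g x) + outer_product (g x) (g' x))) (at x)"
    using has_derivative_add[OF has_derivative_scaleR[OF has_C2D(1)[OF A x] has_C2D(2)[OF B x]]
        has_derivative_scaleR[OF has_C2D(1)[OF B x] has_C2D(2)[OF A x]]]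
    by (rule has_derivative_eq_rhs) (auto simp: blinfun.add_left blinfun.scaleR_left)
qed (intro continuous_intros has_C2_continuous[OF A] has_C2_continuous[OF B])

lemma has_C2_cmult:
  assumes "has_C2 S f g H" shows "has_C2 S (\<lambda>x. c * f x) (\<lambda>x. c *\<^sub>R g x) (\<lambda>x. c *\<^sub>R H x)"
proof -
  have "outer_product 0 b = 0" "outer_product b 0 = 0" for b :: 'a
    by (auto intro!: blinfun_eqI)
  then show ?thesis using has_C2_mult[OF has_C2_const[of S c] assms] by simp
qed

lemma has_C2_sum:
  assumes "finite I" "\<And>i. i \<in> I \<Longrightarrow> has_C2 S (f i) (g i) (H i)"
  shows "has_C2 S (\<lambda>x. \<Sum>i\<in>I. f i x) (\<lambda>x. \<Sum>i\<in>I. g i x) (\<lambda>x. \<Sum>i\<in>I. H i x)"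
  using assms
proof (induction I)
  case empty show ?case by (simp add: has_C2_const)
next
  case (insert i I)
  have "has_C2 S (\<lambda>x. f i x + (\<Sum>i\<in>I. f i x)) (\<lambda>x. g i x + (\<Sum>i\<in>I. g i x)) (\<lambda>x. H i x + (\<Sum>i\<in>I. H i x))"
    using insert by (intro has_C2_add) auto
  then show ?case using insert by simp
qed

lemma has_C2_powr:
  assumes A: "has_C2 S f g H" and pos: "\<And>x. x \<in> S \<Longrightarrow> f x > 0"
  shows "has_C2 S (\<lambda>x. f x powr p) (\<lambda>x. (p * f x powr (p - 1)) *\<^sub>R g x)
    (\<lambda>x. (p * f x powr (p - 1)) *\<^sub>R H x + (p * (p - 1) * f x powr (p - 2)) *\<^sub>R outer_product (g x) (g x))"
  unfolding has_C2_def
proof (intro conjI ballI)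
  fix x assume x: "x \<in> S"
  have d: "((\<lambda>x. f x powr q) has_derivative (\<lambda>w. (q * f x powr (q - 1)) * (g x \<bullet> w))) (at x)" for q
  proof -
    have "((\<lambda>y. y powr q) has_derivative (*) (q * f x powr (q - 1))) (at (f x))"
      using has_real_derivative_powr[OF pos[OF x], of q] by (simp add: has_field_derivative_def)
    from has_derivative_compose[OF has_C2D(1)[OF A x] this] show ?thesis .
  qed
  show "((\<lambda>x. f x powr p) has_derivative (\<lambda>w. (p * f x powr (p - 1)) *\<^sub>R g x \<bullet> w)) (at x)"
    using d[of p] by simp
  have "p - 1 - 1 = p - 2" by simp
  then show "((\<lambda>x. (p * f x powr (p - 1)) *\<^sub>R g x) has_derivative
     blinfun_apply ((p * f x powr (p - 1)) *\<^sub>R H x + (p * (p - 1) * f x powr (p - 2)) *\<^sub>R outer_product (g x) (g x))) (at x)"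
    using has_derivative_scaleR[OF has_derivative_mult_right[OF d[of "p - 1"], of p] has_C2D(2)[OF A x]]
    by (elim has_derivative_eq_rhs) (auto simp: blinfun.add_left blinfun.scaleR_left ac_simps)
next
  show "continuous_on S (\<lambda>x. (p * f x powr (p - 1)) *\<^sub>R H x + (p * (p - 1) * f x powr (p - 2)) *\<^sub>R outer_product (g x) (g x))"
    using pos by (intro continuous_intros has_C2_continuous[OF A]) (auto simp: less_imp_neq[symmetric])
qed

lemma scaled_box_in_ball:
  assumes "y \<in> (bump_box::'a::euclidean_space set)" "\<bar>t\<bar> \<le> r" "r * (2 * real DIM('a)) < \<rho>"
  shows "(x::'a) + t *\<^sub>R y \<in> ball x \<rho>"
proof -
  have "\<bar>t\<bar> * norm y \<le> r * (2 * real DIM('a))"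
    using norm_bump_box[OF assms(1)] assms(2) by (intro mult_mono) auto
  then show ?thesis using assms(3) by (simp add: dist_norm)
qed

text \<open>The radial derivative of the weighted mean is the mean of \<open>g (x + t y) \<bullet> y\<close>. Since \<open>bump 2 y\<close> times
  \<open>y\<close> is minus the gradient of \<open>bump 3 y / 6\<close>, integration by parts in each coordinate turns it into a
  mean of the Laplacian. The bumps play the role of the averages over spheres in the classical proof.\<close>

lemma bump_mean_has_derivative:
  fixes f :: "'a::euclidean_space \<Rightarrow> real"
  assumes C: "has_C2 (ball x \<rho>) f g H" and r: "r * (2 * real DIM('a)) < \<rho>" and t: "0 \<le> t" "t \<le> r"
  shows "((\<lambda>t. integral bump_box (\<lambda>y. bump 2 y * f (x + t *\<^sub>R y))) has_real_derivative
          t * integral bump_box (\<lambda>y. bump 3 y / 6 * blinfun_trace (H (x + t *\<^sub>R y)))) (at t within {0..r})"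
proof -
  note cont = has_C2_continuous[OF C]
  have inb: "x + s *\<^sub>R y \<in> ball x \<rho>" if "y \<in> bump_box" "0 \<le> s" "s \<le> r" for s y
    using that r by (intro scaled_box_in_ball[of y s r]) auto
  have 1: "((\<lambda>t. integral bump_box (\<lambda>y. bump 2 y * f (x + t *\<^sub>R y))) has_real_derivative
      integral bump_box (\<lambda>y. bump 2 y * (g (x + t *\<^sub>R y) \<bullet> y))) (at t within {0..r})"
  proof (rule leibniz_rule_field_derivative)
    fix s :: real and y :: 'a assume s: "s \<in> {0..r}" "y \<in> bump_box"
    have "((\<lambda>s. x + s *\<^sub>R y) has_derivative (\<lambda>h. h *\<^sub>R y)) (at s within {0..r})"
      by (auto intro!: derivative_eq_intros)
    from has_derivative_compose[OF this has_C2D(1)[OF C inb]] s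
    have "((\<lambda>s. f (x + s *\<^sub>R y)) has_real_derivative g (x + s *\<^sub>R y) \<bullet> y) (at s within {0..r})"
      by (auto simp: has_field_derivative_def mult.commute elim!: has_derivative_eq_rhs)
    then show "((\<lambda>s. bump 2 y * f (x + s *\<^sub>R y)) has_real_derivative bump 2 y * (g (x + s *\<^sub>R y) \<bullet> y))
        (at s within {0..r})"
      by (rule DERIV_cmult)
  next
    show "(\<lambda>y. bump 2 y * f (x + s *\<^sub>R y)) integrable_on bump_box" if "s \<in> {0..r}" for s
      using that inb
      by (intro integrable_continuous continuous_intros continuous_on_compose2[OF cont(1)]) auto
    show "continuous_on ({0..r} \<times> bump_box) (\<lambda>(s, y). bump 2 y * (g (x + s *\<^sub>R y) \<bullet> y))"
      unfolding split_beta using inb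
      by (intro continuous_intros continuous_on_compose2[OF cont(2)]
           continuous_on_compose2[OF continuous_on_bump[of UNIV]]) auto
  qed (use t in auto)
  let ?I = "\<lambda>b y. bump 3 y / 6 * (t * (H (x + t *\<^sub>R y) b \<bullet> b)) +
      - (bump 2 y * (y \<bullet> b)) * (g (x + t *\<^sub>R y) \<bullet> b)"
  have 2: "integral bump_box (\<lambda>y. ?I b y) = 0" if b: "b \<in> Basis" for b
  proof (rule integration_by_parts_bump[where e=b])
    fix y :: 'a
    assume y: "norm y < 2"
    have xy: "x + t *\<^sub>R y \<in> ball x \<rho>"
      by (intro inb mem_bump_box) (use y t in auto)
    have "((\<lambda>s. x + t *\<^sub>R (y + s *\<^sub>R b)) has_derivative (\<lambda>h. t *\<^sub>R h *\<^sub>R b)) (at 0)"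
      by (auto intro!: derivative_eq_intros)
    from has_derivative_compose[OF this, of g "blinfun_apply (H (x + t *\<^sub>R y))"] has_C2D(2)[OF C xy]
    have "((\<lambda>s. g (x + t *\<^sub>R (y + s *\<^sub>R b))) has_derivative
        (\<lambda>h. H (x + t *\<^sub>R y) (t *\<^sub>R h *\<^sub>R b))) (at 0)"
      by simp
    from has_derivative_inner_left[OF this, of b]
    show "((\<lambda>s. g (x + t *\<^sub>R (y + s *\<^sub>R b)) \<bullet> b) has_real_derivative t * (H (x + t *\<^sub>R y) b \<bullet> b)) (at 0)"
      by (auto simp: has_field_derivative_def blinfun.scaleR_right elim!: has_derivative_eq_rhs)
  next
    have "x + t *\<^sub>R y \<in> ball x \<rho>" if "y \<in> ball 0 2" for y
      by (intro inb mem_bump_box) (use that t in auto)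
    then show "continuous_on (ball 0 2) (\<lambda>y. g (x + t *\<^sub>R y) \<bullet> b)"
      "continuous_on (ball 0 2) (\<lambda>y. t * (H (x + t *\<^sub>R y) b \<bullet> b))"
      by (intro continuous_intros continuous_on_compose2[OF cont(2)] continuous_on_compose2[OF cont(3)]; auto)+
  next
    fix y :: 'a
    have "((\<lambda>s. bump 3 (y + s *\<^sub>R b)) has_real_derivative - (6 * bump 2 y * (y \<bullet> b))) (at 0)"
      using has_real_derivative_bump_line[of 1 y b] by (simp add: numeral_eq_Suc)
    from DERIV_cdivide[OF this, of 6]
    show "((\<lambda>s. bump 3 (y + s *\<^sub>R b) / 6) has_real_derivative - (bump 2 y * (y \<bullet> b))) (at 0)"
      by simp
  next
    show "continuous_on UNIV (\<lambda>y::'a. bump 3 y / 6)" "continuous_on UNIV (\<lambda>y. - (bump 2 y * (y \<bullet> b)))"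
      by (intro continuous_intros; simp)+
    show "bump 3 y / 6 = 0" "- (bump 2 y * (y \<bullet> b)) = 0" if "norm y \<ge> 1" for y
      using that bump_eq_0[of y 2] bump_eq_0[of y 1] by (simp_all add: numeral_eq_Suc)
    show "norm b \<le> 1" using b by simp
  qed
  have i1: "(\<lambda>y. bump 3 y / 6 * blinfun_trace (H (x + t *\<^sub>R y))) integrable_on bump_box"
    and i2: "(\<lambda>y. bump 2 y * (g (x + t *\<^sub>R y) \<bullet> y)) integrable_on bump_box"
    and i3: "\<And>b. (\<lambda>y. ?I b y) integrable_on bump_box"
    using t inb
    by (intro integrable_continuous continuous_intros continuous_on_compose2[OF cont(2)]
         continuous_on_compose2[OF cont(3)]; auto)+
  have "0 = (\<Sum>b\<in>Basis. integral bump_box (\<lambda>y. ?I b y))"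
    using 2 by simp
  also have "\<dots> = integral bump_box (\<lambda>y. \<Sum>b\<in>Basis. ?I b y)"
    by (rule integral_sum[symmetric]) (use i3 in auto)
  also have "(\<lambda>y. \<Sum>b\<in>Basis. ?I b y) =
      (\<lambda>y. t * (bump 3 y / 6 * blinfun_trace (H (x + t *\<^sub>R y))) - bump 2 y * (g (x + t *\<^sub>R y) \<bullet> y))"
  proof (rule ext)
    fix y
    have "(\<Sum>b\<in>Basis. bump 3 y / 6 * (t * (H (x + t *\<^sub>R y) b \<bullet> b))) =
        t * (bump 3 y / 6 * blinfun_trace (H (x + t *\<^sub>R y)))"
      unfolding blinfun_trace_def sum_distrib_left by (intro sum.cong refl) (simp only: ac_simps)
    moreover have "(\<Sum>b\<in>Basis. - (bump 2 y * (y \<bullet> b)) * (g (x + t *\<^sub>R y) \<bullet> b)) =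
        - (bump 2 y * (g (x + t *\<^sub>R y) \<bullet> y))"
      unfolding euclidean_inner[of "g (x + t *\<^sub>R y)" y] sum_distrib_left sum_negf[symmetric]
      by (intro sum.cong refl) (simp add: ac_simps)
    ultimately show "(\<Sum>b\<in>Basis. ?I b y) =
      t * (bump 3 y / 6 * blinfun_trace (H (x + t *\<^sub>R y))) - bump 2 y * (g (x + t *\<^sub>R y) \<bullet> y)"
      unfolding sum.distrib by simp
  qed
  also have "integral bump_box \<dots> = t * integral bump_box (\<lambda>y. bump 3 y / 6 * blinfun_trace (H (x + t *\<^sub>R y)))
      - integral bump_box (\<lambda>y. bump 2 y * (g (x + t *\<^sub>R y) \<bullet> y))"
    using integral_diff[OF integrable_on_mult_right[OF i1, of t] i2] by simp
  finally show ?thesis using 1 by simp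
qed

lemma submean_value_inequality:
  fixes f :: "'a::euclidean_space \<Rightarrow> real"
  assumes C: "has_C2 (ball x \<rho>) f g H" and r: "0 \<le> r" "r * (2 * real DIM('a)) < \<rho>"
    and h: "\<And>y. y \<in> ball x \<rho> \<Longrightarrow> blinfun_trace (H y) \<ge> 0"
  shows "integral bump_box (bump 2 :: 'a \<Rightarrow> real) * f x \<le> integral bump_box (\<lambda>y. bump 2 y * f (x + r *\<^sub>R y))"
proof -
  let ?J = "\<lambda>t. integral bump_box (\<lambda>y. bump 2 y * f (x + t *\<^sub>R y))"
  let ?D = "\<lambda>t. t * integral bump_box (\<lambda>y. bump 3 y / 6 * blinfun_trace (H (x + t *\<^sub>R y)))"
  note cont = has_C2_continuous[OF C]
  have D: "?D t \<ge> 0" if t: "t \<in> {0..r}" for t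
  proof (rule mult_nonneg_nonneg[OF _ integral_nonneg])
    have inb: "x + t *\<^sub>R y \<in> ball x \<rho>" if "y \<in> bump_box" for y
      using t r that by (intro scaled_box_in_ball[of _ t r]) auto
    then show "(\<lambda>y. bump 3 y / 6 * blinfun_trace (H (x + t *\<^sub>R y))) integrable_on bump_box"
      by (intro integrable_continuous continuous_intros continuous_on_compose2[OF cont(3)]) auto
    show "0 \<le> bump 3 y / 6 * blinfun_trace (H (x + t *\<^sub>R y))" if "y \<in> bump_box" for y
      using h[OF inb[OF that]] bump_nonneg[of 3 y] by simp
  qed (use t in auto)
  have "?J 0 \<le> ?J r"
  proof (rule DERIV_nonneg_imp_increasing_open[OF r(1)])
    fix t assume t: "0 < t" "t < r"
    have "(?J has_real_derivative ?D t) (at t within {0..r})"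
      using t by (intro bump_mean_has_derivative[OF C r(2)]) auto
    then have "(?J has_real_derivative ?D t) (at t)"
      using t by (simp add: at_within_Icc_at)
    then show "\<exists>d. (?J has_real_derivative d) (at t) \<and> 0 \<le> d"
      using D[of t] t by auto
  next
    show "continuous_on {0..r} ?J"
      by (rule DERIV_continuous_on[where D="?D"]) (use bump_mean_has_derivative[OF C r(2)] in auto)
  qed
  also have "?J 0 = integral bump_box (bump 2 :: 'a \<Rightarrow> real) * f x" by simp
  finally show ?thesis .
qed

lemma mean_value_property:
  fixes f :: "'a::euclidean_space \<Rightarrow> real"
  assumes C: "has_C2 (ball x \<rho>) f g H" and r: "0 \<le> r" "r * (2 * real DIM('a)) < \<rho>"
    and h: "\<And>y. y \<in> ball x \<rho> \<Longrightarrow> blinfun_trace (H y) = 0"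
  shows "integral bump_box (\<lambda>y. bump 2 y * f (x + r *\<^sub>R y)) = integral bump_box (bump 2 :: 'a \<Rightarrow> real) * f x"
proof (rule antisym)
  show "integral bump_box (bump 2 :: 'a \<Rightarrow> real) * f x \<le> integral bump_box (\<lambda>y. bump 2 y * f (x + r *\<^sub>R y))"
    by (rule submean_value_inequality[OF C r]) (simp add: h)
  have "integral bump_box (bump 2 :: 'a \<Rightarrow> real) * (- 1 * f x) \<le> integral bump_box (\<lambda>y. bump 2 y * (- 1 * f (x + r *\<^sub>R y)))"
    by (rule submean_value_inequality[OF has_C2_cmult[OF C] r]) (simp only: blinfun_trace_simps, simp add: h)
  then show "integral bump_box (\<lambda>y. bump 2 y * f (x + r *\<^sub>R y)) \<le> integral bump_box (bump 2 :: 'a \<Rightarrow> real) * f x"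
    by simp
qed

text \<open>In the sub-mean-value inequality at a maximum the integrand \<open>bump 2 y * (f x - f (x + r y))\<close> is
  nonnegative with nonpositive integral, hence zero wherever the bump is positive.\<close>

lemma subharmonic_local_max_constant:
  fixes f :: "'a::euclidean_space \<Rightarrow> real"
  assumes C: "has_C2 (ball x \<rho>) f g H" and \<rho>: "\<rho> > 0"
    and h: "\<And>y. y \<in> ball x \<rho> \<Longrightarrow> blinfun_trace (H y) \<ge> 0"
    and m: "\<And>y. y \<in> ball x \<rho> \<Longrightarrow> f y \<le> f x"
  obtains \<delta> where "\<delta> > 0" "\<And>y. y \<in> ball x \<delta> \<Longrightarrow> f y = f x"
proof -
  define r where "r = \<rho> / (4 * real DIM('a))"
  have r: "r > 0" "r * (2 * real DIM('a)) < \<rho>" using \<rho> by (auto simp: r_def)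
  note cont = has_C2_continuous[OF C]
  have inb: "x + r *\<^sub>R y \<in> ball x \<rho>" if "y \<in> bump_box" for y
    using r that by (intro scaled_box_in_ball[of _ r r]) auto
  define D where "D = (\<lambda>y. bump 2 y * (f x - f (x + r *\<^sub>R y)))"
  have cD: "continuous_on bump_box D"
    unfolding D_def using inb by (intro continuous_intros continuous_on_compose2[OF cont(1)]) auto
  have D0: "D y \<ge> 0" if "y \<in> bump_box" for y
    unfolding D_def using m[OF inb[OF that]] bump_nonneg[of 2 y] by simp
  have i1: "(\<lambda>y. bump 2 y * f (x + r *\<^sub>R y)) integrable_on bump_box"
    using inb by (intro integrable_continuous continuous_intros continuous_on_compose2[OF cont(1)]) auto
  have i2: "(\<lambda>y::'a. bump 2 y * f x) integrable_on bump_box"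
    by (intro integrable_continuous continuous_intros)
  have "integral bump_box D = integral bump_box (\<lambda>y. bump 2 y * f x - bump 2 y * f (x + r *\<^sub>R y))"
    by (simp add: D_def algebra_simps)
  also have "\<dots> = integral bump_box (bump 2 :: 'a \<Rightarrow> real) * f x - integral bump_box (\<lambda>y. bump 2 y * f (x + r *\<^sub>R y))"
    by (subst integral_diff[OF i2 i1]) simp
  also have "\<dots> \<le> 0"
    using submean_value_inequality[OF C less_imp_le[OF r(1)] r(2) h] by simp
  finally have "integral bump_box D \<le> 0" .
  moreover have "integral bump_box D \<ge> 0"
    using cD D0 by (intro integral_nonneg integrable_continuous) auto
  ultimately have "integral bump_box D = 0" by simp
  moreover have "box (- (2 *\<^sub>R One)) (2 *\<^sub>R One) \<noteq> ({}::'a set)"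
    by (auto simp: box_ne_empty)
  ultimately have D_eq: "\<forall>y\<in>bump_box. D y = 0"
    using integral_cbox_eq_0_iff[OF cD _ D0] by blast
  show thesis
  proof (rule that[OF r(1)])
    fix y assume y: "y \<in> ball x r"
    define w where "w = (y - x) /\<^sub>R r"
    have w: "norm w < 1" "y = x + r *\<^sub>R w"
      using y r by (auto simp: w_def dist_norm norm_minus_commute divide_simps)
    then have "w \<in> bump_box" by (intro mem_bump_box) auto
    then show "f y = f x" using D_eq bump_pos[OF w(1), of 2] w(2) by (auto simp: D_def)
  qed
qed

section \<open>Harmonic functions and their derivatives\<close>

text \<open>The gradient is kept as an argument because all later estimates concern it.\<close>

definition harmonic_on :: "'a::euclidean_space set \<Rightarrow> ('a \<Rightarrow> real) \<Rightarrow> ('a \<Rightarrow> 'a) \<Rightarrow> bool" where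
  "harmonic_on S f g \<longleftrightarrow> (\<exists>H. has_C2 S f g H \<and> (\<forall>x\<in>S. blinfun_trace (H x) = 0))"

lemma harmonic_on_subset: "harmonic_on S f g \<Longrightarrow> T \<subseteq> S \<Longrightarrow> harmonic_on T f g"
  unfolding harmonic_on_def by (meson has_C2_subset subsetD)

lemma harmonic_on_derivative: "harmonic_on S f g \<Longrightarrow> x \<in> S \<Longrightarrow> (f has_derivative (\<lambda>w. g x \<bullet> w)) (at x)"
  unfolding harmonic_on_def by (blast intro: has_C2D)

lemma harmonic_on_continuous: 
  assumes "harmonic_on S f g" shows "continuous_on S f" "continuous_on S g"
  using assms unfolding harmonic_on_def by (blast intro: has_C2_continuous)+

lemma gradient_unique:
  assumes "(f has_derivative (\<lambda>w. a \<bullet> w)) (at x)" "(f has_derivative (\<lambda>w. b \<bullet> w)) (at x)"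
  shows "a = b"
proof -
  have "(\<lambda>w. a \<bullet> w) = (\<lambda>w. b \<bullet> w)" using has_derivative_unique[OF assms] .
  then show ?thesis by (metis vector_eq_rdot)
qed

text \<open>Gradient and Hessian are unique at every point of an open set, so the local ones agree on
  overlaps.\<close>

lemma harmonic_on_local:
  assumes "\<And>x. x \<in> S \<Longrightarrow> \<exists>e g. e > 0 \<and> ball x e \<subseteq> S \<and> harmonic_on (ball x e) f g"
  shows "\<exists>g. harmonic_on S f g"
proof -
  obtain e h where e: "\<And>x. x \<in> S \<Longrightarrow> e x > 0 \<and> ball x (e x) \<subseteq> S \<and> harmonic_on (ball x (e x)) f (h x)"
    using assms by metis
  then obtain K where K: "\<And>x. x \<in> S \<Longrightarrow> has_C2 (ball x (e x)) f (h x) (K x) \<and>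
      (\<forall>y\<in>ball x (e x). blinfun_trace (K x y) = 0)"
    unfolding harmonic_on_def by metis
  \<comment> \<open>Each point takes the gradient and the Hessian from its own ball.\<close>
  define g where "g = (\<lambda>x. h x x)"
  define H where "H = (\<lambda>x. K x x)"
  have g: "g y = h x y" if "x \<in> S" "y \<in> ball x (e x)" for x y
  proof -
    have "y \<in> S" using e that by blast
    then have "y \<in> ball y (e y)" using e by simp
    show ?thesis unfolding g_def
      by (rule gradient_unique[where x=y and f=f])
         (use has_C2D(1)[of _ f] K that \<open>y \<in> S\<close> \<open>y \<in> ball y (e y)\<close> in blast)+
  qed
  have dg: "(g has_derivative K x y) (at y)" if "x \<in> S" "y \<in> ball x (e x)" for x y
  proof (rule has_derivative_transform_within_open[OF _ open_ball])
    show "(h x has_derivative K x y) (at y)" using has_C2D(2) K that by blast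
  qed (use that g in auto)
  have H: "H y = K x y" if "x \<in> S" "y \<in> ball x (e x)" for x y
  proof -
    have "y \<in> S" using e that by blast
    then have "y \<in> ball y (e y)" using e by simp
    have "blinfun_apply (K y y) = blinfun_apply (K x y)"
      using has_derivative_unique[OF dg[OF \<open>y \<in> S\<close> \<open>y \<in> ball y (e y)\<close>] dg[OF that]] .
    then show ?thesis by (simp add: H_def blinfun_apply_inject)
  qed
  have "has_C2 S f g H"
    unfolding has_C2_def
  proof (intro conjI ballI continuous_at_imp_continuous_on)
    fix x assume x: "x \<in> S"
    then have xb: "x \<in> ball x (e x)" using e by simp
    show "(f has_derivative (\<lambda>w. g x \<bullet> w)) (at x)"
      using has_C2D(1) K x xb unfolding g_def by blast
    show "(g has_derivative blinfun_apply (H x)) (at x)"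
      using dg[OF x xb] by (simp add: H_def)
    have "isCont (K x) x"
      using has_C2_continuous(3)[of _ f] K x xb continuous_on_eq_continuous_at[OF open_ball] by blast
    moreover have "\<forall>\<^sub>F y in nhds x. K x y = H y"
      using eventually_nhds_in_open[OF open_ball xb] by eventually_elim (use H x in auto)
    ultimately show "isCont H x" using isCont_cong by metis
  qed
  moreover have "\<forall>x\<in>S. blinfun_trace (H x) = 0"
    using K e unfolding H_def by fastforce
  ultimately show ?thesis unfolding harmonic_on_def by blast
qed

lemma shifted_box_in_ball:
  fixes x :: "'a::euclidean_space"
  assumes "x \<in> ball x0 \<sigma>" "y \<in> bump_box" "0 \<le> r" "\<sigma> + r * (2 * real DIM('a)) \<le> \<rho>"
  shows "x + r *\<^sub>R y \<in> ball x0 \<rho>"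
proof -
  have "r * norm y \<le> r * (2 * real DIM('a))"
    using norm_bump_box[OF assms(2)] assms(3) by (intro mult_left_mono) auto
  then have "norm (r *\<^sub>R y) \<le> r * (2 * real DIM('a))" using assms(3) by simp
  then show ?thesis
    using assms(1,4) norm_triangle_ineq[of "x - x0" "r *\<^sub>R y"]
    by (simp add: dist_norm norm_minus_commute algebra_simps)
qed

lemma mollification_has_derivative:
  fixes F :: "'a::euclidean_space \<Rightarrow> 'b::banach" and D :: "'a \<Rightarrow> 'a \<Rightarrow>\<^sub>L 'b"
  assumes d: "\<And>z. z \<in> ball x0 \<rho> \<Longrightarrow> (F has_derivative D z) (at z)"
    and cD: "continuous_on (ball x0 \<rho>) D" and k: "continuous_on UNIV \<kappa>"
    and r: "0 \<le> r" and \<sigma>: "\<sigma> + r * (2 * real DIM('a)) \<le> \<rho>"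
  shows "x \<in> ball x0 \<sigma> \<Longrightarrow> ((\<lambda>x. integral bump_box (\<lambda>y. \<kappa> y *\<^sub>R F (x + r *\<^sub>R y))) has_derivative
           integral bump_box (\<lambda>y. \<kappa> y *\<^sub>R D (x + r *\<^sub>R y))) (at x)"
    and "continuous_on (ball x0 \<sigma>) (\<lambda>x. integral bump_box (\<lambda>y. \<kappa> y *\<^sub>R D (x + r *\<^sub>R y)))"
proof -
  note inb = shifted_box_in_ball[OF _ _ r \<sigma>]
  have cF: "continuous_on (ball x0 \<rho>) F"
    by (rule has_derivative_continuous_on, rule has_derivative_at_withinI, rule d)
  have ck: "continuous_on (ball x0 \<sigma> \<times> bump_box) (\<lambda>(x, y). \<kappa> y *\<^sub>R D (x + r *\<^sub>R y))"
    unfolding split_beta using inb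
    by (intro continuous_intros continuous_on_compose2[OF k] continuous_on_compose2[OF cD]) auto
  show "((\<lambda>x. integral bump_box (\<lambda>y. \<kappa> y *\<^sub>R F (x + r *\<^sub>R y))) has_derivative
           integral bump_box (\<lambda>y. \<kappa> y *\<^sub>R D (x + r *\<^sub>R y))) (at x)" if x: "x \<in> ball x0 \<sigma>"
  proof -
    have "((\<lambda>x. integral bump_box (\<lambda>y. \<kappa> y *\<^sub>R F (x + r *\<^sub>R y))) has_derivative
           integral bump_box (\<lambda>y. \<kappa> y *\<^sub>R D (x + r *\<^sub>R y))) (at x within ball x0 \<sigma>)"
    proof (rule leibniz_rule)
      fix z y assume zy: "z \<in> ball x0 \<sigma>" "y \<in> (bump_box :: 'a set)"
      have "((\<lambda>x. x + r *\<^sub>R y) has_derivative (\<lambda>h. h)) (at z within ball x0 \<sigma>)"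
        by (auto intro!: derivative_eq_intros)
      from has_derivative_scaleR_right[OF has_derivative_compose[OF this d[OF inb[OF zy]]], of "\<kappa> y"]
      show "((\<lambda>x. \<kappa> y *\<^sub>R F (x + r *\<^sub>R y)) has_derivative blinfun_apply (\<kappa> y *\<^sub>R D (z + r *\<^sub>R y)))
        (at z within ball x0 \<sigma>)"
        by (rule has_derivative_eq_rhs) (auto simp: blinfun.scaleR_left)
    next
      show "(\<lambda>y. \<kappa> y *\<^sub>R F (z + r *\<^sub>R y)) integrable_on bump_box" if "z \<in> ball x0 \<sigma>" for z
        using inb[OF that]
        by (intro integrable_continuous continuous_intros continuous_on_compose2[OF cF]
            continuous_on_subset[OF k]) auto
    qed (use ck x in auto)
    then show ?thesis using x by (simp add: at_within_open[OF _ open_ball])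
  qed
  show "continuous_on (ball x0 \<sigma>) (\<lambda>x. integral bump_box (\<lambda>y. \<kappa> y *\<^sub>R D (x + r *\<^sub>R y)))"
    by (rule integral_continuous_on_param[OF ck])
qed

text \<open>Differentiation falls on \<open>f\<close>, so averages of translates of \<open>f\<close> inherit two derivatives and the
  vanishing of the Laplacian.\<close>

lemma mollification_harmonic:
  fixes f :: "'a::euclidean_space \<Rightarrow> real"
  assumes h: "harmonic_on (ball x0 \<rho>) f g" and k: "continuous_on UNIV \<kappa>"
    and r: "0 \<le> r" and \<sigma>: "\<sigma> + r * (2 * real DIM('a)) \<le> \<rho>"
  shows "harmonic_on (ball x0 \<sigma>) (\<lambda>x. integral bump_box (\<lambda>y. \<kappa> y * f (x + r *\<^sub>R y)))
     (\<lambda>x. integral bump_box (\<lambda>y. \<kappa> y *\<^sub>R g (x + r *\<^sub>R y)))"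
proof -
  obtain H where C: "has_C2 (ball x0 \<rho>) f g H" and tr: "\<And>x. x \<in> ball x0 \<rho> \<Longrightarrow> blinfun_trace (H x) = 0"
    using h unfolding harmonic_on_def by blast
  note cont = has_C2_continuous[OF C]
  let ?H = "\<lambda>x. integral bump_box (\<lambda>y. \<kappa> y *\<^sub>R H (x + r *\<^sub>R y))"
  note inb = shifted_box_in_ball[OF _ _ r \<sigma>]
  have ig: "(\<lambda>y. \<kappa> y *\<^sub>R g (x + r *\<^sub>R y)) integrable_on bump_box"
    and iH: "(\<lambda>y. \<kappa> y *\<^sub>R H (x + r *\<^sub>R y)) integrable_on bump_box" if "x \<in> ball x0 \<sigma>" for x
    using inb[OF that]
    by (intro integrable_continuous continuous_intros continuous_on_compose2[OF cont(2)]
        continuous_on_compose2[OF cont(3)] continuous_on_subset[OF k]; auto)+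
  have "has_C2 (ball x0 \<sigma>) (\<lambda>x. integral bump_box (\<lambda>y. \<kappa> y * f (x + r *\<^sub>R y)))
     (\<lambda>x. integral bump_box (\<lambda>y. \<kappa> y *\<^sub>R g (x + r *\<^sub>R y))) ?H"
    unfolding has_C2_def
  proof (intro conjI ballI)
    fix x assume x: "x \<in> ball x0 \<sigma>"
    have ir: "(\<lambda>y. \<kappa> y *\<^sub>R blinfun_inner_right (g (x + r *\<^sub>R y))) integrable_on bump_box"
      using inb[OF x]
      by (intro integrable_continuous continuous_intros bounded_linear.continuous_on[OF bounded_linear_blinfun_inner_right]
        continuous_on_compose2[OF cont(2)] continuous_on_subset[OF k]) auto
    have "((\<lambda>x. integral bump_box (\<lambda>y. \<kappa> y *\<^sub>R f (x + r *\<^sub>R y))) has_derivative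
           integral bump_box (\<lambda>y. \<kappa> y *\<^sub>R blinfun_inner_right (g (x + r *\<^sub>R y)))) (at x)"
    proof (rule mollification_has_derivative(1)[OF _ _ k r \<sigma> x])
      show "(f has_derivative blinfun_inner_right (g z)) (at z)" if "z \<in> ball x0 \<rho>" for z
        using has_C2D(1)[OF C that] by simp
      show "continuous_on (ball x0 \<rho>) (\<lambda>x. blinfun_inner_right (g x))"
        by (intro bounded_linear.continuous_on[OF bounded_linear_blinfun_inner_right] cont)
    qed
    moreover have "blinfun_apply (integral bump_box (\<lambda>y. \<kappa> y *\<^sub>R blinfun_inner_right (g (x + r *\<^sub>R y)))) =
        (\<lambda>w. integral bump_box (\<lambda>y. \<kappa> y *\<^sub>R g (x + r *\<^sub>R y)) \<bullet> w)"
      using integral_linear[OF ig[OF x] bounded_linear_inner_left]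
      by (intro ext) (simp add: blinfun_apply_integral[OF ir] blinfun.scaleR_left o_def)
    ultimately show "((\<lambda>x. integral bump_box (\<lambda>y. \<kappa> y * f (x + r *\<^sub>R y))) has_derivative
       (\<lambda>w. integral bump_box (\<lambda>y. \<kappa> y *\<^sub>R g (x + r *\<^sub>R y)) \<bullet> w)) (at x)" by simp
    show "((\<lambda>x. integral bump_box (\<lambda>y. \<kappa> y *\<^sub>R g (x + r *\<^sub>R y))) has_derivative blinfun_apply (?H x)) (at x)"
      by (rule mollification_has_derivative(1)[OF has_C2D(2)[OF C] cont(3) k r \<sigma> x])
  next
    show "continuous_on (ball x0 \<sigma>) ?H"
      by (rule mollification_has_derivative(2)[OF has_C2D(2)[OF C] cont(3) k r \<sigma>])
  qed
  moreover have "blinfun_trace (?H x) = 0" if x: "x \<in> ball x0 \<sigma>" for x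
  proof -
    have ib: "(\<lambda>y. (\<kappa> y *\<^sub>R H (x + r *\<^sub>R y)) b \<bullet> b) integrable_on bump_box" for b
      using inb[OF x] by (intro integrable_continuous continuous_intros
        continuous_on_compose2[OF cont(3)] continuous_on_subset[OF k]) auto
    have ib': "(\<lambda>y. (\<kappa> y *\<^sub>R H (x + r *\<^sub>R y)) b) integrable_on bump_box" for b
      using inb[OF x] by (intro integrable_continuous continuous_intros
        continuous_on_compose2[OF cont(3)] continuous_on_subset[OF k]) auto
    have "?H x b \<bullet> b = integral bump_box (\<lambda>y. (\<kappa> y *\<^sub>R H (x + r *\<^sub>R y)) b \<bullet> b)" for b
      using integral_linear[OF ib' bounded_linear_inner_left, of b]
      by (simp add: blinfun_apply_integral[OF iH[OF x]] o_def)
    then have "blinfun_trace (?H x) = integral bump_box (\<lambda>y. \<Sum>b\<in>Basis. (\<kappa> y *\<^sub>R H (x + r *\<^sub>R y)) b \<bullet> b)"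
      unfolding blinfun_trace_def by (simp add: integral_sum ib)
    also have "\<dots> = integral bump_box (\<lambda>y::'a. 0)"
    proof (rule integral_cong)
      fix y :: 'a assume "y \<in> bump_box"
      then have "(\<Sum>b\<in>Basis. H (x + r *\<^sub>R y) b \<bullet> b) = 0"
        using tr[OF inb[OF x]] by (simp add: blinfun_trace_def)
      then show "(\<Sum>b\<in>Basis. (\<kappa> y *\<^sub>R H (x + r *\<^sub>R y)) b \<bullet> b) = 0"
        by (simp add: blinfun.scaleR_left flip: sum_distrib_left)
    qed
    finally show ?thesis by simp
  qed
  ultimately show ?thesis unfolding harmonic_on_def by blast
qed

lemma integral_bump_pos: "integral bump_box (bump k :: 'a::euclidean_space \<Rightarrow> real) > 0"
proof -
  have c: "continuous_on bump_box (bump k :: 'a \<Rightarrow> real)" by (rule continuous_on_bump)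
  have "integral bump_box (bump k :: 'a \<Rightarrow> real) \<ge> 0"
    using c by (intro integral_nonneg integrable_continuous bump_nonneg)
  moreover have "integral bump_box (bump k :: 'a \<Rightarrow> real) \<noteq> 0"
  proof
    assume "integral bump_box (bump k :: 'a \<Rightarrow> real) = 0"
    moreover have "box (- (2 *\<^sub>R One)) (2 *\<^sub>R One) \<noteq> ({}::'a set)" by (auto simp: box_ne_empty)
    ultimately have "\<forall>y\<in>bump_box. bump k (y::'a) = 0"
      using integral_cbox_eq_0_iff[OF c _ bump_nonneg] by blast
    then show False using bump_pos[of "0::'a" k] mem_bump_box[of "0::'a"] by auto
  qed
  ultimately show ?thesis by simp
qed

text \<open>Differentiate the mean value property in \<open>x\<close> and integrate by parts: the derivative moves to the
  kernel \<open>bump 2\<close>. The right-hand side involves \<open>f\<close> alone, which yields both a bound for the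
  gradient by the size of \<open>f\<close> and, since it is again a mollification of \<open>f\<close>, the harmonicity of the
  derivative.\<close>

lemma harmonic_gradient_formula:
  fixes f :: "'a::euclidean_space \<Rightarrow> real"
  assumes h: "harmonic_on (ball x \<rho>) f g" and r: "0 < r" "r * (2 * real DIM('a)) < \<rho>" and v: "norm v \<le> 1"
  shows "g x \<bullet> v = integral bump_box (\<lambda>y. (4 * bump 1 y * (y \<bullet> v)) * f (x + r *\<^sub>R y))
      / (r * integral bump_box (bump 2 :: 'a \<Rightarrow> real))"
proof -
  let ?I = "integral bump_box (bump 2 :: 'a \<Rightarrow> real)"
  obtain H where C: "has_C2 (ball x \<rho>) f g H" and tr: "\<And>x'. x' \<in> ball x \<rho> \<Longrightarrow> blinfun_trace (H x') = 0"
    using h unfolding harmonic_on_def by blast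
  note cont = has_C2_continuous[OF C]
  have inb: "x + r *\<^sub>R y \<in> ball x \<rho>" if "y \<in> bump_box" for y
    using that r by (intro scaled_box_in_ball[of y r r]) auto
  define \<sigma> where "\<sigma> = \<rho> - r * (2 * real DIM('a))"
  have \<sigma>: "\<sigma> > 0" "\<sigma> + r * (2 * real DIM('a)) \<le> \<rho>" using r by (auto simp: \<sigma>_def)
  have hm: "harmonic_on (ball x \<sigma>) (\<lambda>x. integral bump_box (\<lambda>y. bump 2 y * f (x + r *\<^sub>R y)))
     (\<lambda>x. integral bump_box (\<lambda>y. bump 2 y *\<^sub>R g (x + r *\<^sub>R y)))"
    by (rule mollification_harmonic[OF h continuous_on_bump _ \<sigma>(2)]) (use r in auto)
  have mv: "integral bump_box (\<lambda>y. bump 2 y * f (z + r *\<^sub>R y)) = ?I * f z" if z: "z \<in> ball x \<sigma>" for z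
  proof (rule mean_value_property)
    have sub: "ball z (\<rho> - dist x z) \<subseteq> ball x \<rho>"
      by (auto simp: dist_commute) (smt (verit) dist_commute dist_triangle)
    show "has_C2 (ball z (\<rho> - dist x z)) f g H" by (rule has_C2_subset[OF C sub])
    show "blinfun_trace (H y) = 0" if "y \<in> ball z (\<rho> - dist x z)" for y using tr that sub by blast
  qed (use z r in \<open>auto simp: \<sigma>_def\<close>)
  have "((\<lambda>z. ?I * f z) has_derivative (\<lambda>w. integral bump_box (\<lambda>y. bump 2 y *\<^sub>R g (x + r *\<^sub>R y)) \<bullet> w)) (at x)"
    by (rule has_derivative_transform_within_open[OF harmonic_on_derivative[OF hm] open_ball _ mv])
       (use \<sigma> in auto)
  moreover have "((\<lambda>z. ?I * f z) has_derivative (\<lambda>w. (?I *\<^sub>R g x) \<bullet> w)) (at x)"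
    using has_derivative_mult_right[OF has_C2D(1)[OF C, of x], of ?I] r
    by (simp add: order.strict_trans1[of 0 "r * (2 * real DIM('a))" \<rho>])
  ultimately have "?I *\<^sub>R g x = integral bump_box (\<lambda>y. bump 2 y *\<^sub>R g (x + r *\<^sub>R y))"
    by (rule gradient_unique[symmetric])
  from arg_cong[OF this, of "\<lambda>a. a \<bullet> v"]
  have "?I * (g x \<bullet> v) = integral bump_box (\<lambda>y. bump 2 y *\<^sub>R g (x + r *\<^sub>R y)) \<bullet> v"
    by (simp only: inner_scaleR_left)
  also have "\<dots> = integral bump_box (\<lambda>y. bump 2 y * (g (x + r *\<^sub>R y) \<bullet> v))"
  proof -
    have "(\<lambda>y. bump 2 y *\<^sub>R g (x + r *\<^sub>R y)) integrable_on bump_box"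
      using inb by (intro integrable_continuous continuous_intros continuous_on_compose2[OF cont(2)]) auto
    from integral_linear[OF this bounded_linear_inner_left, of v] show ?thesis by (simp add: o_def)
  qed
  finally have 1: "?I * (g x \<bullet> v) = integral bump_box (\<lambda>y. bump 2 y * (g (x + r *\<^sub>R y) \<bullet> v))" .
  have inb2: "x + r *\<^sub>R y \<in> ball x \<rho>" if "norm y < 2" for y
    by (intro inb mem_bump_box) (use that in auto)
  have "integral bump_box (\<lambda>y. bump 2 y * (r * (g (x + r *\<^sub>R y) \<bullet> v)) + - (4 * bump 1 y * (y \<bullet> v)) * f (x + r *\<^sub>R y)) = 0"
  proof (rule integration_by_parts_bump[where e=v])
    fix y :: 'a assume "norm y < 2"
    note xy = inb2[OF this]
    have "((\<lambda>s. x + r *\<^sub>R (y + s *\<^sub>R v)) has_derivative (\<lambda>h. r *\<^sub>R h *\<^sub>R v)) (at 0)"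
      by (auto intro!: derivative_eq_intros)
    moreover have "(f has_derivative (\<lambda>w. g (x + r *\<^sub>R y) \<bullet> w)) (at (x + r *\<^sub>R (y + 0 *\<^sub>R v)))"
      using has_C2D(1)[OF C xy] by simp
    ultimately have "((\<lambda>s. f (x + r *\<^sub>R (y + s *\<^sub>R v))) has_derivative
        (\<lambda>h. g (x + r *\<^sub>R y) \<bullet> (r *\<^sub>R h *\<^sub>R v))) (at 0)"
      by (rule has_derivative_compose)
    then show "((\<lambda>s. f (x + r *\<^sub>R (y + s *\<^sub>R v))) has_real_derivative r * (g (x + r *\<^sub>R y) \<bullet> v)) (at 0)"
      by (auto simp: has_field_derivative_def elim!: has_derivative_eq_rhs)
  next
    show "continuous_on (ball 0 2) (\<lambda>y. f (x + r *\<^sub>R y))"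
      "continuous_on (ball 0 2) (\<lambda>y. r * (g (x + r *\<^sub>R y) \<bullet> v))"
      using inb2 by (intro continuous_intros continuous_on_compose2[OF cont(1)] continuous_on_compose2[OF cont(2)]; auto)+
  next
    fix y :: 'a
    show "((\<lambda>s. bump 2 (y + s *\<^sub>R v)) has_real_derivative - (4 * bump 1 y * (y \<bullet> v))) (at 0)"
      using has_real_derivative_bump_line[of 0 y v] by (simp add: numeral_eq_Suc)
  next
    show "continuous_on UNIV (bump 2 :: 'a \<Rightarrow> real)" "continuous_on UNIV (\<lambda>y. - (4 * bump 1 y * (y \<bullet> v)))"
      by (intro continuous_intros)+
    show "bump 2 y = 0" "- (4 * bump 1 y * (y \<bullet> v)) = 0" if "norm y \<ge> 1" for y
      using that bump_eq_0[of y 1] bump_eq_0[of y 0] by (simp_all add: numeral_eq_Suc)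
  qed (rule v)
  also have "(\<lambda>y. bump 2 y * (r * (g (x + r *\<^sub>R y) \<bullet> v)) + - (4 * bump 1 y * (y \<bullet> v)) * f (x + r *\<^sub>R y)) =
      (\<lambda>y. r * (bump 2 y * (g (x + r *\<^sub>R y) \<bullet> v)) - (4 * bump 1 y * (y \<bullet> v)) * f (x + r *\<^sub>R y))"
    by (rule ext) (simp add: ac_simps)
  also have "integral bump_box \<dots> = r * integral bump_box (\<lambda>y. bump 2 y * (g (x + r *\<^sub>R y) \<bullet> v))
      - integral bump_box (\<lambda>y. (4 * bump 1 y * (y \<bullet> v)) * f (x + r *\<^sub>R y))"
  proof -
    have "(\<lambda>y. bump 2 y * (g (x + r *\<^sub>R y) \<bullet> v)) integrable_on bump_box"
      "(\<lambda>y. (4 * bump 1 y * (y \<bullet> v)) * f (x + r *\<^sub>R y)) integrable_on bump_box"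
      using inb by (intro integrable_continuous continuous_intros continuous_on_compose2[OF cont(2)]
          continuous_on_compose2[OF cont(1)]; auto)+
    from integral_diff[OF integrable_on_mult_right[OF this(1), of r] this(2)] show ?thesis by simp
  qed
  finally show ?thesis using 1 r(1) integral_bump_pos[of 2, where 'a='a]
    by (simp add: field_simps)
qed

lemma harmonic_on_cong:
  assumes "harmonic_on S f g" "open S" "\<And>x. x \<in> S \<Longrightarrow> f x = f' x"
  shows "harmonic_on S f' g"
proof -
  obtain H where C: "has_C2 S f g H" and tr: "\<forall>x\<in>S. blinfun_trace (H x) = 0"
    using assms(1) unfolding harmonic_on_def by blast
  have "(f' has_derivative (\<lambda>w. g x \<bullet> w)) (at x)" if "x \<in> S" for x
    by (rule has_derivative_transform_within_open[OF has_C2D(1)[OF C that] assms(2) that assms(3)])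
  then have "has_C2 S f' g H" using C unfolding has_C2_def by blast
  then show ?thesis using tr unfolding harmonic_on_def by blast
qed

lemma harmonic_on_cmult:
  assumes "harmonic_on S f g" shows "harmonic_on S (\<lambda>x. c * f x) (\<lambda>x. c *\<^sub>R g x)"
proof -
  obtain H where H: "has_C2 S f g H" "\<forall>x\<in>S. blinfun_trace (H x) = 0"
    using assms unfolding harmonic_on_def by blast
  then show ?thesis
    unfolding harmonic_on_def by (intro exI[of _ "\<lambda>x. c *\<^sub>R H x"]) (simp add: has_C2_cmult)
qed

text \<open>The gradient formula writes the derivative locally as a mollification of \<open>f\<close>. By iteration,
  harmonic functions are infinitely differentiable.\<close>

lemma harmonic_on_directional_derivative:
  fixes f :: "'a::euclidean_space \<Rightarrow> real"
  assumes h: "harmonic_on S f g" and S: "open S" and v: "norm v \<le> 1"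
  shows "\<exists>g'. harmonic_on S (\<lambda>x. g x \<bullet> v) g'"
proof (rule harmonic_on_local)
  fix x assume "x \<in> S"
  then obtain \<rho> where \<rho>: "\<rho> > 0" "ball x \<rho> \<subseteq> S" using S open_contains_ball by blast
  define r where "r = \<rho> / (8 * real DIM('a))"
  have r: "r > 0" "r * (2 * real DIM('a)) = \<rho> / 4" using \<rho> by (auto simp: r_def)
  let ?c = "r * integral bump_box (bump 2 :: 'a \<Rightarrow> real)"
  let ?k = "\<lambda>y::'a. 4 * bump 1 y * (y \<bullet> v)"
  have "harmonic_on (ball x (\<rho>/2)) (\<lambda>x. integral bump_box (\<lambda>y. ?k y * f (x + r *\<^sub>R y)))
     (\<lambda>x. integral bump_box (\<lambda>y. ?k y *\<^sub>R g (x + r *\<^sub>R y)))"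
    by (rule mollification_harmonic[OF harmonic_on_subset[OF h \<rho>(2)]])
       (use r \<rho> in \<open>auto intro!: continuous_intros\<close>)
  from harmonic_on_cmult[OF this, of "1 / ?c"]
  have "harmonic_on (ball x (\<rho>/2)) (\<lambda>x. g x \<bullet> v) (\<lambda>x. (1 / ?c) *\<^sub>R integral bump_box (\<lambda>y. ?k y *\<^sub>R g (x + r *\<^sub>R y)))"
  proof (rule harmonic_on_cong)
    fix z assume z: "z \<in> ball x (\<rho>/2)"
    have sub: "ball z (\<rho>/2) \<subseteq> S"
    proof
      fix w assume "w \<in> ball z (\<rho>/2)"
      then have "dist x w < \<rho>" using z dist_triangle[of x w z] by simp
      then show "w \<in> S" using \<rho> by auto
    qed
    show "1 / ?c * integral bump_box (\<lambda>y. ?k y * f (z + r *\<^sub>R y)) = g z \<bullet> v"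
      using harmonic_gradient_formula[OF harmonic_on_subset[OF h sub] r(1) _ v] r(2) \<rho>(1) by simp
  qed auto
  moreover have "ball x (\<rho>/2) \<subseteq> S" using \<rho> subset_ball[of "\<rho>/2" \<rho> x] by auto
  moreover have "\<rho>/2 > 0" using \<rho> by simp
  ultimately show "\<exists>e g'. e > 0 \<and> ball x e \<subseteq> S \<and> harmonic_on (ball x e) (\<lambda>x. g x \<bullet> v) g'"
    by blast
qed

lemma harmonic_gradient_estimate:
  obtains C where "C > 0"
    "\<And>(f :: 'a::euclidean_space \<Rightarrow> real) g x \<rho> M. \<lbrakk>harmonic_on (ball x \<rho>) f g; \<rho> > 0;
        \<And>y. y \<in> ball x \<rho> \<Longrightarrow> \<bar>f y\<bar> \<le> M\<rbrakk> \<Longrightarrow> norm (g x) \<le> C * M / \<rho>"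
proof -
  let ?I = "integral bump_box (bump 2 :: 'a \<Rightarrow> real)" and ?I1 = "integral bump_box (bump 1 :: 'a \<Rightarrow> real)"
  let ?C = "16 * real DIM('a) * ?I1 / ?I"
  have I: "?I > 0" "?I1 > 0" by (rule integral_bump_pos)+
  show thesis
  proof (rule that[of ?C])
    show "?C > 0" using I by simp
    fix f :: "'a \<Rightarrow> real" and g x \<rho> M
    assume h: "harmonic_on (ball x \<rho>) f g" and \<rho>: "\<rho> > 0" and M: "\<And>y. y \<in> ball x \<rho> \<Longrightarrow> \<bar>f y\<bar> \<le> M"
    define r where "r = \<rho> / (4 * real DIM('a))"
    have r: "r > 0" "r * (2 * real DIM('a)) < \<rho>" using \<rho> by (auto simp: r_def)
    define v where "v = g x /\<^sub>R norm (g x)"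
    have v: "norm v \<le> 1" by (cases "g x = 0") (auto simp: v_def)
    have gv: "g x \<bullet> v = norm (g x)"
      by (cases "g x = 0") (simp_all add: v_def dot_square_norm power2_eq_square)
    have inb: "x + r *\<^sub>R y \<in> ball x \<rho>" if "y \<in> bump_box" for y
      using that r by (intro scaled_box_in_ball[of y r r]) auto
    have M0: "M \<ge> 0" using M[of x] \<rho> by (smt (verit) centre_in_ball)
    have "norm (integral bump_box (\<lambda>y. (4 * bump 1 y * (y \<bullet> v)) * f (x + r *\<^sub>R y)))
        \<le> integral bump_box (\<lambda>y::'a. 4 * M * bump 1 y)"
    proof (rule integral_norm_bound_integral)
      show "(\<lambda>y. (4 * bump 1 y * (y \<bullet> v)) * f (x + r *\<^sub>R y)) integrable_on bump_box"
        using inb by (intro integrable_continuous continuous_intros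
            continuous_on_compose2[OF harmonic_on_continuous(1)[OF h]]) auto
      show "(\<lambda>y::'a. 4 * M * bump 1 y) integrable_on bump_box"
        by (intro integrable_continuous continuous_intros)
      fix y :: 'a assume y: "y \<in> bump_box"
      have b: "bump 1 y * \<bar>y \<bullet> v\<bar> \<le> bump 1 y"
      proof (cases "norm y < 1")
        case True
        then have "\<bar>y \<bullet> v\<bar> \<le> 1"
          using Cauchy_Schwarz_ineq2[of y v] v mult_mono[of "norm y" 1 "norm v" 1] by simp
        then show ?thesis using mult_left_mono[OF _ bump_nonneg, of "\<bar>y \<bullet> v\<bar>" 1 1 y] by simp
      next
        case False then show ?thesis using bump_eq_0[of y 0] by simp
      qed
      have "norm ((4 * bump 1 y * (y \<bullet> v)) * f (x + r *\<^sub>R y)) = 4 * (bump 1 y * \<bar>y \<bullet> v\<bar>) * \<bar>f (x + r *\<^sub>R y)\<bar>"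
        using bump_nonneg[of 1 y] by (simp add: abs_mult)
      also have "\<dots> \<le> 4 * bump 1 y * M"
        using b M[OF inb[OF y]] bump_nonneg[of 1 y] by (intro mult_mono) auto
      finally show "norm ((4 * bump 1 y * (y \<bullet> v)) * f (x + r *\<^sub>R y)) \<le> 4 * M * bump 1 y"
        by (simp add: ac_simps)
    qed
    then have bd: "\<bar>integral bump_box (\<lambda>y. (4 * bump 1 y * (y \<bullet> v)) * f (x + r *\<^sub>R y))\<bar> \<le> 4 * M * ?I1"
      by simp
    have "norm (g x) = integral bump_box (\<lambda>y. (4 * bump 1 y * (y \<bullet> v)) * f (x + r *\<^sub>R y)) / (r * ?I)"
      using harmonic_gradient_formula[OF h r v] gv by simp
    also have "\<dots> \<le> (4 * M * ?I1) / (r * ?I)"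
      using bd r(1) I by (intro divide_right_mono) auto
    also have "\<dots> = ?C * M / \<rho>" using I by (simp add: r_def field_simps)
    finally show "norm (g x) \<le> ?C * M / \<rho>" .
  qed
qed

section \<open>The maximum principle\<close>

text \<open>The points where a positive maximum is attained form a compact set. A neighbourhood of each of
  its points in the open set belongs to it by the local statement, which is impossible at the point
  farthest from the origin.\<close>

lemma maximum_principle:
  fixes f :: "'a::euclidean_space \<Rightarrow> real"
  assumes G: "open G" and C: "has_C2 G f g H" and c: "continuous_on (closure G) f"
    and h: "\<And>x. x \<in> G \<Longrightarrow> blinfun_trace (H x) \<ge> 0"
    and b: "\<And>x. x \<in> frontier G \<Longrightarrow> f x \<le> 0"
    and i: "\<And>e. e > 0 \<Longrightarrow> \<exists>R. \<forall>x\<in>G. norm x \<ge> R \<longrightarrow> f x < e"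
    and x: "x \<in> G"
  shows "f x \<le> 0"
proof (rule ccontr)
  assume "\<not> f x \<le> 0"
  then have fx: "f x > 0" by simp
  obtain R where R: "\<forall>y\<in>G. norm y \<ge> R \<longrightarrow> f y < f x" using i[OF fx] by blast
  let ?K = "closure G \<inter> cball 0 (max R (norm x))"
  have K: "compact ?K" by (simp add: closed_Int_compact)
  have xK: "x \<in> ?K" using x closure_subset by auto
  have cK: "continuous_on ?K f" using c by (rule continuous_on_subset) auto
  obtain m where m: "m \<in> ?K" "\<And>y. y \<in> ?K \<Longrightarrow> f y \<le> f m"
    using continuous_attains_sup[OF K _ cK] xK by blast
  have top: "f y \<le> f m" if "y \<in> G" for y
  proof (cases "norm y \<le> max R (norm x)")
    case True then show ?thesis using m(2) that closure_subset by auto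
  next
    case False then have "f y < f x" using R that by auto
    then show ?thesis using m(2)[OF xK] by simp
  qed
  have fm: "f m > 0" using m(2)[OF xK] fx by simp
  let ?A = "{y\<in>?K. f y \<ge> f m}"
  have cA: "compact ?A"
  proof -
    have "closed (?K \<inter> f -` {f m..})"
      by (intro continuous_closed_preimage cK compact_imp_closed K closed_atLeast)
    then have "compact (?K \<inter> (?K \<inter> f -` {f m..}))" by (rule compact_Int_closed[OF K])
    moreover have "?K \<inter> (?K \<inter> f -` {f m..}) = ?A" by auto
    ultimately show ?thesis by simp
  qed
  have "m \<in> ?A" using m(1) by auto
  then obtain p where p: "p \<in> ?A" "\<And>y. y \<in> ?A \<Longrightarrow> norm y \<le> norm p"
    using continuous_attains_sup[OF cA _ continuous_on_norm_id] by blast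
  have "p \<notin> frontier G" using b p(1) fm by fastforce
  then have pG: "p \<in> G" using p(1) G by (auto simp: frontier_def interior_open)
  have fp: "f p = f m" using p(1) m(2) by force
  obtain \<rho> where \<rho>: "\<rho> > 0" "ball p \<rho> \<subseteq> G" using G pG open_contains_ball by blast
  obtain \<delta> where \<delta>: "\<delta> > 0" "\<And>y. y \<in> ball p \<delta> \<Longrightarrow> f y = f p"
  proof (rule subharmonic_local_max_constant[OF has_C2_subset[OF C \<rho>(2)] \<rho>(1)])
    show "f y \<le> f p" if "y \<in> ball p \<rho>" for y using top \<rho>(2) that fp by auto
    show "blinfun_trace (H y) \<ge> 0" if "y \<in> ball p \<rho>" for y using h \<rho>(2) that by auto
  qed blast
  \<comment> \<open>A unit vector in whose direction the norm grows at \<open>p\<close>.\<close>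
  define e :: 'a where "e = (if p = 0 then (SOME b. b \<in> Basis) else p /\<^sub>R norm p)"
  have e: "norm e = 1" by (auto simp: e_def some_in_eq nonempty_Basis)
  have pe: "p = norm p *\<^sub>R e" by (auto simp: e_def)
  define s where "s = min \<delta> \<rho> / 2"
  have s: "s > 0" "s < \<delta>" "s < \<rho>" using \<delta> \<rho> by (auto simp: s_def)
  let ?q = "p + s *\<^sub>R e"
  have "?q = (norm p + s) *\<^sub>R e" using pe by (metis scaleR_add_left)
  then have nq: "norm ?q = norm p + s" using e s by simp
  have dq: "dist p ?q = s" using e s by (simp add: dist_norm)
  then have qG: "?q \<in> G" using \<rho>(2) s by auto
  have fq: "f ?q = f m" using \<delta>(2)[of ?q] dq s fp by auto
  have "norm ?q \<le> max R (norm x)"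
  proof (rule ccontr)
    assume "\<not> norm ?q \<le> max R (norm x)"
    then have "f ?q < f x" using R qG by auto
    then show False using fq m(2)[OF xK] by simp
  qed
  then have "?q \<in> ?A" using qG closure_subset fq by auto
  then show False using p(2) nq s by fastforce
qed

section \<open>Unique continuation\<close>

lemma power_self_le_exp_fact: "real n ^ n \<le> exp (real n) * fact n"
proof -
  have "(\<Sum>k\<in>{n}. inverse (fact k) * real n ^ k) \<le> (\<Sum>k. inverse (fact k) * real n ^ k)"
    by (intro sum_le_suminf) (use summable_exp[of "real n"] in auto)
  then show ?thesis by (simp add: exp_def field_simps)
qed

lemma harmonic_iterated_directional_derivatives:
  fixes h :: "'a::euclidean_space \<Rightarrow> real"
  assumes "harmonic_on S h g" "open S" "norm v \<le> 1"
  obtains D G where "D 0 = h" "\<And>k::nat. harmonic_on S (D k) (G k)" "\<And>k x. D (Suc k) x = G k x \<bullet> v"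
proof -
  have "\<exists>F. \<forall>n::nat. (harmonic_on S (fst (F n)) (snd (F n)) \<and> (n = 0 \<longrightarrow> fst (F n) = h)) \<and>
      fst (F (Suc n)) = (\<lambda>x. snd (F n) x \<bullet> v)"
  proof (rule dependent_nat_choice)
    show "\<exists>F. harmonic_on S (fst F) (snd F) \<and> (0 = (0::nat) \<longrightarrow> fst F = h)"
      by (rule exI[of _ "(h, g)"]) (use assms(1) in auto)
    fix F and n :: nat
    assume "harmonic_on S (fst F) (snd F) \<and> (n = 0 \<longrightarrow> fst F = h)"
    then obtain g' where "harmonic_on S (\<lambda>x. snd F x \<bullet> v) g'"
      using harmonic_on_directional_derivative[OF _ assms(2,3)] by blast
    then show "\<exists>F'. (harmonic_on S (fst F') (snd F') \<and> (Suc n = 0 \<longrightarrow> fst F' = h)) \<and> fst F' = (\<lambda>x. snd F x \<bullet> v)"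
      by (intro exI[of _ "(\<lambda>x. snd F x \<bullet> v, g')"]) auto
  qed
  then obtain F where F: "\<And>n::nat. harmonic_on S (fst (F n)) (snd (F n)) \<and> (n = 0 \<longrightarrow> fst (F n) = h)"
      "\<And>n. fst (F (Suc n)) = (\<lambda>x. snd (F n) x \<bullet> v)" by blast
  show thesis by (rule that[of "\<lambda>n. fst (F n)" "\<lambda>n. snd (F n)"]) (use F in auto)
qed

text \<open>Applying the gradient estimate \<open>k\<close> times, each time on a ball of radius \<open>r / k\<close>, bounds the \<open>k\<close>-th
  derivatives by \<open>(C k / r)^k M\<close>. As \<open>k^k \<le> e^k k!\<close>, the Taylor remainder tends to \<open>0\<close> within a fixed
  fraction of \<open>r\<close>, while all Taylor coefficients vanish where \<open>h\<close> does. This is the analyticity of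
  harmonic functions, restricted to one line at a time.\<close>

lemma harmonic_vanishing_propagates:
  obtains \<delta> where "\<delta> > 0" "\<delta> \<le> 1/2"
    "\<And>(h :: 'a::euclidean_space \<Rightarrow> real) g z r M e y.
       \<lbrakk>harmonic_on (ball z r) h g; \<And>x. x \<in> ball z r \<Longrightarrow> \<bar>h x\<bar> \<le> M; e > 0;
        \<And>x. x \<in> ball z e \<Longrightarrow> h x = 0; y \<in> ball z (\<delta> * r)\<rbrakk> \<Longrightarrow> h y = 0"
proof -
  obtain C where C: "C > 0"
    "\<And>(f :: 'a::euclidean_space \<Rightarrow> real) g x \<rho> M. \<lbrakk>harmonic_on (ball x \<rho>) f g; \<rho> > 0;
        \<And>y. y \<in> ball x \<rho> \<Longrightarrow> \<bar>f y\<bar> \<le> M\<rbrakk> \<Longrightarrow> norm (g x) \<le> C * M / \<rho>"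
    using harmonic_gradient_estimate by blast
  define \<delta> where "\<delta> = min (1/2) (1 / (4 * C * exp 1))"
  have \<delta>: "\<delta> > 0" "\<delta> \<le> 1/2" "2 * C * exp 1 * \<delta> \<le> 1/2"
    using C(1) by (auto simp: \<delta>_def min_def field_simps)
  show thesis
  proof (rule that[OF \<delta>(1,2)])
    fix h :: "'a \<Rightarrow> real" and g z r M e y
    assume h: "harmonic_on (ball z r) h g" and M: "\<And>x. x \<in> ball z r \<Longrightarrow> \<bar>h x\<bar> \<le> M" and e: "e > 0"
      and h0: "\<And>x. x \<in> ball z e \<Longrightarrow> h x = 0" and y: "y \<in> ball z (\<delta> * r)"
    have "\<delta> * r > 0" using y by (smt (verit) mem_ball zero_le_dist)
    then have r: "r > 0" using \<delta>(1) zero_less_mult_pos by blast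
    define s where "s = dist z y"
    have s: "0 \<le> s" "s < \<delta> * r" using y by (auto simp: s_def)
    have "\<delta> * r \<le> r / 2" using \<delta>(2) r mult_right_mono[of \<delta> "1/2" r] by simp
    then have s2: "s < r / 2" using s by simp
    define v where "v = (y - z) /\<^sub>R s"
    have v: "norm v \<le> 1" by (cases "s = 0") (auto simp: v_def s_def dist_norm norm_minus_commute)
    have yv: "y = z + s *\<^sub>R v" by (cases "s = 0") (auto simp: v_def s_def)
    obtain D G where D: "D 0 = h" "\<And>k::nat. harmonic_on (ball z r) (D k) (G k)" "\<And>k x. D (Suc k) x = G k x \<bullet> v"
      using harmonic_iterated_directional_derivatives[OF h open_ball v] by blast
    have zero: "\<forall>x\<in>ball z (min e r). D k x = 0" for k
    proof (induction k)
      case 0 then show ?case using D(1) h0 by auto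
    next
      case (Suc k)
      show ?case
      proof
        fix x assume x: "x \<in> ball z (min e r)"
        have "((\<lambda>_. 0) has_derivative (\<lambda>w. G k x \<bullet> w)) (at x)"
          by (rule has_derivative_transform_within_open[OF harmonic_on_derivative[OF D(2)] open_ball x])
             (use Suc x in auto)
        moreover have "((\<lambda>_. 0) has_derivative (\<lambda>w. 0 \<bullet> w)) (at x)" by simp
        ultimately have "G k x = 0" by (rule gradient_unique)
        then show "D (Suc k) x = 0" using D(3) by simp
      qed
    qed
    \<comment> \<open>Cauchy estimates. In the step from \<open>k\<close> to \<open>Suc k\<close> the last derivative uses the fraction \<open>1 / Suc k\<close> of the radius.\<close>
    have bound: "ball x \<rho> \<subseteq> ball z r \<Longrightarrow> \<rho> > 0 \<Longrightarrow> \<bar>D k x\<bar> \<le> (C * real k / \<rho>) ^ k * M" for k x \<rho>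
    proof (induction k arbitrary: x \<rho>)
      case 0 
      then have "x \<in> ball x \<rho>" by simp
      then have "x \<in> ball z r" using 0(1) by blast
      then show ?case using D(1) M by simp
    next
      case (Suc k)
      have M0: "M \<ge> 0" using M[of z] r by (smt (verit) centre_in_ball)
      define t where "t = \<rho> / real (Suc k)"
      have t: "t > 0" "t \<le> \<rho>" using Suc.prems by (auto simp: t_def field_simps)
      have "norm (G k x) \<le> C * ((C * real (Suc k) / \<rho>) ^ k * M) / t"
      proof (rule C(2)[OF harmonic_on_subset[OF D(2)] t(1)])
        show "ball x t \<subseteq> ball z r" using Suc.prems(1) subset_ball[OF t(2), of x] by blast
        fix w assume w: "w \<in> ball x t"
        show "\<bar>D k w\<bar> \<le> (C * real (Suc k) / \<rho>) ^ k * M"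
        proof (cases "k = 0")
          case True
          have "w \<in> ball z r" using w \<open>ball x t \<subseteq> ball z r\<close> by blast
          then show ?thesis using True D(1) M by simp
        next
          case False
          have sub: "ball w (\<rho> - t) \<subseteq> ball z r"
          proof
            fix q assume "q \<in> ball w (\<rho> - t)"
            then have "q \<in> ball x \<rho>" using w dist_triangle[of x q w] by simp
            then show "q \<in> ball z r" using Suc.prems(1) by blast
          qed
          have rt: "\<rho> - t = \<rho> * real k / real (Suc k)" by (simp add: t_def field_simps)
          then have "\<rho> - t > 0" using False Suc.prems by simp
          from Suc.IH[OF sub this]
          have "\<bar>D k w\<bar> \<le> (C * real k / (\<rho> - t)) ^ k * M" .
          also have "C * real k / (\<rho> - t) = C * real (Suc k) / \<rho>"
            unfolding rt using False Suc.prems(2) by (simp add: field_simps)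
          finally show ?thesis .
        qed
      qed
      also have "\<dots> = (C * real (Suc k) / \<rho>) ^ Suc k * M"
        using Suc.prems(2) by (simp add: t_def field_simps)
      finally have "norm (G k x) \<le> (C * real (Suc k) / \<rho>) ^ Suc k * M" .
      moreover have "\<bar>G k x \<bullet> v\<bar> \<le> norm (G k x)"
        using Cauchy_Schwarz_ineq2[of "G k x" v] v mult_left_mono[of "norm v" 1 "norm (G k x)"] by simp
      ultimately show ?case using D(3) by simp
    qed
    have inb: "z + t *\<^sub>R v \<in> ball z r" "ball (z + t *\<^sub>R v) (r/2) \<subseteq> ball z r" if "\<bar>t\<bar> \<le> s" for t
    proof -
      have d: "dist z (z + t *\<^sub>R v) \<le> s"
        using that v mult_mono[of "\<bar>t\<bar>" s "norm v" 1] s by (simp add: dist_norm)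
      then show "z + t *\<^sub>R v \<in> ball z r" using s2 r by simp
      show "ball (z + t *\<^sub>R v) (r/2) \<subseteq> ball z r"
      proof
        fix q assume "q \<in> ball (z + t *\<^sub>R v) (r/2)"
        then show "q \<in> ball z r" using d s2 dist_triangle[of z q "z + t *\<^sub>R v"] by simp
      qed
    qed
    \<comment> \<open>Taylor expansion of order \<open>n\<close> along the segment from \<open>z\<close> to \<open>y\<close>.\<close>
    have est: "\<bar>h y\<bar> \<le> (1/2) ^ n * M" for n
    proof -
      have "\<exists>t. \<bar>t\<bar> \<le> \<bar>s\<bar> \<and> h (z + s *\<^sub>R v) =
        (\<Sum>m<n. D m (z + 0 *\<^sub>R v) / fact m * s ^ m) + D n (z + t *\<^sub>R v) / fact n * s ^ n"
      proof (rule Maclaurin_bi_le[where diff="\<lambda>m t. D m (z + t *\<^sub>R v)"])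
        show "(\<lambda>t. D 0 (z + t *\<^sub>R v)) = (\<lambda>t. h (z + t *\<^sub>R v))" using D(1) by simp
        show "\<forall>m t. m < n \<and> \<bar>t\<bar> \<le> \<bar>s\<bar> \<longrightarrow> DERIV (\<lambda>t. D m (z + t *\<^sub>R v)) t :> D (Suc m) (z + t *\<^sub>R v)"
        proof (intro allI impI)
          fix m t assume "m < n \<and> \<bar>t\<bar> \<le> \<bar>s\<bar>"
          then have "z + t *\<^sub>R v \<in> ball z r" using inb s(1) by auto
          note d = harmonic_on_derivative[OF D(2)[of m] this]
          have "((\<lambda>t. z + t *\<^sub>R v) has_derivative (\<lambda>w. w *\<^sub>R v)) (at t)"
            by (auto intro!: derivative_eq_intros)
          from has_derivative_compose[OF this d]
          show "DERIV (\<lambda>t. D m (z + t *\<^sub>R v)) t :> D (Suc m) (z + t *\<^sub>R v)"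
            by (auto simp: has_field_derivative_def D(3) elim!: has_derivative_eq_rhs)
        qed
      qed
      then obtain t where t: "\<bar>t\<bar> \<le> s" "h y = (\<Sum>m<n. D m z / fact m * s ^ m) + D n (z + t *\<^sub>R v) / fact n * s ^ n"
        using s(1) yv by auto
      have "z \<in> ball z (min e r)" using e r by simp
      then have "h y = D n (z + t *\<^sub>R v) / fact n * s ^ n"
        using t(2) zero by simp
      then have "\<bar>h y\<bar> = \<bar>D n (z + t *\<^sub>R v)\<bar> / fact n * s ^ n"
        using s(1) by (simp add: abs_mult)
      also have "\<dots> \<le> ((C * real n / (r/2)) ^ n * M) / fact n * s ^ n"
        using bound[OF inb(2)[OF t(1)], of n] r s(1)
        by (intro mult_right_mono divide_right_mono) auto
      also have "\<dots> = (real n ^ n / fact n) * ((2 * C * s / r) ^ n * M)"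
        using r by (simp add: power_mult_distrib power_divide field_simps)
      also have "\<dots> \<le> exp (real n) * ((2 * C * s / r) ^ n * M)"
      proof (rule mult_right_mono)
        show "real n ^ n / fact n \<le> exp (real n)"
          using power_self_le_exp_fact[of n] by (simp add: field_simps)
        have "M \<ge> 0" using M[of z] r by (smt (verit) centre_in_ball)
        then show "0 \<le> (2 * C * s / r) ^ n * M" using C(1) s(1) r by simp
      qed
      also have "\<dots> = (2 * C * exp 1 * (s / r)) ^ n * M"
        using exp_of_nat_mult[of n "1::real"] by (simp add: power_mult_distrib power_divide)
      also have "\<dots> \<le> (1/2) ^ n * M"
      proof (intro mult_right_mono power_mono)
        show "M \<ge> 0" using M[of z] r by (smt (verit) centre_in_ball)
        have "s / r \<le> \<delta>" using s r by (simp add: field_simps)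
        then have "2 * C * exp 1 * (s / r) \<le> 2 * C * exp 1 * \<delta>"
          using C(1) by (intro mult_left_mono) auto
        then show "2 * C * exp 1 * (s / r) \<le> 1/2" using \<delta>(3) by simp
        show "0 \<le> 2 * C * exp 1 * (s / r)" using C(1) s r by simp
      qed
      finally show ?thesis .
    qed
    have "(\<lambda>n. (1/2) ^ n * M) \<longlonglongrightarrow> 0"
      by (intro tendsto_mult_left_zero LIMSEQ_power_zero) simp
    then have "\<bar>h y\<bar> \<le> 0"
      by (rule LIMSEQ_le_const) (use est in auto)
    then show "h y = 0" by simp
  qed
qed

text \<open>The set of points near which \<open>h\<close> vanishes is open, and by the uniform fraction in the propagation
  lemma it is also closed in \<open>S\<close>.\<close>

lemma harmonic_unique_continuation:
  fixes h :: "'a::euclidean_space \<Rightarrow> real"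
  assumes S: "open S" "connected S" and h: "harmonic_on S h g"
    and y: "y \<in> S" "e > 0" "\<And>x. x \<in> ball y e \<Longrightarrow> h x = 0" and x: "x \<in> S"
  shows "h x = 0"
proof -
  obtain \<delta> where \<delta>: "\<delta> > 0" "\<delta> \<le> 1/2"
    "\<And>(h :: 'a::euclidean_space \<Rightarrow> real) g z r M e y.
       \<lbrakk>harmonic_on (ball z r) h g; \<And>x. x \<in> ball z r \<Longrightarrow> \<bar>h x\<bar> \<le> M; e > 0;
        \<And>x. x \<in> ball z e \<Longrightarrow> h x = 0; y \<in> ball z (\<delta> * r)\<rbrakk> \<Longrightarrow> h y = 0"
    using harmonic_vanishing_propagates by blast
  define Z where "Z = S \<inter> interior {w. h w = 0}"
  have Z_iff: "z \<in> Z \<longleftrightarrow> z \<in> S \<and> (\<exists>e>0. \<forall>w\<in>ball z e. h w = 0)" for z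
    unfolding Z_def mem_interior Int_iff subset_iff mem_Collect_eq Ball_def by (rule refl)
  have "open Z" unfolding Z_def using S(1) by (intro open_Int open_interior)
  moreover have "open (S - Z)"
  proof (subst open_contains_ball, rule ballI)
    fix z assume z: "z \<in> S - Z"
    obtain R where R: "R > 0" "cball z R \<subseteq> S" using S(1) z open_contains_cball by blast
    have "compact (h ` cball z R)"
      by (intro compact_continuous_image continuous_on_subset[OF harmonic_on_continuous(1)[OF h] R(2)]) auto
    then obtain M where M: "\<And>w. w \<in> cball z R \<Longrightarrow> \<bar>h w\<bar> \<le> M"
      using compact_imp_bounded bounded_iff by (metis imageI real_norm_def)
    have "ball z (\<delta> * R / 4) \<subseteq> S - Z"
    proof (rule ccontr)
      assume "\<not> ball z (\<delta> * R / 4) \<subseteq> S - Z"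
      moreover have dR: "\<delta> * R \<le> R / 2" using mult_right_mono[OF \<delta>(2), of R] R(1) by simp
      moreover have "ball z (\<delta> * R / 4) \<subseteq> cball z R"
        by (rule subsetI) (use dR R(1) in \<open>unfold mem_ball mem_cball, linarith\<close>)
      then have "ball z (\<delta> * R / 4) \<subseteq> S" using R(2) by blast
      ultimately obtain w where w: "w \<in> ball z (\<delta> * R / 4)" "w \<in> Z" by blast
      then obtain e where e: "e > 0" "\<And>q. q \<in> ball w e \<Longrightarrow> h q = 0" unfolding Z_iff by blast
      have sub: "ball w (R/2) \<subseteq> cball z R"
      proof
        fix q assume "q \<in> ball w (R/2)"
        then show "q \<in> cball z R"
          using w(1) dR R(1) dist_triangle[of z q w] unfolding mem_ball mem_cball by linarith
      qed
      have h0: "h q = 0" if q: "q \<in> ball z (\<delta> * R / 4)" for q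
      proof (rule \<delta>(3)[OF harmonic_on_subset[OF h] _ e])
        show "ball w (R/2) \<subseteq> S" using sub R(2) by blast
        show "\<bar>h x\<bar> \<le> M" if "x \<in> ball w (R/2)" for x using M sub that by blast
        have "dist w q < \<delta> * R / 4 + \<delta> * R / 4"
          using q w(1) dist_triangle[of w q z] dist_commute[of z w] unfolding mem_ball by linarith
        then show "q \<in> ball w (\<delta> * (R/2))" by (simp add: mult.commute)
      qed
      have "\<delta> * R / 4 > 0" using \<delta>(1) R(1) by simp
      then have "z \<in> Z" using z h0 unfolding Z_iff by blast
      then show False using z by simp
    qed
    then show "\<exists>e>0. ball z e \<subseteq> S - Z" using \<delta>(1) R(1) by (intro exI[of _ "\<delta> * R / 4"]) auto
  qed
  moreover have "y \<in> Z" using y unfolding Z_iff by blast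
  moreover have "Z \<subseteq> S" by (auto simp: Z_def)
  ultimately have "x \<in> Z" using S(2) x connectedD[OF S(2), of Z "S - Z"] by blast
  then obtain e where "e > 0" "\<forall>w\<in>ball x e. h w = 0" unfolding Z_iff by blast
  then show ?thesis by simp
qed

section \<open>The Bochner formula for the gradient quotient\<close>

text \<open>The fundamental solution \<open>|x - z|^(2 - n)\<close>, written as a power of the smooth function
  \<open>(x - z) \<bullet> (x - z)\<close>.\<close>

lemma harmonic_radial:
  fixes z :: "'a::euclidean_space"
  defines "p \<equiv> (2 - real DIM('a)) / 2"
  shows "\<exists>g. harmonic_on (- {z}) (\<lambda>x. ((x - z) \<bullet> (x - z)) powr p) g"
proof -
  have "has_C2 (- {z}) (\<lambda>x. (x - z) \<bullet> (x - z)) (\<lambda>x. 2 *\<^sub>R (x - z)) (\<lambda>x. 2 *\<^sub>R id_blinfun)"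
    unfolding has_C2_def
    by (auto intro!: derivative_eq_intros simp: inner_commute algebra_simps blinfun.scaleR_left)
  from has_C2_powr[OF this, of p]
  have C: "has_C2 (- {z}) (\<lambda>x. ((x - z) \<bullet> (x - z)) powr p)
     (\<lambda>x. (p * ((x - z) \<bullet> (x - z)) powr (p - 1)) *\<^sub>R 2 *\<^sub>R (x - z))
     (\<lambda>x. (p * ((x - z) \<bullet> (x - z)) powr (p - 1)) *\<^sub>R 2 *\<^sub>R id_blinfun +
       (p * (p - 1) * ((x - z) \<bullet> (x - z)) powr (p - 2)) *\<^sub>R outer_product (2 *\<^sub>R (x - z)) (2 *\<^sub>R (x - z)))"
    by (simp)
  have "blinfun_trace ((p * ((x - z) \<bullet> (x - z)) powr (p - 1)) *\<^sub>R 2 *\<^sub>R id_blinfun +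
       (p * (p - 1) * ((x - z) \<bullet> (x - z)) powr (p - 2)) *\<^sub>R outer_product (2 *\<^sub>R (x - z)) (2 *\<^sub>R (x - z))) = 0"
    if "x \<in> - {z}" for x
  proof -
    let ?s = "(x - z) \<bullet> (x - z)"
    have s: "?s > 0" using that by simp
    have "?s powr (p - 1) = ?s powr (p - 2) * ?s powr 1" unfolding powr_add[symmetric] by simp
    then have e: "?s powr (p - 1) = ?s powr (p - 2) * ?s" using s by simp
    have n: "real DIM('a) = 2 - 2 * p" by (simp add: p_def field_simps)
    show ?thesis unfolding blinfun_trace_simps e n inner_scaleR_left inner_scaleR_right
      by (simp add: algebra_simps)
  qed
  then show ?thesis using C unfolding harmonic_on_def by blast
qed

text \<open>One row of the square norm of \<open>Q - \<alpha> (g \<otimes> g - \<beta> I)\<close>, expanded so that the rows can be summed.\<close>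

lemma norm_diff_tracefree_row:
  fixes q g b :: "'a::real_inner"
  assumes b: "b \<bullet> b = 1"
  shows "(q - \<alpha> *\<^sub>R ((g \<bullet> b) *\<^sub>R g - \<beta> *\<^sub>R b)) \<bullet> (q - \<alpha> *\<^sub>R ((g \<bullet> b) *\<^sub>R g - \<beta> *\<^sub>R b)) =
    q \<bullet> q - 2 * \<alpha> * ((g \<bullet> b) * (q \<bullet> g)) + 2 * \<alpha> * \<beta> * (q \<bullet> b)
      + \<alpha>\<^sup>2 * (g \<bullet> g - 2 * \<beta>) * ((g \<bullet> b) * (g \<bullet> b)) + \<alpha>\<^sup>2 * \<beta>\<^sup>2"
proof -
  define T where "T = (g \<bullet> b) *\<^sub>R g - \<beta> *\<^sub>R b"
  have TT: "T \<bullet> T = (g \<bullet> b) * (g \<bullet> b) * (g \<bullet> g) - 2 * \<beta> * ((g \<bullet> b) * (g \<bullet> b)) + \<beta>\<^sup>2"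
    unfolding T_def inner_diff_left inner_diff_right inner_scaleR_left inner_scaleR_right b inner_commute[of b g]
    by (simp add: power2_eq_square algebra_simps)
  have qT: "q \<bullet> T = (g \<bullet> b) * (q \<bullet> g) - \<beta> * (q \<bullet> b)"
    unfolding T_def inner_diff_right inner_scaleR_right ..
  have "(q - \<alpha> *\<^sub>R T) \<bullet> (q - \<alpha> *\<^sub>R T) = q \<bullet> q - 2 * \<alpha> * (q \<bullet> T) + \<alpha>\<^sup>2 * (T \<bullet> T)"
    unfolding inner_diff_left inner_diff_right inner_scaleR_left inner_scaleR_right inner_commute[of T q]
    by (simp add: power2_eq_square algebra_simps)
  then show ?thesis unfolding TT qT T_def[symmetric] by (simp add: algebra_simps)
qed

text \<open>With \<open>h = D\<^sup>2 u\<close> and \<open>T = (a / u) (g \<otimes> g - |g|\<^sup>2 I / n)\<close> one has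
  \<open>\<Delta> (|g|\<^sup>2 u^(-a)) = 2 u^(-a) |h - T|\<^sup>2\<close>: the terms in \<open>\<Delta> (|g|\<^sup>2) = 2 |h|\<^sup>2\<close>, the mixed term and
  \<open>\<Delta> (u^(-a))\<close> complete to a square because \<open>h\<close> has trace \<open>0\<close> and \<open>a\<^sup>2 (1 - 1 / n) = a (a + 1) / 2\<close>,
  which determines the exponent \<open>a\<close>. The quotient is therefore subharmonic, and where its Laplacian
  vanishes the Hessian of \<open>u\<close> equals \<open>T\<close>, the Hessian of a multiple of \<open>|x - z|^(2 - n)\<close>.\<close>

lemma bochner_gradient_quotient:
  fixes u :: "'a::euclidean_space \<Rightarrow> real" and g :: "'a \<Rightarrow> 'a"
  defines "n \<equiv> real DIM('a)"
  defines "a \<equiv> n / (n - 2)"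
  assumes n: "n > 2" and h: "harmonic_on S u g" and S: "open S" and pos: "\<And>x. x \<in> S \<Longrightarrow> u x > 0"
  obtains G H where "has_C2 S (\<lambda>x. (g x \<bullet> g x) * u x powr (- a)) G H"
    "\<And>x. x \<in> S \<Longrightarrow> blinfun_trace (H x) \<ge> 0"
    "\<And>x. x \<in> S \<Longrightarrow> blinfun_trace (H x) = 0 \<Longrightarrow>
      (g has_derivative (\<lambda>w. (a / u x) *\<^sub>R ((g x \<bullet> w) *\<^sub>R g x - ((g x \<bullet> g x) / n) *\<^sub>R w))) (at x)"
proof -
  obtain K where K: "has_C2 S u g K" and trK: "\<And>x. x \<in> S \<Longrightarrow> blinfun_trace (K x) = 0"
    using h unfolding harmonic_on_def by blast
  have "\<forall>b\<in>Basis. \<exists>q. harmonic_on S (\<lambda>x. g x \<bullet> b) q"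
    using harmonic_on_directional_derivative[OF h S] by (metis norm_Basis order_refl)
  then obtain q where "\<And>b. b \<in> Basis \<Longrightarrow> harmonic_on S (\<lambda>x. g x \<bullet> b) (q b)" by metis
  then obtain Q where Q: "\<And>b. b \<in> Basis \<Longrightarrow> has_C2 S (\<lambda>x. g x \<bullet> b) (q b) (Q b) \<and> (\<forall>x\<in>S. blinfun_trace (Q b x) = 0)"
    unfolding harmonic_on_def by metis
  have qK: "q b x \<bullet> w = K x w \<bullet> b" if "x \<in> S" "b \<in> Basis" for x w b
  proof -
    have "((\<lambda>x. g x \<bullet> b) has_derivative (\<lambda>w. q b x \<bullet> w)) (at x)"
      using has_C2D(1) Q that by blast
    moreover have "((\<lambda>x. g x \<bullet> b) has_derivative (\<lambda>w. K x w \<bullet> b)) (at x)"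
      using has_derivative_inner_left[OF has_C2D(2)[OF K that(1)]] .
    ultimately show ?thesis by (metis has_derivative_unique)
  qed
  let ?H1 = "\<lambda>x. \<Sum>b\<in>Basis. (g x \<bullet> b) *\<^sub>R Q b x + (g x \<bullet> b) *\<^sub>R Q b x + outer_product (q b x) (q b x) + outer_product (q b x) (q b x)"
  let ?G1 = "\<lambda>x. \<Sum>b\<in>Basis. (g x \<bullet> b) *\<^sub>R q b x + (g x \<bullet> b) *\<^sub>R q b x"
  have C1: "has_C2 S (\<lambda>x. \<Sum>b\<in>Basis. (g x \<bullet> b) * (g x \<bullet> b)) ?G1 ?H1"
    using Q by (intro has_C2_sum has_C2_mult) auto
  note C2 = has_C2_powr[OF K pos, of "- a"]
  define HH where "HH = (\<lambda>x. (\<Sum>b\<in>Basis. (g x \<bullet> b) * (g x \<bullet> b)) *\<^sub>R ((- a * u x powr (- a - 1)) *\<^sub>R K x +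
          (- a * (- a - 1) * u x powr (- a - 2)) *\<^sub>R outer_product (g x) (g x)) +
         u x powr - a *\<^sub>R ?H1 x +
         outer_product ((- a * u x powr (- a - 1)) *\<^sub>R g x) (?G1 x) +
         outer_product (?G1 x) ((- a * u x powr (- a - 1)) *\<^sub>R g x))"
  have C: "has_C2 S (\<lambda>x. (\<Sum>b\<in>Basis. (g x \<bullet> b) * (g x \<bullet> b)) * u x powr (- a))
      (\<lambda>x. (\<Sum>b\<in>Basis. (g x \<bullet> b) * (g x \<bullet> b)) *\<^sub>R ((- a * u x powr (- a - 1)) *\<^sub>R g x) + u x powr (- a) *\<^sub>R ?G1 x) HH"
    using has_C2_mult[OF C1 C2] unfolding HH_def .
  have w: "(\<Sum>b\<in>Basis. (g x \<bullet> b) * (g x \<bullet> b)) = g x \<bullet> g x" for x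
    by (rule euclidean_inner[symmetric])
  \<comment> \<open>The value of the Hessian for the rotationally symmetric solution.\<close>
  define T where "T = (\<lambda>x b. (a / u x) *\<^sub>R ((g x \<bullet> b) *\<^sub>R g x - ((g x \<bullet> g x) / n) *\<^sub>R b))"
  have tr: "blinfun_trace (HH x)
      = 2 * u x powr (- a) * (\<Sum>b\<in>Basis. (q b x - T x b) \<bullet> (q b x - T x b))" if x: "x \<in> S" for x
  proof -
    let ?w = "g x \<bullet> g x" and ?A = "\<Sum>b\<in>Basis. q b x \<bullet> q b x" and ?B = "\<Sum>b\<in>Basis. (g x \<bullet> b) * (q b x \<bullet> g x)"
    have u: "u x > 0" using pos x .
    have e1: "u x powr (- a - 1) = u x powr (- a) / u x" using u by (simp add: powr_diff)
    have e2: "u x powr (- a - 2) = u x powr (- a) / (u x)\<^sup>2" using u by (simp add: powr_diff powr_realpow)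
    have G1: "?G1 x \<bullet> g x = 2 * ?B" by (simp add: inner_sum_left inner_add_left sum.distrib)
    have H1: "blinfun_trace (?H1 x) = 2 * ?A"
    proof -
      have "blinfun_trace (\<Sum>b\<in>I. F b) = (\<Sum>b\<in>I. blinfun_trace (F b))" if "finite I" for I and F :: "'a \<Rightarrow> 'a \<Rightarrow>\<^sub>L 'a"
        using that by induction auto
      then show ?thesis using Q x by (simp add: sum.distrib)
    qed
    have "blinfun_trace (HH x) = ?w * (a * (a + 1) * (u x powr (- a) / (u x)\<^sup>2) * ?w)
        + u x powr (- a) * (2 * ?A) - 2 * (a * (u x powr (- a) / u x) * (2 * ?B))"
      unfolding HH_def w blinfun_trace_simps H1 trK[OF x] inner_scaleR_left inner_scaleR_right
        inner_commute[of "g x" "?G1 x"] G1 e1 e2 by (simp add: algebra_simps)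
    also have "\<dots> = 2 * u x powr (- a) * (?A - (2 * a / u x) * ?B + a * (a + 1) / 2 * ?w\<^sup>2 / (u x)\<^sup>2)"
      using u by (simp add: field_simps power2_eq_square)
    also have "?A - (2 * a / u x) * ?B + a * (a + 1) / 2 * ?w\<^sup>2 / (u x)\<^sup>2 = (\<Sum>b\<in>Basis. (q b x - T x b) \<bullet> (q b x - T x b))"
    proof -
      have t1: "(q b x - T x b) \<bullet> (q b x - T x b) = q b x \<bullet> q b x
          - 2 * (a / u x) * ((g x \<bullet> b) * (q b x \<bullet> g x)) + 2 * (a / u x) * (?w / n) * (q b x \<bullet> b)
          + (a / u x)\<^sup>2 * (?w - 2 * (?w / n)) * ((g x \<bullet> b) * (g x \<bullet> b)) + (a / u x)\<^sup>2 * (?w / n)\<^sup>2" if "b \<in> Basis" for b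
        unfolding T_def by (rule norm_diff_tracefree_row) (use that in simp)
      have t2: "(\<Sum>b\<in>Basis. q b x \<bullet> b) = 0"
        using trK[OF x] qK[OF x] by (simp add: blinfun_trace_def)
      have "(\<Sum>b\<in>Basis. (q b x - T x b) \<bullet> (q b x - T x b)) = (\<Sum>b\<in>Basis. q b x \<bullet> q b x
          - 2 * (a / u x) * ((g x \<bullet> b) * (q b x \<bullet> g x)) + 2 * (a / u x) * (?w / n) * (q b x \<bullet> b)
          + (a / u x)\<^sup>2 * (?w - 2 * (?w / n)) * ((g x \<bullet> b) * (g x \<bullet> b)) + (a / u x)\<^sup>2 * (?w / n)\<^sup>2)"
        by (rule sum.cong[OF refl t1])
      also have "\<dots> = ?A - 2 * (a / u x) * ?B + 2 * (a / u x) * (?w / n) * (\<Sum>b\<in>Basis. q b x \<bullet> b)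
          + (a / u x)\<^sup>2 * (?w - 2 * (?w / n)) * (\<Sum>b\<in>Basis. (g x \<bullet> b) * (g x \<bullet> b)) + n * ((a / u x)\<^sup>2 * (?w / n)\<^sup>2)"
        by (simp only: sum.distrib sum_subtractf sum_distrib_left sum_constant n_def mult.assoc)
      also have "\<dots> = ?A - (2 * a / u x) * ?B + (a\<^sup>2 * (1 - 1 / n)) * ?w\<^sup>2 / (u x)\<^sup>2"
        unfolding w t2 using n u by (simp add: field_simps power2_eq_square)
      also have "a\<^sup>2 * (1 - 1 / n) = a * (a + 1) / 2"
      proof -
        have e: "a * (1 - 1 / n) = (n - 1) / (n - 2)" "a + 1 = 2 * ((n - 1) / (n - 2))"
          using n by (simp_all add: a_def field_simps)
        have "a * (1 - 1 / n) = (a + 1) / 2" unfolding e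
          by (rule nonzero_mult_div_cancel_left[symmetric]) simp
        then have "a * (a * (1 - 1 / n)) = a * ((a + 1) / 2)" by (simp only:)
        then show ?thesis by (simp add: power2_eq_square mult.assoc)
      qed
      finally show ?thesis by simp
    qed
    finally show ?thesis .
  qed
  show thesis
  proof (rule that)
    show "has_C2 S (\<lambda>x. (g x \<bullet> g x) * u x powr (- a))
      (\<lambda>x. (g x \<bullet> g x) *\<^sub>R ((- a * u x powr (- a - 1)) *\<^sub>R g x) + u x powr (- a) *\<^sub>R ?G1 x) HH"
      using C unfolding w .
    show "blinfun_trace (HH x) \<ge> 0" if "x \<in> S" for x
      using tr[OF that] by (simp add: sum_nonneg)
    fix x assume x: "x \<in> S" and "blinfun_trace (HH x) = 0"
    then have "(\<Sum>b\<in>Basis. (q b x - T x b) \<bullet> (q b x - T x b)) = 0"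
      using tr[OF x] pos[OF x] by simp
    then have qT: "q b x = T x b" if "b \<in> Basis" for b
      using that by (simp add: sum_nonneg_eq_0_iff)
    have "K x w = (a / u x) *\<^sub>R ((g x \<bullet> w) *\<^sub>R g x - ((g x \<bullet> g x) / n) *\<^sub>R w)" for w
    proof (rule euclidean_eqI)
      fix b :: 'a assume b: "b \<in> Basis"
      show "K x w \<bullet> b = (a / u x) *\<^sub>R ((g x \<bullet> w) *\<^sub>R g x - ((g x \<bullet> g x) / n) *\<^sub>R w) \<bullet> b"
        using qK[OF x b, of w] unfolding qT[OF b] T_def inner_scaleR_left inner_diff_left
        by (simp add: inner_commute mult.commute)
    qed
    then show "(g has_derivative (\<lambda>w. (a / u x) *\<^sub>R ((g x \<bullet> w) *\<^sub>R g x - ((g x \<bullet> g x) / n) *\<^sub>R w))) (at x)"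
      using has_C2D(2)[OF K x] by (elim has_derivative_eq_rhs) auto
  qed
qed

section \<open>Growth of harmonic functions on exterior domains\<close>

lemma inner_self_powr: "(x \<bullet> x) powr p = norm (x::'a::real_inner) powr (2 * p)"
proof (cases "x = 0")
  case False
  then have "x \<bullet> x = norm x powr 2" by (simp add: dot_square_norm powr_realpow[of "norm x" 2, simplified])
  then show ?thesis by (simp only: powr_powr)
qed simp

lemma harmonic_on_diff:
  assumes "harmonic_on S f g" "harmonic_on S f' g'"
  shows "harmonic_on S (\<lambda>x. f x - f' x) (\<lambda>x. g x - g' x)"
proof -
  obtain H where H: "has_C2 S f g H" "\<forall>x\<in>S. blinfun_trace (H x) = 0"
    using assms unfolding harmonic_on_def by blast
  obtain H' where H': "has_C2 S f' g' H'" "\<forall>x\<in>S. blinfun_trace (H' x) = 0"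
    using assms unfolding harmonic_on_def by blast
  have "has_C2 S (\<lambda>x. f x + (-1) * f' x) (\<lambda>x. g x + (-1) *\<^sub>R g' x) (\<lambda>x. H x + (-1) *\<^sub>R H' x)"
    by (intro has_C2_add has_C2_cmult H H')
  moreover have "\<forall>x\<in>S. blinfun_trace (H x + (-1) *\<^sub>R H' x) = 0"
    using H H' unfolding blinfun_trace_simps by simp
  ultimately show ?thesis unfolding harmonic_on_def by auto
qed

lemma harmonic_le_boundary:
  fixes f :: "'a::euclidean_space \<Rightarrow> real"
  assumes G: "open G" and h: "harmonic_on G f g" and c: "continuous_on (closure G) f"
    and b: "\<And>x. x \<in> frontier G \<Longrightarrow> f x \<le> k"
    and i: "\<And>e. e > 0 \<Longrightarrow> \<exists>R. \<forall>x\<in>G. norm x \<ge> R \<longrightarrow> f x < k + e" and x: "x \<in> G"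
  shows "f x \<le> k"
proof -
  obtain H where H: "has_C2 G f g H" "\<And>x. x \<in> G \<Longrightarrow> blinfun_trace (H x) = 0"
    using h unfolding harmonic_on_def by blast
  have "f x + - k \<le> 0"
  proof (rule maximum_principle[OF G has_C2_add[OF H(1) has_C2_const] _ _ _ _ x])
    show "continuous_on (closure G) (\<lambda>x. f x + - k)" by (intro continuous_intros c)
    show "0 \<le> blinfun_trace (H y + 0)" if "y \<in> G" for y using H(2)[OF that] by simp
    show "f y + - k \<le> 0" if "y \<in> frontier G" for y using b[OF that] by simp
    show "\<exists>R. \<forall>x\<in>G. R \<le> norm x \<longrightarrow> f x + - k < e" if "e > 0" for e
      using i[OF that] by (simp add: algebra_simps)
  qed
  then show ?thesis by simp
qed

lemma harmonic_comparison:
  fixes f :: "'a::euclidean_space \<Rightarrow> real"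
  assumes "open G" and h: "harmonic_on G f g" "harmonic_on G f' g'"
    and "continuous_on (closure G) f" "continuous_on (closure G) f'"
    and "\<And>x. x \<in> frontier G \<Longrightarrow> f x \<le> f' x"
    and l: "(f \<longlongrightarrow> 0) at_infinity" "(f' \<longlongrightarrow> 0) at_infinity" and "x \<in> G"
  shows "f x \<le> f' x"
proof -
  have "f x - f' x \<le> 0"
  proof (rule harmonic_le_boundary[OF assms(1) harmonic_on_diff[OF h]])
    fix e :: real assume "e > 0"
    moreover have "((\<lambda>x. f x - f' x) \<longlongrightarrow> 0) at_infinity" using tendsto_diff[OF l] by simp
    ultimately have "\<forall>\<^sub>F x in at_infinity. f x - f' x < 0 + e" by (intro order_tendstoD) auto
    then show "\<exists>R. \<forall>x\<in>G. norm x \<ge> R \<longrightarrow> f x - f' x < 0 + e"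
      unfolding eventually_at_infinity by blast
  qed (use assms in \<open>auto intro!: continuous_intros\<close>)
  then show ?thesis by simp
qed

lemma tendsto_radial_at_infinity:
  assumes "p < 0"
  shows "((\<lambda>x::'a::euclidean_space. (x \<bullet> x) powr p) \<longlongrightarrow> 0) at_infinity"
  unfolding inner_self_powr
  by (rule tendsto_neg_powr[OF _ filterlim_norm_at_top]) (use assms in simp)

lemma exterior_domain:
  fixes \<Omega> :: "'a::euclidean_space set"
  assumes "open \<Omega>"
  shows "closure (- closure \<Omega>) \<subseteq> - \<Omega>" "frontier (- closure \<Omega>) \<subseteq> frontier \<Omega>"
    "- \<Omega> = (- closure \<Omega>) \<union> frontier \<Omega>"
proof -
  show "closure (- closure \<Omega>) \<subseteq> - \<Omega>"
    using interior_maximal[OF closure_subset assms] by (auto simp: closure_complement)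
  show "frontier (- closure \<Omega>) \<subseteq> frontier \<Omega>"
    using interior_mono[OF closure_subset[of \<Omega>]] unfolding frontier_complement
    by (auto simp: frontier_def)
  show "- \<Omega> = (- closure \<Omega>) \<union> frontier \<Omega>"
    using assms closure_subset by (auto simp: frontier_def interior_open)
qed

text \<open>Comparison with multiples of the fundamental solution with pole \<open>0 \<in> \<Omega>\<close>: the two factors are
  chosen so that the multiples lie below and above \<open>1\<close> on the boundary.\<close>

lemma exterior_harmonic_growth:
  fixes \<Omega> :: "'a::euclidean_space set" and u :: "'a \<Rightarrow> real"
  defines "p \<equiv> (2 - real DIM('a)) / 2"
  assumes n: "DIM('a) \<ge> 3" and \<Omega>: "open \<Omega>" "bounded \<Omega>" "0 \<in> \<Omega>"
    and c: "continuous_on (- \<Omega>) u" and h: "harmonic_on (- closure \<Omega>) u g"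
    and b: "\<And>x. x \<in> frontier \<Omega> \<Longrightarrow> u x = 1" and l: "(u \<longlongrightarrow> 0) at_infinity"
  obtains A1 A2 where "A1 > 0" "A2 > 0"
    "\<And>x. x \<in> - closure \<Omega> \<Longrightarrow> A1 * (x \<bullet> x) powr p \<le> u x"
    "\<And>x. x \<in> - closure \<Omega> \<Longrightarrow> u x \<le> A2 * (x \<bullet> x) powr p"
proof -
  note ext = exterior_domain[OF \<Omega>(1)]
  have p: "p < 0" using n by (simp add: p_def)
  obtain k where k: "harmonic_on (- {0}) (\<lambda>x::'a. (x \<bullet> x) powr p) k"
    using harmonic_radial[of "0::'a"] unfolding p_def by auto
  have kO: "harmonic_on (- closure \<Omega>) (\<lambda>x. C * (x \<bullet> x) powr p) (\<lambda>x. C *\<^sub>R k x)" for C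
    by (intro harmonic_on_cmult harmonic_on_subset[OF k]) (use \<Omega>(3) closure_subset in auto)
  have cu: "continuous_on (closure (- closure \<Omega>)) u"
    using c ext(1) by (rule continuous_on_subset)
  have "closure (- closure \<Omega>) \<subseteq> - {0}" using ext(1) \<Omega>(3) by auto
  then have ck: "continuous_on (closure (- closure \<Omega>)) (\<lambda>x::'a. C * (x \<bullet> x) powr p)" for C
    by (intro continuous_intros continuous_on_subset[OF harmonic_on_continuous(1)[OF k]])
  have lk: "((\<lambda>x::'a. C * (x \<bullet> x) powr p) \<longlongrightarrow> 0) at_infinity" for C
    using tendsto_mult_left[OF tendsto_radial_at_infinity[OF p], of C] by simp
  obtain r0 where r0: "r0 > 0" "ball 0 r0 \<subseteq> \<Omega>" using \<Omega> open_contains_ball by blast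
  obtain R where R: "R > 0" "\<Omega> \<subseteq> ball 0 R" using \<Omega>(2) bounded_subset_ballD by blast
  have fr: "r0 \<le> norm x" "norm x \<le> R" if "x \<in> frontier \<Omega>" for x
  proof -
    have "x \<notin> \<Omega>" using that \<Omega>(1) by (simp add: frontier_def interior_open)
    then show "r0 \<le> norm x" using r0(2) by (auto simp: not_less[symmetric])
    have "x \<in> closure \<Omega>" using that by (simp add: frontier_def)
    then have "x \<in> closure (ball 0 R)" using closure_mono[OF R(2)] by blast
    then show "norm x \<le> R" using R(1) by simp
  qed
  define A1 where "A1 = r0 powr (- (2 * p))"
  define A2 where "A2 = R powr (- (2 * p))"
  have one1: "A1 * (x \<bullet> x) powr p \<le> 1" if "x \<in> frontier \<Omega>" for x
  proof -
    have "norm x powr (2 * p) \<le> r0 powr (2 * p)"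
      using fr[OF that] r0(1) p by (intro powr_mono2') auto
    then have "A1 * norm x powr (2 * p) \<le> A1 * r0 powr (2 * p)"
      by (intro mult_left_mono) (auto simp: A1_def)
    also have "\<dots> = 1" using r0(1) by (simp add: A1_def flip: powr_add)
    finally show ?thesis by (simp add: inner_self_powr)
  qed
  have one2: "A2 * (x \<bullet> x) powr p \<ge> 1" if "x \<in> frontier \<Omega>" for x
  proof -
    have "norm x > 0" using fr[OF that] r0(1) by linarith
    then have "R powr (2 * p) \<le> norm x powr (2 * p)"
      using fr[OF that] p by (intro powr_mono2') auto
    then have "A2 * R powr (2 * p) \<le> A2 * norm x powr (2 * p)"
      by (intro mult_left_mono) (auto simp: A2_def)
    moreover have "A2 * R powr (2 * p) = 1" using R(1) by (simp add: A2_def flip: powr_add)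
    ultimately show ?thesis by (simp add: inner_self_powr)
  qed
  show thesis
  proof (rule that[of A1 A2])
    show "A1 > 0" "A2 > 0" using r0 R by (auto simp: A1_def A2_def)
    show "A1 * (x \<bullet> x) powr p \<le> u x" if "x \<in> - closure \<Omega>" for x
      by (rule harmonic_comparison[OF _ kO h ck cu _ lk l that]) (use one1 b ext(2) in auto)
    show "u x \<le> A2 * (x \<bullet> x) powr p" if "x \<in> - closure \<Omega>" for x
      by (rule harmonic_comparison[OF _ h kO cu ck _ l lk that]) (use one2 b ext(2) in auto)
  qed
qed

text \<open>The gradient estimate on the ball of radius \<open>|x| / 2\<close> gives \<open>|g x| \<le> K |x|^(1 - n)\<close>, and the lower
  bound for \<open>u\<close> gives \<open>u^(-a) \<le> K |x|^n\<close>, so the quotient is at most of order \<open>|x|^(2 - n)\<close>.\<close>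

lemma gradient_quotient_decay:
  fixes \<Omega> :: "'a::euclidean_space set" and u :: "'a \<Rightarrow> real"
  defines "n \<equiv> real DIM('a)"
  assumes n: "DIM('a) \<ge> 3" and bd: "bounded \<Omega>" and h: "harmonic_on (- closure \<Omega>) u g"
    and A: "A1 > 0" "A2 > 0"
    and lo: "\<And>x. x \<in> - closure \<Omega> \<Longrightarrow> A1 * (x \<bullet> x) powr ((2 - n) / 2) \<le> u x"
    and up: "\<And>x. x \<in> - closure \<Omega> \<Longrightarrow> u x \<le> A2 * (x \<bullet> x) powr ((2 - n) / 2)"
    and e: "e > 0"
  shows "\<exists>R. \<forall>x\<in>- closure \<Omega>. norm x \<ge> R \<longrightarrow> (g x \<bullet> g x) * u x powr (- (n / (n - 2))) < e"
proof -
  have n3: "n \<ge> 3" using n by (simp add: n_def)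
  let ?a = "n / (n - 2)"
  have "2 * ((2 - n) / 2) = 2 - n" by simp
  note lo' = lo[unfolded inner_self_powr this] and up' = up[unfolded inner_self_powr this]
  obtain C where C: "C > 0"
    "\<And>(f :: 'a::euclidean_space \<Rightarrow> real) g x \<rho> M. \<lbrakk>harmonic_on (ball x \<rho>) f g; \<rho> > 0;
        \<And>y. y \<in> ball x \<rho> \<Longrightarrow> \<bar>f y\<bar> \<le> M\<rbrakk> \<Longrightarrow> norm (g x) \<le> C * M / \<rho>"
    using harmonic_gradient_estimate by blast
  obtain R0 where R0: "R0 > 0" "closure \<Omega> \<subseteq> ball 0 R0"
    using bounded_subset_ballD[OF bounded_closure[OF bd]] by blast
  define K where "K = 2 * C * A2 * (1/2) powr (2 - n)"
  have est: "(g x \<bullet> g x) * u x powr (- ?a) \<le> (K\<^sup>2 * A1 powr (- ?a)) * norm x powr (2 - n)"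
    if x: "x \<in> - closure \<Omega>" "norm x \<ge> 2 * R0" for x
  proof -
    let ?N = "norm x"
    have N: "?N > 0" using R0(1) x(2) by linarith
    have sub: "y \<in> - closure \<Omega> \<and> norm y \<ge> ?N / 2" if "y \<in> ball x (?N / 2)" for y
    proof -
      have "norm y \<ge> ?N / 2" using that norm_triangle_ineq2[of x "x - y"] by (simp add: dist_norm norm_minus_commute)
      moreover have "y \<notin> ball 0 R0" using calculation x(2) by simp
      ultimately show ?thesis using R0(2) by auto
    qed
    have uy: "\<bar>u y\<bar> \<le> A2 * (?N / 2) powr (2 - n)" if "y \<in> ball x (?N / 2)" for y
    proof -
      note s = sub[OF that]
      have y0: "u y \<ge> 0" using lo'[of y] s A(1) by (smt (verit) mult_nonneg_nonneg powr_ge_zero)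
      have "u y \<le> A2 * norm y powr (2 - n)" using up'[of y] s by simp
      also have "\<dots> \<le> A2 * (?N / 2) powr (2 - n)"
        using s N n3 A(2) by (intro mult_left_mono powr_mono2') auto
      finally show ?thesis using y0 by simp
    qed
    have "norm (g x) \<le> C * (A2 * (?N / 2) powr (2 - n)) / (?N / 2)"
      by (rule C(2)[OF harmonic_on_subset[OF h] _ uy]) (use sub N in auto)
    also have "(?N / 2) powr (2 - n) = (1/2) powr (2 - n) * ?N powr (2 - n)"
      using N by (simp add: powr_divide)
    also have "C * (A2 * ((1/2) powr (2 - n) * ?N powr (2 - n))) / (?N / 2) = K * ?N powr (1 - n)"
    proof -
      have "?N powr (2 - n) = ?N powr (1 - n) * ?N" using N powr_add[of ?N "1 - n" 1] by simp
      then show ?thesis using N by (simp add: K_def)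
    qed
    finally have g: "norm (g x) \<le> K * ?N powr (1 - n)" .
    have "g x \<bullet> g x = (norm (g x))\<^sup>2" by (simp add: dot_square_norm)
    also have "\<dots> \<le> (K * ?N powr (1 - n))\<^sup>2"
      by (rule power_mono[OF g]) simp
    also have "\<dots> = K\<^sup>2 * ?N powr (2 - 2 * n)"
    proof -
      have "(?N powr (1 - n))\<^sup>2 = ?N powr (2 - 2 * n)"
        by (simp add: power2_eq_square flip: powr_add)
      then show ?thesis by (simp add: power_mult_distrib)
    qed
    finally have gg: "g x \<bullet> g x \<le> K\<^sup>2 * ?N powr (2 - 2 * n)" .
    have "u x powr (- ?a) \<le> (A1 * ?N powr (2 - n)) powr (- ?a)"
      using lo'[OF x(1)] A(1) N n3 by (intro powr_mono2') auto
    also have "\<dots> = A1 powr (- ?a) * ?N powr ((2 - n) * (- ?a))"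
      using A(1) by (simp add: powr_mult powr_powr)
    also have "(2 - n) * (- ?a) = n" using n3 by (simp add: field_simps)
    finally have uu: "u x powr (- ?a) \<le> A1 powr (- ?a) * ?N powr n" .
    have "(g x \<bullet> g x) * u x powr (- ?a) \<le>
        (K\<^sup>2 * ?N powr (2 - 2 * n)) * (A1 powr (- ?a) * ?N powr n)"
      by (rule mult_mono[OF gg uu]) auto
    also have "\<dots> = (K\<^sup>2 * A1 powr (- ?a)) * (?N powr (2 - 2 * n) * ?N powr n)"
      by (simp only: ac_simps)
    also have "?N powr (2 - 2 * n) * ?N powr n = ?N powr (2 - n)" by (simp flip: powr_add)
    finally show ?thesis .
  qed
  let ?K = "K\<^sup>2 * A1 powr (- ?a)"
  have "((\<lambda>N::real. ?K * N powr (2 - n)) \<longlongrightarrow> ?K * 0) at_top"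
    using n3 by (intro tendsto_mult_left tendsto_neg_powr filterlim_ident) auto
  then have "\<forall>\<^sub>F N in at_top. ?K * N powr (2 - n) < e"
    using e by (intro order_tendstoD(2)) auto
  then obtain R1 where "\<And>N. N \<ge> R1 \<Longrightarrow> ?K * N powr (2 - n) < e"
    unfolding eventually_at_top_linorder by blast
  then show ?thesis using est by (intro exI[of _ "max R1 (2 * R0)"]) (smt (verit) max.bounded_iff)
qed

section \<open>Rigidity and the boundary maximum\<close>

text \<open>Under the Hessian identity the field \<open>u^(-a) g\<close> has derivative \<open>- k I\<close> with the constant
  \<open>k = M / (n - 2)\<close>, so it equals \<open>- k (x - z)\<close> for some centre \<open>z\<close>. Comparing its norm with
  \<open>|g|\<^sup>2 u^(-a) = M u\<close> expresses \<open>u\<close> by \<open>|x - z|\<close>.\<close>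

lemma radial_of_extremal_gradient:
  fixes u :: "'a::euclidean_space \<Rightarrow> real" and g :: "'a \<Rightarrow> 'a"
  defines "n \<equiv> real DIM('a)"
  defines "a \<equiv> n / (n - 2)"
  assumes n: "n > 2" and s: "s > 0" and M: "M > 0"
    and pos: "\<And>x. x \<in> ball y s \<Longrightarrow> u x > 0"
    and du: "\<And>x. x \<in> ball y s \<Longrightarrow> (u has_derivative (\<lambda>w. g x \<bullet> w)) (at x)"
    and dg: "\<And>x. x \<in> ball y s \<Longrightarrow>
      (g has_derivative (\<lambda>w. (a / u x) *\<^sub>R ((g x \<bullet> w) *\<^sub>R g x - ((g x \<bullet> g x) / n) *\<^sub>R w))) (at x)"
    and P: "\<And>x. x \<in> ball y s \<Longrightarrow> (g x \<bullet> g x) * u x powr (- a) = M * u x"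
  obtains z A where "A > 0" "\<And>x. x \<in> ball y s \<Longrightarrow> x \<noteq> z \<and> u x = A * ((x - z) \<bullet> (x - z)) powr ((2 - n) / 2)"
proof -
  define k where "k = M / (n - 2)"
  have k: "k > 0" using M n by (simp add: k_def)
  define X where "X = (\<lambda>x. u x powr (- a) *\<^sub>R g x + k *\<^sub>R x)"
  have "(X has_derivative (\<lambda>w. 0)) (at x within ball y s)" if x: "x \<in> ball y s" for x
  proof (rule has_derivative_at_withinI)
    have u: "u x > 0" using pos[OF x] .
    have "((\<lambda>y. y powr - a) has_derivative (*) (- a * u x powr (- a - 1))) (at (u x))"
      using has_real_derivative_powr[OF u, of "- a"] by (simp add: has_field_derivative_def)
    note d = has_derivative_compose[OF du[OF x] this]
    have e: "u x powr (- a - 1) = u x powr (- a) / u x" using u by (simp add: powr_diff)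
    have K: "(g x \<bullet> g x) * (u x powr (- a) * a / (u x * n)) = k"
    proof -
      have "(g x \<bullet> g x) * (u x powr (- a) * a / (u x * n)) = ((g x \<bullet> g x) * u x powr (- a)) * (a / (u x * n))" by simp
      also have "\<dots> = M * u x * (a / (u x * n))" using P[OF x] by simp
      also have "\<dots> = k" using u n by (simp add: k_def a_def)
      finally show ?thesis .
    qed
    show "(X has_derivative (\<lambda>w. 0)) (at x)"
      unfolding X_def
    proof (rule has_derivative_eq_rhs[OF has_derivative_add[OF has_derivative_scaleR[OF d dg[OF x]]
            has_derivative_scaleR_right[OF has_derivative_ident]]], rule ext)
      fix w
      have "u x powr - a *\<^sub>R (a / u x) *\<^sub>R ((g x \<bullet> w) *\<^sub>R g x - (g x \<bullet> g x / n) *\<^sub>R w) +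
         (- a * u x powr (- a - 1) * (g x \<bullet> w)) *\<^sub>R g x + k *\<^sub>R w
         = (k - (g x \<bullet> g x) * (u x powr (- a) * a / (u x * n))) *\<^sub>R w"
        unfolding e by (simp add: algebra_simps)
      also have "\<dots> = 0" unfolding K by simp
      finally show "u x powr - a *\<^sub>R (a / u x) *\<^sub>R ((g x \<bullet> w) *\<^sub>R g x - (g x \<bullet> g x / n) *\<^sub>R w) +
         (- a * u x powr (- a - 1) * (g x \<bullet> w)) *\<^sub>R g x + k *\<^sub>R w = 0" .
    qed
  qed
  then have "\<exists>c. \<forall>x\<in>ball y s. X x = c"
    by (rule has_derivative_zero_constant[OF convex_ball])
  then obtain c where c: "\<And>x. x \<in> ball y s \<Longrightarrow> X x = c" by blast
  define z where "z = c /\<^sub>R k"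
  define B where "B = (M / k\<^sup>2) powr ((2 - n) / 2)"
  have B: "B > 0" using M k by (simp add: B_def)
  have "x \<noteq> z \<and> u x = (1 / B) * ((x - z) \<bullet> (x - z)) powr ((2 - n) / 2)" if x: "x \<in> ball y s" for x
  proof -
    have u: "u x > 0" using pos[OF x] .
    have "u x powr (- a) *\<^sub>R g x = c - k *\<^sub>R x" using c[OF x] by (simp add: X_def algebra_simps)
    also have "\<dots> = - (k *\<^sub>R (x - z))" using k by (simp add: z_def algebra_simps)
    finally have e: "u x powr (- a) *\<^sub>R g x = - (k *\<^sub>R (x - z))" .
    have "k\<^sup>2 * ((x - z) \<bullet> (x - z)) = (- (k *\<^sub>R (x - z))) \<bullet> (- (k *\<^sub>R (x - z)))"
      by (simp add: power2_eq_square)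
    also have "\<dots> = u x powr (- a) * ((g x \<bullet> g x) * u x powr (- a))"
      unfolding e[symmetric] by simp
    also have "\<dots> = M * (u x powr (- a) * u x powr 1)" using P[OF x] u by simp
    also have "\<dots> = M * u x powr (1 - a)" unfolding powr_add[symmetric] by simp
    finally have r: "(x - z) \<bullet> (x - z) = (M / k\<^sup>2) * u x powr (1 - a)"
      using k by (simp add: field_simps)
    then have "(x - z) \<bullet> (x - z) > 0" using M k u by simp
    then have "x \<noteq> z" by auto
    moreover have "((x - z) \<bullet> (x - z)) powr ((2 - n) / 2) = B * u x powr ((1 - a) * ((2 - n) / 2))"
      unfolding r B_def powr_powr[symmetric] using M by (subst powr_mult) auto
    moreover have "(1 - a) * ((2 - n) / 2) = 1" using n by (simp add: a_def field_simps)
    ultimately show ?thesis using u B by simp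
  qed
  then show thesis using that[of "1 / B" z] B by simp
qed

lemma has_C2_locally_constant_trace:
  assumes "has_C2 S f g H" "open S" "\<And>x. x \<in> S \<Longrightarrow> f x = k" "x \<in> S"
  shows "blinfun_trace (H x) = 0"
proof -
  have g: "g y = 0" if "y \<in> S" for y
  proof (rule gradient_unique[OF has_C2D(1)[OF assms(1) that]])
    have "((\<lambda>_. k) has_derivative (\<lambda>w. 0 \<bullet> w)) (at y)" by simp
    then show "(f has_derivative (\<lambda>w. 0 \<bullet> w)) (at y)"
      by (rule has_derivative_transform_within_open[OF _ assms(2) that]) (use assms(3) in auto)
  qed
  have "((\<lambda>_. 0) has_derivative blinfun_apply (H x)) (at x)"
    by (rule has_derivative_transform_within_open[OF has_C2D(2)[OF assms(1,4)] assms(2,4)]) (use g in auto)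
  then have "blinfun_apply (H x) = (\<lambda>_. 0)" using has_derivative_const has_derivative_unique by blast
  then show ?thesis by (simp add: blinfun_trace_def)
qed

lemma has_derivative_along_ray:
  fixes f :: "'a::real_normed_vector \<Rightarrow> 'b::real_normed_vector"
  assumes d: "(f has_derivative D) (at x within S)"
    and ray: "\<forall>\<^sub>F t in at_right 0. x + t *\<^sub>R w \<in> S"
  shows "((\<lambda>t. f (x + t *\<^sub>R w)) has_vector_derivative D w) (at_right 0)"
proof -
  obtain t0 where t0: "t0 > 0" "\<And>t. 0 < t \<Longrightarrow> t < t0 \<Longrightarrow> x + t *\<^sub>R w \<in> S"
    using ray unfolding eventually_at_right_field by auto
  let ?I = "{0<..<t0}" and ?c = "\<lambda>t. x + t *\<^sub>R w"
  have "(?c has_derivative (\<lambda>h. h *\<^sub>R w)) (at 0 within ?I)"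
    by (auto intro!: derivative_eq_intros)
  moreover have "(f has_derivative D) (at (?c 0) within ?c ` ?I)"
  proof -
    have "?c ` ?I \<subseteq> S" using t0(2) by (force simp: image_subset_iff)
    from has_derivative_subset[OF d this] show ?thesis by simp
  qed
  ultimately have "((\<lambda>t. f (?c t)) has_derivative (\<lambda>h. D (h *\<^sub>R w))) (at 0 within ?I)"
    by (rule has_derivative_in_compose)
  moreover have "D (h *\<^sub>R w) = h *\<^sub>R D w" for h
    using linear_cmul[OF has_derivative_linear[OF d]] .
  moreover have "at 0 within ?I = at_right 0" 
    by (rule at_within_nhd[where S="{..<t0}"]) (use t0(1) in auto)
  ultimately show ?thesis by (simp add: has_vector_derivative_def)
qed

text \<open>Let \<open>M\<close> be the maximum of \<open>P = |g|\<^sup>2 u^(-a-1)\<close> over the level set, attained at \<open>x0\<close>, and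
  \<open>Z = |g|\<^sup>2 u^(-a) - M u = u (P - M)\<close>. Then \<open>Z\<close> is subharmonic, nonpositive on \<open>{u = c}\<close> and vanishes at
  infinity, hence \<open>Z \<le> 0\<close> on \<open>{u < c}\<close>. If \<open>Z\<close> vanishes at some point of \<open>{u < c}\<close>, it vanishes in a
  neighbourhood, and the equality case of the Bochner formula makes \<open>u\<close> radial there. Otherwise \<open>Z\<close>
  lies below a negative constant on \<open>{u = c / 2}\<close>. As \<open>u\<close> itself is harmonic, \<open>c - u\<close> can serve as
  the barrier of a Hopf lemma: \<open>Z + \<epsilon> (c - u) \<le> 0\<close> on \<open>{c / 2 < u < c}\<close> with equality at \<open>x0\<close>. The
  derivative of \<open>Z\<close> at \<open>x0\<close> in direction \<open>g\<close> is then at least \<open>\<epsilon> |g|\<^sup>2 > 0\<close>, whereas the curvature bound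
  says exactly that it is at most \<open>0\<close>.\<close>

lemma locally_radial_of_curvature_bound:
  fixes \<Omega> :: "'a::euclidean_space set" and u :: "'a \<Rightarrow> real" and g :: "'a \<Rightarrow> 'a"
  defines "n \<equiv> real DIM('a)"
  assumes dim: "DIM('a) \<ge> 3" and \<Omega>: "open \<Omega>" "bounded \<Omega>" "0 \<in> \<Omega>"
    and cont: "continuous_on (- \<Omega>) u" and h: "harmonic_on (- closure \<Omega>) u g"
    and one: "\<And>x. x \<in> frontier \<Omega> \<Longrightarrow> u x = 1" and lim: "(u \<longlongrightarrow> 0) at_infinity"
    and c: "0 < c" "c \<le> 1"
    and cg: "continuous_on {x\<in>- \<Omega>. u x \<le> c} g"
    and reg: "\<And>x. x \<in> - \<Omega> \<Longrightarrow> u x = c \<Longrightarrow> g x \<noteq> 0"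
    and du: "\<And>x. x \<in> - \<Omega> \<Longrightarrow> u x = c \<Longrightarrow> (u has_derivative (\<lambda>w. g x \<bullet> w)) (at x within - \<Omega>)"
    and dg: "\<And>x. x \<in> - \<Omega> \<Longrightarrow> u x = c \<Longrightarrow> (g has_derivative A x) (at x within - \<Omega>)"
    and curv: "\<And>x. x \<in> - \<Omega> \<Longrightarrow> u x = c \<Longrightarrow> A x (g x) \<bullet> g x \<le> (n - 1) / (n - 2) * (g x \<bullet> g x)\<^sup>2 / c"
    and ray: "\<And>x. x \<in> - \<Omega> \<Longrightarrow> u x = c \<Longrightarrow> \<forall>\<^sub>F t in at_right 0. x - t *\<^sub>R g x \<in> - \<Omega>"
  obtains y s z B where "s > 0" "B > 0" "ball y s \<subseteq> - closure \<Omega>"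
    "\<And>x. x \<in> ball y s \<Longrightarrow> x \<noteq> z \<and> u x = B * ((x - z) \<bullet> (x - z)) powr ((2 - n) / 2)"
proof -
  define a where "a = n / (n - 2)"
  have n: "n > 2" "n \<ge> 3" using dim by (auto simp: n_def)
  have a1: "a + 1 = 2 * ((n - 1) / (n - 2))" using n by (simp add: a_def field_simps)
  note ext = exterior_domain[OF \<Omega>(1)]
  obtain A1 A2 where A12: "A1 > 0" "A2 > 0"
    and lo: "\<And>x. x \<in> - closure \<Omega> \<Longrightarrow> A1 * (x \<bullet> x) powr ((2 - n) / 2) \<le> u x"
    and up: "\<And>x. x \<in> - closure \<Omega> \<Longrightarrow> u x \<le> A2 * (x \<bullet> x) powr ((2 - n) / 2)"
    using exterior_harmonic_growth[OF dim \<Omega> cont h one lim] unfolding n_def by blast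
  have uO: "u x > 0" if "x \<in> - closure \<Omega>" for x
  proof -
    have "x \<noteq> 0" using that \<Omega>(3) closure_subset by auto
    then show ?thesis using lo[OF that] A12(1) by (smt (verit) inner_gt_zero_iff mult_pos_pos powr_gt_zero)
  qed
  then have upos: "u x > 0" if "x \<in> - \<Omega>" for x
    using that one unfolding ext(3) by fastforce
  have inO: "x \<in> - closure \<Omega>" if "x \<in> - \<Omega>" "u x < 1" for x
    using that one unfolding ext(3) by fastforce
  have openO: "open (- closure \<Omega>)" by (rule open_Compl[OF closed_closure])
  have closedS: "closed (- \<Omega>)" using \<Omega>(1) by (rule closed_Compl)
  have level_compact: "compact {x\<in>- \<Omega>. u x = d}" if d: "d > 0" for d
  proof -
    have "closed ((- \<Omega>) \<inter> u -` {d})" by (intro continuous_closed_preimage cont closedS closed_singleton)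
    moreover have "(- \<Omega>) \<inter> u -` {d} = {x\<in>- \<Omega>. u x = d}" by auto
    moreover have "\<forall>\<^sub>F x in at_infinity. u x < d" using lim d by (rule order_tendstoD)
    then obtain R where "\<And>x. norm x \<ge> R \<Longrightarrow> u x < d" unfolding eventually_at_infinity by blast
    then have "{x\<in>- \<Omega>. u x = d} \<subseteq> cball 0 R" by (smt (verit) mem_Collect_eq mem_cball_0 subsetI)
    ultimately show ?thesis using bounded_cball bounded_subset compact_eq_bounded_closed by metis
  qed
  define L where "L = {x\<in>- \<Omega>. u x = c}"
  define E where "E = - closure \<Omega> \<inter> u -` {..<c}"
  define E' where "E' = - \<Omega> \<inter> u -` {..c}"
  have compL: "compact L" unfolding L_def by (rule level_compact[OF c(1)])
  have cuO: "continuous_on (- closure \<Omega>) u" by (rule harmonic_on_continuous[OF h])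
  have openE: "open E" unfolding E_def by (rule continuous_open_preimage[OF cuO openO open_lessThan])
  have closedE': "closed E'"
    unfolding E'_def by (intro continuous_closed_preimage cont closedS closed_atMost)
  have "E \<subseteq> E'" using closure_subset by (auto simp: E_def E'_def)
  then have clE: "closure E \<subseteq> E'" using closedE' by (rule closure_minimal)
  have frE: "frontier E \<subseteq> L"
  proof
    fix x assume x: "x \<in> frontier E"
    then have "x \<in> E'" "x \<notin> E" using clE openE by (auto simp: frontier_def interior_open)
    then show "x \<in> L" using inO[of x] c by (cases "u x < c") (auto simp: E_def E'_def L_def)
  qed
  \<comment> \<open>Otherwise \<open>E\<close> would have empty frontier, although it is neither empty nor everything.\<close>
  have neL: "L \<noteq> {}"
  proof
    assume "L = {}"
    then have "E = {} \<or> E = UNIV" using frE frontier_eq_empty by blast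
    moreover have "0 \<notin> E" using \<Omega>(3) closure_subset by (auto simp: E_def)
    moreover have "E \<noteq> {}"
    proof -
      have "\<forall>\<^sub>F x in at_infinity. u x < c" using lim c(1) by (rule order_tendstoD)
      then obtain R where R: "\<And>x. norm x \<ge> R \<Longrightarrow> u x < c" unfolding eventually_at_infinity by blast
      obtain R' where R': "\<Omega> \<subseteq> ball 0 R'" using \<Omega>(2) bounded_subset_ballD by blast
      obtain x :: 'a where x: "norm x = max 0 (max R R')"
        using vector_choose_size[of "max 0 (max R R')"] by auto
      then have "x \<in> - \<Omega>" "u x < c" using R[of x] R' by auto
      then show ?thesis using inO[of x] c by (auto simp: E_def)
    qed
    ultimately show False by auto
  qed
  let ?P = "\<lambda>x. (g x \<bullet> g x) * u x powr (- a - 1)"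
  have L_E': "L \<subseteq> E'" by (auto simp: L_def E'_def)
  have cgE: "continuous_on E' g" using cg by (simp add: E'_def Int_def vimage_def)
  have cuE: "continuous_on E' u" using cont by (rule continuous_on_subset) (auto simp: E'_def)
  have uE: "u x > 0" if "x \<in> E'" for x using that upos by (simp add: E'_def)
  have "continuous_on L ?P"
    by (intro continuous_intros continuous_on_subset[OF cgE L_E'] continuous_on_subset[OF cuE L_E'])
      (use uE L_E' in force)
  then obtain x0 where x0: "x0 \<in> L" "\<And>x. x \<in> L \<Longrightarrow> ?P x \<le> ?P x0"
    using continuous_attains_sup[OF compL neL] by blast
  define M where "M = ?P x0"
  have x0S: "x0 \<in> - \<Omega>" and ux0: "u x0 = c" using x0(1) by (auto simp: L_def)
  have g0: "g x0 \<bullet> g x0 > 0" using reg[OF x0S ux0] by simp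
  have M: "M > 0" using g0 c(1) by (simp add: M_def ux0)
  define Z where "Z = (\<lambda>x. (g x \<bullet> g x) * u x powr (- a) + (- M) * u x)"
  have ZP: "Z x = u x * (?P x - M)" if "u x > 0" for x
  proof -
    have "u x powr (- a) = u x powr (- a - 1) * u x powr 1"
      unfolding powr_add[symmetric] by simp
    then show ?thesis using that by (simp add: Z_def algebra_simps)
  qed
  have ZL: "Z x \<le> 0" if "x \<in> L" for x
    using x0(2)[OF that] ZP[of x] that c(1) by (auto simp: M_def L_def mult_le_0_iff)
  have Z0: "Z x0 = 0" using ZP[of x0] ux0 c(1) by (simp add: M_def)
  have cZ: "continuous_on E' Z"
    unfolding Z_def by (intro continuous_intros cgE cuE) (use uE in force)
  obtain G H where W: "has_C2 (- closure \<Omega>) (\<lambda>x. (g x \<bullet> g x) * u x powr (- a)) G H"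
    and trH: "\<And>x. x \<in> - closure \<Omega> \<Longrightarrow> blinfun_trace (H x) \<ge> 0"
    and eqH: "\<And>x. x \<in> - closure \<Omega> \<Longrightarrow> blinfun_trace (H x) = 0 \<Longrightarrow>
      (g has_derivative (\<lambda>w. (a / u x) *\<^sub>R ((g x \<bullet> w) *\<^sub>R g x - ((g x \<bullet> g x) / n) *\<^sub>R w))) (at x)"
    using bochner_gradient_quotient[OF _ h openO uO] n(1) unfolding n_def a_def by blast
  obtain K where K: "has_C2 (- closure \<Omega>) u g K" "\<And>x. x \<in> - closure \<Omega> \<Longrightarrow> blinfun_trace (K x) = 0"
    using h unfolding harmonic_on_def by blast
  define HZ where "HZ = (\<lambda>x. H x + (- M) *\<^sub>R K x)"
  have CZ: "has_C2 (- closure \<Omega>) Z (\<lambda>x. G x + (- M) *\<^sub>R g x) HZ"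
    unfolding Z_def HZ_def by (intro has_C2_add has_C2_cmult W K)
  have trZ: "blinfun_trace (HZ x) = blinfun_trace (H x)" if "x \<in> - closure \<Omega>" for x
    using K(2)[OF that] unfolding HZ_def blinfun_trace_simps by simp
  have E_O: "E \<subseteq> - closure \<Omega>" by (auto simp: E_def)
  \<comment> \<open>Maximum principle on the unbounded set \<open>E\<close>; at infinity \<open>Z\<close> is bounded above by the decaying quotient.\<close>
  have ZE: "Z x \<le> 0" if x: "x \<in> E" for x
  proof (rule maximum_principle[OF openE has_C2_subset[OF CZ E_O] continuous_on_subset[OF cZ clE] _ _ _ x])
    show "blinfun_trace (HZ y) \<ge> 0" if "y \<in> E" for y
      using trZ[OF subsetD[OF E_O that]] trH[OF subsetD[OF E_O that]] by (simp only:)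
    show "Z y \<le> 0" if "y \<in> frontier E" for y using ZL frE that by blast
    fix e :: real assume "e > 0"
    then obtain R where R: "\<forall>x\<in>- closure \<Omega>. norm x \<ge> R \<longrightarrow> (g x \<bullet> g x) * u x powr (- a) < e"
      using gradient_quotient_decay[OF dim \<Omega>(2) h A12 lo[unfolded n_def] up[unfolded n_def]]
      unfolding a_def n_def by blast
    have "Z x < e" if "x \<in> E" "norm x \<ge> R" for x
    proof -
      have "(g x \<bullet> g x) * u x powr (- a) < e" using R that E_O by blast
      moreover have "M * u x > 0" using M uO that E_O by (meson mult_pos_pos subsetD)
      ultimately show ?thesis by (simp add: Z_def)
    qed
    then show "\<exists>R. \<forall>x\<in>E. norm x \<ge> R \<longrightarrow> Z x < e" by blast
  qed
  have "\<exists>y\<in>E. Z y = 0"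
  proof (rule ccontr)
    assume "\<not> (\<exists>y\<in>E. Z y = 0)"
    then have Zneg: "Z y < 0" if "y \<in> E" for y using ZE that by force
    define L' where "L' = {x\<in>- \<Omega>. u x = c / 2}"
    have L'E: "L' \<subseteq> E" using inO c by (auto simp: L'_def E_def)
    have compL': "compact L'" unfolding L'_def using c(1) by (intro level_compact) simp
    have "\<exists>\<delta>>0. \<forall>x\<in>L'. Z x \<le> - \<delta>"
    proof (cases "L' = {}")
      case False
      have "continuous_on L' Z" using cZ by (rule continuous_on_subset) (use L'E \<open>E \<subseteq> E'\<close> in blast)
      then obtain m where "m \<in> L'" "\<And>x. x \<in> L' \<Longrightarrow> Z x \<le> Z m"
        using continuous_attains_sup[OF compL' False] by blast
      then show ?thesis using Zneg[of m] L'E by (intro exI[of _ "- Z m"]) auto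
    qed (auto intro: exI[of _ 1])
    then obtain \<delta> where \<delta>: "\<delta> > 0" "\<And>x. x \<in> L' \<Longrightarrow> Z x \<le> - \<delta>" by blast
    \<comment> \<open>With this choice the barrier \<open>\<epsilon> (c - u)\<close> equals \<open>\<delta>\<close> on \<open>{u = c / 2}\<close>.\<close>
    define \<epsilon> where "\<epsilon> = 2 * \<delta> / c"
    have \<epsilon>: "\<epsilon> > 0" using \<delta>(1) c(1) by (simp add: \<epsilon>_def)
    define F where "F = (\<lambda>x. Z x + (\<epsilon> * c + (- \<epsilon>) * u x))"
    define V where "V = - closure \<Omega> \<inter> u -` {c / 2<..<c}"
    have V_O: "V \<subseteq> - closure \<Omega>" by (auto simp: V_def)
    have openV: "open V"
      unfolding V_def by (rule continuous_open_preimage[OF cuO openO open_greaterThanLessThan])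
    let ?V' = "- \<Omega> \<inter> u -` {c / 2..c}"
    have clV: "closure V \<subseteq> ?V'"
    proof (rule closure_minimal)
      show "V \<subseteq> ?V'" using closure_subset by (auto simp: V_def)
      show "closed ?V'" by (intro continuous_closed_preimage cont closedS closed_atLeastAtMost)
    qed
    have V'E: "?V' \<subseteq> E'" by (auto simp: E'_def)
    have clVE: "closure V \<subseteq> E'" using clV V'E by blast
    have CF: "has_C2 V F (\<lambda>x. (G x + (- M) *\<^sub>R g x) + (0 + (- \<epsilon>) *\<^sub>R g x)) (\<lambda>x. HZ x + (0 + (- \<epsilon>) *\<^sub>R K x))"
      unfolding F_def
      by (intro has_C2_add has_C2_cmult has_C2_const has_C2_subset[OF CZ V_O] has_C2_subset[OF K(1) V_O])
    have FV: "F x \<le> 0" if x: "x \<in> V" for x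
    proof (rule maximum_principle[OF openV CF _ _ _ _ x])
      show "continuous_on (closure V) F"
        unfolding F_def
        by (intro continuous_intros continuous_on_subset[OF cZ clVE] continuous_on_subset[OF cuE clVE])
      show "blinfun_trace (HZ y + (0 + - \<epsilon> *\<^sub>R K y)) \<ge> 0" if "y \<in> V" for y
        using trZ[OF subsetD[OF V_O that]] trH[OF subsetD[OF V_O that]] K(2)[OF subsetD[OF V_O that]]
        unfolding blinfun_trace_simps by simp
      show "F y \<le> 0" if "y \<in> frontier V" for y
      proof -
        have y: "y \<in> ?V'" "y \<notin> V" using that clV openV by (auto simp: frontier_def interior_open)
        then consider "y \<in> L" | "y \<in> L'" using inO[of y] c by (force simp: V_def L_def L'_def)
        then show ?thesis
        proof cases
          case 1 then show ?thesis using ZL[OF 1] by (simp add: F_def L_def)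
        next
          case 2
          then have uy: "u y = c / 2" by (simp add: L'_def)
          have "\<epsilon> * c + - \<epsilon> * (c / 2) = \<delta>" using c(1) by (simp add: \<epsilon>_def)
          then show ?thesis using \<delta>(2)[OF 2] unfolding F_def uy by linarith
        qed
      qed
      obtain R where R: "\<And>x. norm x \<ge> R \<Longrightarrow> u x < c / 2"
      proof -
        have "\<forall>\<^sub>F x in at_infinity. u x < c / 2" using lim c(1) by (intro order_tendstoD) auto
        then show thesis using that unfolding eventually_at_infinity by blast
      qed
      show "\<exists>R. \<forall>x\<in>V. norm x \<ge> R \<longrightarrow> F x < e" for e
        using R by (intro exI[of _ R]) (force simp: V_def)
    qed
    let ?g = "g x0" and ?A = "A x0"
    \<comment> \<open>The ray from \<open>x0\<close> into \<open>{u < c}\<close>, along which \<open>F\<close> cannot increase initially.\<close>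
    let ?\<gamma> = "\<lambda>t. x0 - t *\<^sub>R ?g"
    note ray0 = ray[OF x0S ux0] and du0 = du[OF x0S ux0] and dg0 = dg[OF x0S ux0]
    have chain: "((\<lambda>t. f (?\<gamma> t)) has_real_derivative f' (- ?g)) (at_right 0)"
      if "(f has_derivative f') (at x0 within - \<Omega>)" for f :: "'a \<Rightarrow> real" and f'
      using has_derivative_along_ray[OF that, of "- ?g"] ray0
      by (simp add: has_real_derivative_iff_has_vector_derivative)
    have d\<gamma>: "((\<lambda>t. u (?\<gamma> t)) has_real_derivative ?g \<bullet> (- ?g)) (at_right 0)" by (rule chain[OF du0])
    from has_real_derivative_neg_dec_right[OF this] g0
    obtain d where d: "d > 0" "\<And>t. 0 < t \<Longrightarrow> t < d \<Longrightarrow> u (?\<gamma> t) < c" using ux0 by auto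
    have "\<forall>\<^sub>F t in at_right 0. u (?\<gamma> t) < c" by (rule eventually_at_rightI[of 0 d]) (use d in auto)
    moreover have "((\<lambda>t. u (?\<gamma> t)) \<longlongrightarrow> c) (at_right 0)"
      using DERIV_continuous[OF d\<gamma>] ux0 by (simp add: continuous_within)
    then have "\<forall>\<^sub>F t in at_right 0. u (?\<gamma> t) > c / 2"
      by (rule order_tendstoD) (use c(1) in simp)
    ultimately have Fneg: "\<forall>\<^sub>F t in at_right 0. F (?\<gamma> t) \<le> 0"
      using ray0
    proof eventually_elim
      case (elim t)
      then have "?\<gamma> t \<in> V" using inO[of "?\<gamma> t"] c by (auto simp: V_def)
      then show ?case by (rule FV)
    qed
    let ?D = "\<lambda>w. ((?g \<bullet> ?g) * (- a * c powr (- a - 1) * (?g \<bullet> w)) + (?g \<bullet> ?A w + ?A w \<bullet> ?g) * c powr (- a)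
        + - M * (?g \<bullet> w)) + (0 + - \<epsilon> * (?g \<bullet> w))"
    have "(F has_derivative ?D) (at x0 within - \<Omega>)"
    proof -
      have "((\<lambda>y. y powr - a) has_derivative (*) (- a * c powr (- a - 1))) (at (u x0))"
        using has_real_derivative_powr[OF c(1), of "- a"] by (simp add: has_field_derivative_def ux0)
      note dp = has_derivative_compose[OF du0 this]
      have "(F has_derivative (\<lambda>w. ((?g \<bullet> ?g) * (- a * c powr (- a - 1) * (?g \<bullet> w)) + (?g \<bullet> ?A w + ?A w \<bullet> ?g) * u x0 powr (- a)
        + - M * (?g \<bullet> w)) + (0 + - \<epsilon> * (?g \<bullet> w)))) (at x0 within - \<Omega>)"
        unfolding F_def Z_def
        by (intro has_derivative_add has_derivative_mult has_derivative_inner dg0 dp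
            has_derivative_mult_right du0 has_derivative_const)
      then show ?thesis by (simp add: ux0)
    qed
    note dF = chain[OF this]
    have "?D (- ?g) \<le> 0"
    proof (rule ccontr)
      assume "\<not> ?D (- ?g) \<le> 0"
      then obtain e where e: "e > 0" "\<And>t. t > 0 \<Longrightarrow> t < e \<Longrightarrow> F (?\<gamma> 0) < F (?\<gamma> t)"
        using has_real_derivative_pos_inc_right[OF dF] by auto
      have "F (?\<gamma> 0) = 0" using Z0 ux0 by (simp add: F_def)
      then have "\<forall>\<^sub>F t in at_right 0. 0 < F (?\<gamma> t)"
        by (intro eventually_at_rightI[of 0 e]) (use e in auto)
      with Fneg have "\<forall>\<^sub>F t in at_right (0::real). False" by eventually_elim simp
      then show False by simp
    qed
    moreover have "?A (- ?g) = - ?A ?g"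
      using linear_neg[OF has_derivative_linear[OF dg0]] .
    ultimately have "a * c powr (- a - 1) * (?g \<bullet> ?g)\<^sup>2 - 2 * (?A ?g \<bullet> ?g) * c powr (- a) + M * (?g \<bullet> ?g) + \<epsilon> * (?g \<bullet> ?g) \<le> 0"
      by (simp add: inner_commute[of ?g "?A ?g"] power2_eq_square algebra_simps)
    moreover have "M = (?g \<bullet> ?g) * c powr (- a - 1)" by (simp add: M_def ux0)
    moreover have "2 * (?A ?g \<bullet> ?g) * c powr (- a) \<le> (a + 1) * c powr (- a - 1) * (?g \<bullet> ?g)\<^sup>2"
    proof -
      have "2 * (?A ?g \<bullet> ?g) * c powr (- a) \<le> 2 * ((n - 1) / (n - 2) * (?g \<bullet> ?g)\<^sup>2 / c) * c powr (- a)"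
        using curv[OF x0S ux0] by (intro mult_right_mono) auto
      also have "\<dots> = (a + 1) * (c powr (- a) / c) * (?g \<bullet> ?g)\<^sup>2" unfolding a1 by simp
      also have "c powr (- a) / c = c powr (- a - 1)" using c(1) by (simp add: powr_diff)
      finally show ?thesis .
    qed
    ultimately have "\<epsilon> * (?g \<bullet> ?g) \<le> 0" by (simp add: algebra_simps power2_eq_square)
    then show False using mult_pos_pos[OF \<epsilon> g0] by linarith
  qed
  then obtain y where y: "y \<in> E" "Z y = 0" by blast
  obtain \<rho> where \<rho>: "\<rho> > 0" "ball y \<rho> \<subseteq> E" using openE y(1) open_contains_ball by blast
  have \<rho>O: "ball y \<rho> \<subseteq> - closure \<Omega>" using \<rho>(2) E_O by blast
  obtain \<delta> where \<delta>: "\<delta> > 0" "\<And>x. x \<in> ball y \<delta> \<Longrightarrow> Z x = Z y"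
  proof (rule subharmonic_local_max_constant[OF has_C2_subset[OF CZ \<rho>O] \<rho>(1)])
    show "blinfun_trace (HZ x) \<ge> 0" if "x \<in> ball y \<rho>" for x
      using trZ[OF subsetD[OF \<rho>O that]] trH[OF subsetD[OF \<rho>O that]] by (simp only:)
    show "Z x \<le> Z y" if "x \<in> ball y \<rho>" for x using ZE \<rho>(2) that y(2) by auto
  qed blast
  define s where "s = min \<delta> \<rho>"
  have s: "s > 0" "ball y s \<subseteq> - closure \<Omega>" and Zs: "\<And>x. x \<in> ball y s \<Longrightarrow> Z x = 0"
    using \<delta> \<rho> \<rho>O y(2) by (auto simp: s_def)
  have trs: "blinfun_trace (H x) = 0" if "x \<in> ball y s" for x
    using has_C2_locally_constant_trace[OF has_C2_subset[OF CZ s(2)] open_ball Zs that] trZ s(2) that by auto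
  obtain z B where "B > 0" "\<And>x. x \<in> ball y s \<Longrightarrow> x \<noteq> z \<and> u x = B * ((x - z) \<bullet> (x - z)) powr ((2 - n) / 2)"
    unfolding n_def
  proof (rule radial_of_extremal_gradient[OF _ s(1) M])
    fix x assume x: "x \<in> ball y s"
    then have xO: "x \<in> - closure \<Omega>" using s(2) by blast
    show "u x > 0" by (rule uO[OF xO])
    show "(u has_derivative (\<lambda>w. g x \<bullet> w)) (at x)" by (rule harmonic_on_derivative[OF h xO])
    show "(g has_derivative (\<lambda>w. (real DIM('a) / (real DIM('a) - 2) / u x) *\<^sub>R
        ((g x \<bullet> w) *\<^sub>R g x - ((g x \<bullet> g x) / real DIM('a)) *\<^sub>R w))) (at x)"
      using eqH[OF xO trs[OF x]] unfolding a_def n_def .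
    show "(g x \<bullet> g x) * u x powr (- (real DIM('a) / (real DIM('a) - 2))) = M * u x"
      using Zs[OF x] unfolding Z_def a_def n_def by simp
  qed (use n in \<open>auto simp: n_def\<close>)
  then show thesis using that[OF s(1) _ s(2)] by blast
qed

section \<open>Exterior domains with smooth boundary\<close>

lemma has_derivative_gradient:
  fixes f :: "'a::euclidean_space \<Rightarrow> real"
  assumes "f differentiable (at x within S)"
  shows "(f has_derivative (\<lambda>w. grad S f x \<bullet> w)) (at x within S)"
proof -
  let ?D = "frechet_derivative f (at x within S)"
  have d: "(f has_derivative ?D) (at x within S)" using assms frechet_derivative_works by blast
  have "?D w = grad S f x \<bullet> w" for w
  proof -
    have "?D w = ?D (\<Sum>b\<in>Basis. (w \<bullet> b) *\<^sub>R b)" by (simp add: euclidean_representation)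
    also have "\<dots> = (\<Sum>b\<in>Basis. (w \<bullet> b) *\<^sub>R ?D b)"
      using has_derivative_linear[OF d] by (simp add: linear_sum linear_cmul)
    also have "\<dots> = grad S f x \<bullet> w"
      unfolding grad_def pd_def inner_sum_left
      by (intro sum.cong refl) (simp add: inner_commute mult.commute)
    finally show ?thesis .
  qed
  then show ?thesis by (intro has_derivative_eq_rhs[OF d] ext)
qed


text \<open>The vector \<open>q\<close> is the gradient of a defining function at \<open>p\<close>: it increases along every \<open>w\<close> with
  \<open>q \<bullet> w > 0\<close>, and points where it is positive lie outside the closure.\<close>

lemma smooth_boundary_exterior_cone:
  fixes \<Omega> :: "'a::euclidean_space set"
  assumes sb: "smooth_boundary \<Omega>" and o: "open \<Omega>" and p: "p \<in> frontier \<Omega>"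
  obtains q where "q \<noteq> 0" "\<And>w. q \<bullet> w > 0 \<Longrightarrow> \<forall>\<^sub>F t in at_right 0. p + t *\<^sub>R w \<in> - closure \<Omega>"
proof -
  from bspec[OF sb[unfolded smooth_boundary_def] p]
  obtain U \<rho> where U: "open U" "p \<in> U" and C: "\<forall>k. Ck_on k U \<rho>"
    and g: "\<forall>x\<in>U. grad U \<rho> x \<noteq> 0" and eq: "\<Omega> \<inter> U = {x\<in>U. \<rho> x < 0}"
    by (elim exE conjE) (rule that)
  have diff: "\<rho> differentiable_on U" using spec[OF C, of "Suc 0"] by simp
  then have cont: "continuous_on U \<rho>" by (rule differentiable_imp_continuous_on)
  let ?q = "grad U \<rho> p"
  have "\<rho> differentiable (at p within U)" using diff U(2) by (simp add: differentiable_on_def)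
  from has_derivative_gradient[OF this]
  have d: "(\<rho> has_derivative (\<lambda>w. ?q \<bullet> w)) (at p)" by (simp only: at_within_open[OF U(2,1)])
  have neg: "\<rho> y < 0 \<longleftrightarrow> y \<in> \<Omega>" if "y \<in> U" for y using eq that by blast
  have out: "x \<in> - closure \<Omega>" if "x \<in> U" "\<rho> x > 0" for x
  proof -
    have "open (U \<inter> \<rho> -` {0<..})" using cont U(1) by (intro continuous_open_preimage) auto
    moreover have "(U \<inter> \<rho> -` {0<..}) \<inter> \<Omega> = {}" using neg by force
    ultimately have "(U \<inter> \<rho> -` {0<..}) \<inter> closure \<Omega> = {}" by (simp add: open_Int_closure_eq_empty)
    then show ?thesis using that by auto
  qed
  have p0: "\<rho> p \<ge> 0"
  proof -
    have "p \<notin> \<Omega>" using p o by (simp add: frontier_def interior_open)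
    then show ?thesis using neg[OF U(2)] by linarith
  qed
  have p1: "\<rho> p \<le> 0"
  proof (rule ccontr)
    assume "\<not> \<rho> p \<le> 0"
    then have "p \<in> - closure \<Omega>" using out U(2) by simp
    then show False using p by (simp add: frontier_def)
  qed
  have "\<forall>\<^sub>F t in at_right 0. p + t *\<^sub>R w \<in> - closure \<Omega>" if w: "?q \<bullet> w > 0" for w
  proof -
    have "((\<lambda>t. \<rho> (p + t *\<^sub>R w)) has_vector_derivative ?q \<bullet> w) (at_right 0)"
      using has_derivative_along_ray[OF d, of w] by simp
    then have "((\<lambda>t. \<rho> (p + t *\<^sub>R w)) has_real_derivative ?q \<bullet> w) (at_right 0)"
      by (simp add: has_real_derivative_iff_has_vector_derivative)
    from has_real_derivative_pos_inc_right[OF this w]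
    obtain e where e: "e > 0" "\<And>t. t > 0 \<Longrightarrow> t < e \<Longrightarrow> \<rho> (p + t *\<^sub>R w) > 0"
      using p0 p1 by auto
    have "\<forall>\<^sub>F t in at_right 0. \<rho> (p + t *\<^sub>R w) > 0" by (rule eventually_at_rightI[of 0 e]) (use e in auto)
    moreover have "\<forall>\<^sub>F t in at_right 0. p + t *\<^sub>R w \<in> U"
      using eventually_line_in_open[OF U, of w] eventually_nhds_conv_at eventually_at_split by blast
    ultimately show ?thesis by eventually_elim (rule out)
  qed
  then show thesis using that[of ?q] g U(2) by blast
qed

lemma frontier_subset_closure_exterior:
  assumes "smooth_boundary \<Omega>" "open \<Omega>"
  shows "frontier \<Omega> \<subseteq> closure (- closure \<Omega>)"
proof
  fix p assume "p \<in> frontier \<Omega>"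
  then obtain q where q: "q \<noteq> 0" "\<And>w. q \<bullet> w > 0 \<Longrightarrow> \<forall>\<^sub>F t in at_right 0. p + t *\<^sub>R w \<in> - closure \<Omega>"
    using smooth_boundary_exterior_cone[OF assms] by metis
  have "\<forall>\<^sub>F t in at_right 0. p + t *\<^sub>R q \<in> - closure \<Omega>" using q by simp
  then have ev: "\<forall>\<^sub>F t in at_right 0. p + t *\<^sub>R q \<in> closure (- closure \<Omega>)"
    by eventually_elim (rule subsetD[OF closure_subset])
  have "((\<lambda>t. p + t *\<^sub>R q) \<longlongrightarrow> p + 0 *\<^sub>R q) (at_right 0)" by (intro tendsto_intros)
  then have "((\<lambda>t. p + t *\<^sub>R q) \<longlongrightarrow> p) (at_right 0)" by simp
  then show "p \<in> closure (- closure \<Omega>)"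
    by (rule Lim_in_closed_set[OF closed_closure ev trivial_limit_at_right_real])
qed

text \<open>At a boundary point the exterior contains short segments in all directions of an open half-space,
  and these directions span. Hence the derivative within the exterior is unique, and a chosen
  derivative such as \<open>frechet_derivative\<close> can be computed by the usual rules.\<close>

lemma exterior_derivative_unique:
  fixes f :: "'a::euclidean_space \<Rightarrow> 'b::real_normed_vector"
  assumes sb: "smooth_boundary \<Omega>" "open \<Omega>" and p: "p \<in> - \<Omega>"
    and d: "(f has_derivative D) (at p within - \<Omega>)" "(f has_derivative D') (at p within - \<Omega>)"
  shows "D = D'"
proof (cases "p \<in> - closure \<Omega>")
  case True
  then have "p \<in> interior (- \<Omega>)" using closure_subset by (intro interiorI[of "- closure \<Omega>"]) (auto intro: open_Compl)
  then have "at p within - \<Omega> = at p" by (rule at_within_interior)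
  then show ?thesis using d has_derivative_unique by metis
next
  case False
  then have "p \<in> frontier \<Omega>" using p exterior_domain(3)[OF sb(2)] by blast
  then obtain q where q: "q \<noteq> 0" "\<And>w. q \<bullet> w > 0 \<Longrightarrow> \<forall>\<^sub>F t in at_right 0. p + t *\<^sub>R w \<in> - closure \<Omega>"
    using smooth_boundary_exterior_cone[OF sb] by metis
  have half: "D w = D' w" if "q \<bullet> w > 0" for w
  proof -
    have "\<forall>\<^sub>F t in at_right 0. p + t *\<^sub>R w \<in> - \<Omega>"
      using q(2)[OF that] by eventually_elim (use closure_subset in auto)
    from has_derivative_along_ray[OF d(1) this] has_derivative_along_ray[OF d(2) this]
    show ?thesis by (intro vector_derivative_unique_within) simp_all
  qed
  note lin = has_derivative_linear[OF d(1)] has_derivative_linear[OF d(2)]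
  show ?thesis
  proof
    fix w
    define l where "l = (\<bar>q \<bullet> w\<bar> + 1) / (q \<bullet> q)"
    have qq: "q \<bullet> q > 0" using q(1) by simp
    have "q \<bullet> (w + l *\<^sub>R q) = q \<bullet> w + (\<bar>q \<bullet> w\<bar> + 1)" using qq q(1) by (simp add: l_def inner_add_right)
    then have "q \<bullet> (w + l *\<^sub>R q) > 0" by linarith
    moreover have "q \<bullet> (l *\<^sub>R q) > 0" using qq by (simp add: l_def)
    ultimately have "D (w + l *\<^sub>R q) - D (l *\<^sub>R q) = D' (w + l *\<^sub>R q) - D' (l *\<^sub>R q)" using half by simp
    then show "D w = D' w" using lin by (simp add: linear_add)
  qed
qed

text \<open>Derivatives within a set only depend on the function near interior points of that set.\<close>

lemma pd_local:
  assumes "open T" "x \<in> T" "T \<subseteq> S" "T \<subseteq> S'" "\<And>y. y \<in> T \<Longrightarrow> f y = f' y"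
  shows "pd S b f x = pd S' b f' x"
proof -
  have "at x within S = at x" "at x within S' = at x"
    using assms interiorI by (metis at_within_interior)+
  moreover have "(f has_derivative D) (at x) \<longleftrightarrow> (f' has_derivative D) (at x)" for D
    using has_derivative_transform_within_open[of _ D x UNIV T] assms by metis
  ultimately show ?thesis unfolding pd_def frechet_derivative_def by simp
qed

section \<open>Hessian and mean curvature of level sets\<close>

text \<open>The differential of \<open>grad S f\<close>, assembled from the differentials of the partial derivatives.\<close>

definition hess :: "'a::euclidean_space set \<Rightarrow> ('a \<Rightarrow> real) \<Rightarrow> 'a \<Rightarrow> 'a \<Rightarrow> 'a" where
  "hess S f x w = (\<Sum>b\<in>Basis. frechet_derivative (pd S b f) (at x within S) w *\<^sub>R b)"

lemma Ck_on_2D: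
  assumes "Ck_on 2 S f"
  shows "f differentiable_on S" "\<And>b. b \<in> Basis \<Longrightarrow> pd S b f differentiable_on S"
    "\<And>b b'. b \<in> Basis \<Longrightarrow> b' \<in> Basis \<Longrightarrow> continuous_on S (pd S b' (pd S b f))"
  using assms by (auto simp: numeral_2_eq_2)

lemma has_derivative_grad_hess:
  assumes "Ck_on 2 S f" "x \<in> S"
  shows "(grad S f has_derivative hess S f x) (at x within S)"
  unfolding grad_def hess_def
  using Ck_on_2D(2)[OF assms(1)] assms(2) frechet_derivative_works
  by (intro has_derivative_sum has_derivative_scaleR_left) (auto simp: differentiable_on_def)

lemma hess_trace:
  assumes "Ck_on 2 S f" "x \<in> S"
  shows "(\<Sum>b\<in>Basis. hess S f x b \<bullet> b) = laplacian S f x"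
  unfolding laplacian_def
proof (rule sum.cong[OF refl])
  fix b :: 'a assume b: "b \<in> Basis"
  have "hess S f x b \<bullet> b = (\<Sum>b'\<in>Basis. frechet_derivative (pd S b' f) (at x within S) b * (b' \<bullet> b))"
    by (simp add: hess_def inner_sum_left)
  also have "\<dots> = (\<Sum>b'\<in>Basis. if b' = b then frechet_derivative (pd S b' f) (at x within S) b else 0)"
    using b by (intro sum.cong) (auto simp: inner_Basis)
  also have "\<dots> = pd S b (pd S b f) x" using b by (simp add: pd_def)
  finally show "hess S f x b \<bullet> b = pd S b (pd S b f) x" .
qed

lemma harmonic_on_of_laplacian:
  assumes S: "open S" and C: "Ck_on 2 S f" and l: "\<And>x. x \<in> S \<Longrightarrow> laplacian S f x = 0"
    and g: "\<And>x. x \<in> S \<Longrightarrow> g x = grad S f x"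
  shows "harmonic_on S f g"
proof -
  have at: "at x within S = at x" if "x \<in> S" for x using at_within_open[OF that S] .
  define H where "H = (\<lambda>x. Blinfun (hess S f x))"
  have dg: "(grad S f has_derivative hess S f x) (at x)" if "x \<in> S" for x
    using has_derivative_grad_hess[OF C that] at[OF that] by simp
  have H: "blinfun_apply (H x) = hess S f x" if "x \<in> S" for x
    unfolding H_def by (rule bounded_linear_Blinfun_apply[OF has_derivative_bounded_linear[OF dg[OF that]]])
  have "has_C2 S f g H"
    unfolding has_C2_def
  proof (intro conjI ballI)
    fix x assume x: "x \<in> S"
    have "f differentiable (at x within S)" using Ck_on_2D(1)[OF C] x by (simp add: differentiable_on_def)
    from has_derivative_gradient[OF this]
    show "(f has_derivative (\<lambda>w. g x \<bullet> w)) (at x)" using g[OF x] at[OF x] by simp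
    show "(g has_derivative blinfun_apply (H x)) (at x)"
      unfolding H[OF x]
      by (rule has_derivative_transform_within_open[OF dg[OF x] S x]) (use g in auto)
  next
    show "continuous_on S H"
    proof (rule continuous_on_blinfun_componentwise)
      fix i :: 'a assume i: "i \<in> Basis"
      have "continuous_on S (\<lambda>x. \<Sum>b\<in>Basis. pd S i (pd S b f) x *\<^sub>R b)"
        by (intro continuous_intros Ck_on_2D(3)[OF C] i)
      then show "continuous_on S (\<lambda>x. H x i)"
        by (rule continuous_on_eq) (use H in \<open>simp add: hess_def pd_def\<close>)
    qed
  qed
  moreover have "blinfun_trace (H x) = 0" if "x \<in> S" for x
    unfolding blinfun_trace_def H[OF that] hess_trace[OF C that] by (rule l[OF that])
  ultimately show ?thesis unfolding harmonic_on_def by blast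
qed

text \<open>Expanding \<open>\<nu>\<close> in the basis, each of the two mixed terms sums to \<open>- A \<nu> \<bullet> \<nu>\<close> and the last term
  to \<open>A \<nu> \<bullet> \<nu>\<close>.\<close>

lemma trace_tangential_compression:
  fixes A :: "'a::euclidean_space \<Rightarrow> 'a"
  assumes A: "linear A" and \<nu>: "norm \<nu> = 1"
  shows "(\<Sum>b\<in>Basis. A (b - (b \<bullet> \<nu>) *\<^sub>R \<nu>) \<bullet> (b - (b \<bullet> \<nu>) *\<^sub>R \<nu>)) = (\<Sum>b\<in>Basis. A b \<bullet> b) - A \<nu> \<bullet> \<nu>"
proof -
  have nn: "\<nu> \<bullet> \<nu> = 1" using \<nu> by (simp add: dot_square_norm)
  have "A (b - (b \<bullet> \<nu>) *\<^sub>R \<nu>) \<bullet> (b - (b \<bullet> \<nu>) *\<^sub>R \<nu>) =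
      A b \<bullet> b - ((b \<bullet> \<nu>) *\<^sub>R A b) \<bullet> \<nu> - (A \<nu> \<bullet> b) * (\<nu> \<bullet> b) + (\<nu> \<bullet> b) * (\<nu> \<bullet> b) * (A \<nu> \<bullet> \<nu>)" for b
    by (simp add: linear_diff[OF A] linear_cmul[OF A] inner_diff_left inner_diff_right inner_commute[of \<nu> b] algebra_simps)
  then have "(\<Sum>b\<in>Basis. A (b - (b \<bullet> \<nu>) *\<^sub>R \<nu>) \<bullet> (b - (b \<bullet> \<nu>) *\<^sub>R \<nu>)) =
      (\<Sum>b\<in>Basis. A b \<bullet> b) - (\<Sum>b\<in>Basis. (b \<bullet> \<nu>) *\<^sub>R A b) \<bullet> \<nu> - (\<Sum>b\<in>Basis. (A \<nu> \<bullet> b) * (\<nu> \<bullet> b))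
       + (\<Sum>b\<in>Basis. (\<nu> \<bullet> b) * (\<nu> \<bullet> b)) * (A \<nu> \<bullet> \<nu>)"
    by (simp only: sum.distrib sum_subtractf inner_sum_left sum_distrib_right)
  also have "(\<Sum>b\<in>Basis. (b \<bullet> \<nu>) *\<^sub>R A b) = A \<nu>"
  proof -
    have "A \<nu> = A (\<Sum>b\<in>Basis. (\<nu> \<bullet> b) *\<^sub>R b)" by (simp add: euclidean_representation)
    then show ?thesis using A by (simp add: linear_sum linear_cmul inner_commute[of \<nu>])
  qed
  also have "(\<Sum>b\<in>Basis. (A \<nu> \<bullet> b) * (\<nu> \<bullet> b)) = A \<nu> \<bullet> \<nu>" by (rule euclidean_inner[symmetric])
  also have "(\<Sum>b\<in>Basis. (\<nu> \<bullet> b) * (\<nu> \<bullet> b)) = 1" using nn by (simp flip: euclidean_inner)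
  finally show ?thesis by simp
qed

text \<open>On tangent vectors the differential of \<open>- Du / |Du|\<close> is \<open>- D\<^sup>2 u / |Du|\<close> up to a normal component, so
  the tangential trace is \<open>(D\<^sup>2 u (\<nu>, \<nu>) - \<Delta> u) / |Du|\<close>, and the Laplacian vanishes.\<close>

lemma mean_curvature_harmonic_level:
  fixes u :: "'a::euclidean_space \<Rightarrow> real"
  assumes sb: "smooth_boundary \<Omega>" "open \<Omega>" and x: "x \<in> - \<Omega>"
    and dg: "(grad (- \<Omega>) u has_derivative A) (at x within - \<Omega>)" and g: "grad (- \<Omega>) u x \<noteq> 0"
    and tr: "(\<Sum>b\<in>Basis. A b \<bullet> b) = 0"
  shows "mean_curvature (- \<Omega>) u x = (A (grad (- \<Omega>) u x) \<bullet> grad (- \<Omega>) u x) / norm (grad (- \<Omega>) u x) ^ 3"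
proof -
  let ?S = "- \<Omega>" and ?g = "grad (- \<Omega>) u x"
  define m where "m = norm ?g"
  have m: "m > 0" using g by (simp add: m_def)
  define \<nu> where "\<nu> = unit_normal ?S u x"
  have \<nu>: "\<nu> = - (?g /\<^sub>R m)" by (simp add: \<nu>_def unit_normal_def m_def)
  have n1: "norm \<nu> = 1" using g by (simp add: \<nu> m_def)
  note lin = has_derivative_linear[OF dg]
  have dn: "((\<lambda>y. norm (grad ?S u y)) has_derivative (\<lambda>w. A w \<bullet> sgn ?g)) (at x within ?S)"
    using has_derivative_compose[OF dg has_derivative_norm[OF g]] by simp
  define T where "T = (\<lambda>w. - (inverse m *\<^sub>R A w + (- (inverse m * (A w \<bullet> sgn ?g) * inverse m)) *\<^sub>R ?g))"
  have "(unit_normal ?S u has_derivative T) (at x within ?S)"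
  proof -
    have i: "((\<lambda>y. inverse (norm (grad ?S u y))) has_derivative (\<lambda>w. - (inverse m * (A w \<bullet> sgn ?g) * inverse m))) (at x within ?S)"
      using Deriv.has_derivative_inverse[OF _ dn] g by (simp add: m_def)
    have "((\<lambda>y. - (inverse (norm (grad ?S u y)) *\<^sub>R grad ?S u y)) has_derivative T) (at x within ?S)"
      using has_derivative_minus[OF has_derivative_scaleR[OF i dg]] unfolding T_def m_def .
    then show ?thesis unfolding unit_normal_def[abs_def] .
  qed
  moreover from this have "(unit_normal ?S u has_derivative shape_operator ?S u x) (at x within ?S)"
    unfolding shape_operator_def using frechet_derivative_works differentiableI by blast
  ultimately have sT: "shape_operator ?S u x = T"
    using exterior_derivative_unique[OF sb x] by blast
  have Tt: "T w \<bullet> v = - inverse m * (A w \<bullet> v)" if "v \<bullet> \<nu> = 0" for w v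
  proof -
    have "?g \<bullet> v = 0" using that m by (simp add: \<nu> inner_commute)
    then show ?thesis by (simp add: T_def inner_diff_left)
  qed
  have nn: "\<nu> \<bullet> \<nu> = 1" using n1 by (simp add: dot_square_norm)
  have "mean_curvature ?S u x = (\<Sum>b\<in>Basis. T (b - (b \<bullet> \<nu>) *\<^sub>R \<nu>) \<bullet> (b - (b \<bullet> \<nu>) *\<^sub>R \<nu>))"
    by (simp add: mean_curvature_def sT tangent_proj_def \<nu>_def)
  also have "\<dots> = (\<Sum>b\<in>Basis. - inverse m * (A (b - (b \<bullet> \<nu>) *\<^sub>R \<nu>) \<bullet> (b - (b \<bullet> \<nu>) *\<^sub>R \<nu>)))"
    by (intro sum.cong refl Tt) (simp add: inner_diff_left nn)
  also have "\<dots> = - inverse m * ((\<Sum>b\<in>Basis. A b \<bullet> b) - A \<nu> \<bullet> \<nu>)"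
    unfolding sum_distrib_left[symmetric] trace_tangential_compression[OF lin n1] ..
  also have "\<dots> = inverse m * (A \<nu> \<bullet> \<nu>)" by (simp add: tr)
  also have "A \<nu> = - (inverse m *\<^sub>R A ?g)" using lin by (simp add: \<nu> linear_neg linear_cmul)
  also have "inverse m * (- (inverse m *\<^sub>R A ?g) \<bullet> \<nu>) = (A ?g \<bullet> ?g) / m ^ 3"
    by (simp add: \<nu> field_simps power3_eq_cube)
  finally show ?thesis by (simp add: m_def)
qed

section \<open>From the local to the global conclusion\<close>

text \<open>A ray from a point of \<open>\<Omega>\<close> outside the closed ball, directed away from the centre, would have to
  leave the bounded set \<open>\<Omega>\<close> through a frontier point off the sphere. Inside the ball there are no
  frontier points, so the connected ball is covered by \<open>\<Omega>\<close>.\<close>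

lemma ball_of_frontier_subset_sphere:
  fixes \<Omega> :: "'a::euclidean_space set"
  assumes \<Omega>: "open \<Omega>" "bounded \<Omega>" "\<Omega> \<noteq> {}" and fr: "frontier \<Omega> \<subseteq> sphere z r"
  shows "\<Omega> = ball z r"
proof -
  obtain R where R: "R > 0" "\<Omega> \<subseteq> ball z R" using \<Omega>(2) bounded_subset_ballD by blast
  have "\<Omega> \<subseteq> cball z r"
  proof (rule ccontr)
    assume "\<not> \<Omega> \<subseteq> cball z r"
    then obtain x where x': "x \<in> \<Omega>" "x \<notin> cball z r" by blast
    then have x: "x \<in> \<Omega>" "dist z x > r" by simp_all
    have "frontier \<Omega> \<noteq> {}" using \<Omega> frontier_eq_empty not_bounded_UNIV by metis
    then obtain y where "y \<in> sphere z r" using fr by blast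
    then have r: "r \<ge> 0" by (auto simp: sphere_def)
    define \<gamma> where "\<gamma> = (\<lambda>t::real. x + t *\<^sub>R (x - z))"
    have d: "dist z (\<gamma> t) = (1 + t) * dist z x" if "t \<ge> 0" for t
    proof -
      have "\<gamma> t - z = (1 + t) *\<^sub>R (x - z)" by (simp add: \<gamma>_def algebra_simps)
      then have "norm (\<gamma> t - z) = (1 + t) * norm (x - z)" using that by simp
      then show ?thesis by (simp only: dist_norm norm_minus_commute[of z])
    qed
    have "\<gamma> ` {0..} \<inter> frontier \<Omega> \<noteq> {}"
    proof (rule connected_Int_frontier)
      show "connected (\<gamma> ` {0..})"
        unfolding \<gamma>_def by (intro connected_continuous_image continuous_intros) auto
      show "\<gamma> ` {0..} \<inter> \<Omega> \<noteq> {}" using x(1) by (auto simp: \<gamma>_def intro!: image_eqI[of _ _ 0])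
      have "z \<noteq> x" using x(2) r by auto
      then have "dist z (\<gamma> (R / dist z x)) \<ge> R"
        using d[of "R / dist z x"] x(2) r R(1) by (simp add: distrib_right)
      then have "\<gamma> (R / dist z x) \<notin> \<Omega>" using R(2) by auto
      moreover have "R / dist z x \<in> {0..}" using R(1) by simp
      ultimately show "\<gamma> ` {0..} - \<Omega> \<noteq> {}" by blast
    qed
    then obtain t where t: "t \<ge> 0" "\<gamma> t \<in> frontier \<Omega>" by auto
    then have "dist z (\<gamma> t) = r" using fr by (auto simp: sphere_def)
    moreover have "dist z x \<le> (1 + t) * dist z x" using t(1) by (simp add: algebra_simps)
    ultimately show False using d[OF t(1)] x(2) by linarith
  qed
  from interior_maximal[OF this \<Omega>(1)] have sub: "\<Omega> \<subseteq> ball z r" by simp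
  have "ball z r \<subseteq> \<Omega>"
  proof (rule ccontr)
    assume "\<not> ball z r \<subseteq> \<Omega>"
    then have "ball z r \<inter> frontier \<Omega> \<noteq> {}"
      using sub \<Omega>(3) by (intro connected_Int_frontier) auto
    then show False using fr by auto
  qed
  then show ?thesis using sub by blast
qed

text \<open>Unique continuation extends the radial formula to the whole exterior without \<open>z\<close>. The formula is
  unbounded near \<open>z\<close> while \<open>u\<close> is continuous, so \<open>z \<in> \<Omega>\<close>. On the frontier \<open>u = 1\<close>, so the frontier
  lies on a sphere around \<open>z\<close>.\<close>

lemma ball_of_locally_radial:
  fixes \<Omega> :: "'a::euclidean_space set" and u :: "'a \<Rightarrow> real"
  defines "p \<equiv> (2 - real DIM('a)) / 2"
  assumes dim: "DIM('a) \<ge> 3" and \<Omega>: "open \<Omega>" "bounded \<Omega>" "0 \<in> \<Omega>" "smooth_boundary \<Omega>"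
    and cont: "continuous_on (- \<Omega>) u" and h: "harmonic_on (- closure \<Omega>) u g"
    and conn: "connected (- closure \<Omega>)"
    and one: "\<And>x. x \<in> frontier \<Omega> \<Longrightarrow> u x = 1"
    and s: "s > 0" "B > 0" "ball y s \<subseteq> - closure \<Omega>"
    and loc: "\<And>x. x \<in> ball y s \<Longrightarrow> x \<noteq> z \<and> u x = B * ((x - z) \<bullet> (x - z)) powr p"
  shows "\<exists>r. r > 0 \<and> \<Omega> = ball z r \<and> (\<forall>x\<in>- \<Omega>. u x = B * ((dist z x)\<^sup>2) powr p)"
proof -
  let ?O = "- closure \<Omega>" and ?f = "\<lambda>x. B * ((x - z) \<bullet> (x - z)) powr p"
  note ext = exterior_domain[OF \<Omega>(1)]
  have p: "p < 0" using dim by (simp add: p_def)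
  have openO: "open ?O" by (rule open_Compl[OF closed_closure])
  have clO: "closure ?O = - \<Omega>"
    using ext(1,3) frontier_subset_closure_exterior[OF \<Omega>(4,1)] closure_subset[of ?O] by blast
  have "y \<in> ball y s" using s(1) by simp
  then have yO: "y \<in> ?O" and yz: "y \<noteq> z" using s(3) loc[of y] by blast+
  obtain k where k: "harmonic_on (- {z}) (\<lambda>x. ((x - z) \<bullet> (x - z)) powr p) k"
    using harmonic_radial[of z] unfolding p_def by blast
  have hk: "harmonic_on (?O - {z}) (\<lambda>x. u x - ?f x) (\<lambda>x. g x - B *\<^sub>R k x)"
    by (intro harmonic_on_diff harmonic_on_cmult harmonic_on_subset[OF h] harmonic_on_subset[OF k]) auto
  have eqO: "u x = ?f x" if x: "x \<in> ?O" "x \<noteq> z" for x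
  proof -
    have "u x - ?f x = 0"
    proof (rule harmonic_unique_continuation[OF _ _ hk])
      show "open (?O - {z})" using openO by (rule open_delete)
      show "connected (?O - {z})" using dim by (intro connected_open_delete openO conn) auto
      show "y \<in> ?O - {z}" using yO yz by simp
      show "s > 0" by (rule s(1))
      show "u w - ?f w = 0" if "w \<in> ball y s" for w using loc[OF that] by simp
      show "x \<in> ?O - {z}" using x by simp
    qed
    then show ?thesis by simp
  qed
  have z: "z \<in> \<Omega>"
  proof (rule ccontr)
    assume z: "z \<notin> \<Omega>"
    then have "z \<in> closure ?O" using clO by simp
    have lp: "z islimpt ?O"
    proof (cases "z \<in> ?O")
      case True
      then show ?thesis using openO interior_limit_point interior_open by metis
    next
      case False
      then show ?thesis using \<open>z \<in> closure ?O\<close> unfolding closure_def[of ?O] by blast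
    qed
    have "((u \<longlongrightarrow> u z) (at z within - \<Omega>))" using cont z by (simp add: continuous_on_def)
    then have "\<forall>\<^sub>F x in at z within - \<Omega>. u x < \<bar>u z\<bar> + 1" by (rule order_tendstoD) linarith
    then obtain d where d: "d > 0" "\<And>x. x \<in> - \<Omega> \<Longrightarrow> x \<noteq> z \<Longrightarrow> dist x z < d \<Longrightarrow> u x < \<bar>u z\<bar> + 1"
      unfolding eventually_at by blast
    define d' where "d' = ((\<bar>u z\<bar> + 1) / B) powr (1 / (2 * p))"
    have d': "d' > 0" "d' powr (2 * p) = (\<bar>u z\<bar> + 1) / B"
      using s(2) p by (auto simp: d'_def powr_powr)
    obtain x where x: "x \<in> ?O" "x \<noteq> z" "dist x z < min d d'"
      using lp d(1) d'(1) unfolding islimpt_approachable by (metis min_less_iff_conj)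
    have "norm (x - z) powr (2 * p) > d' powr (2 * p)"
      using x p by (intro powr_less_mono2_neg) (auto simp: dist_norm)
    from mult_strict_left_mono[OF this s(2)]
    have "?f x > B * d' powr (2 * p)" unfolding inner_self_powr .
    then have "?f x > \<bar>u z\<bar> + 1" unfolding d'(2) using s(2) by simp
    moreover have "u x < \<bar>u z\<bar> + 1" using d(2)[of x] x closure_subset by auto
    ultimately show False using eqO[OF x(1,2)] by simp
  qed
  have eq: "u x = ?f x" if x: "x \<in> - \<Omega>" for x
  proof -
    have "u x - ?f x = 0"
    proof (rule continuous_constant_on_closure[where S="?O" and f="\<lambda>x. u x - ?f x"])
      show "continuous_on (closure ?O) (\<lambda>x. u x - ?f x)"
        unfolding clO using z
        by (intro continuous_intros cont continuous_on_subset[OF harmonic_on_continuous(1)[OF k]]) auto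
      show "u x - ?f x = 0" if "x \<in> ?O" for x
        using eqO[OF that] z that closure_subset by (cases "x = z") auto
      show "x \<in> closure ?O" using x clO by simp
    qed
    then show ?thesis by simp
  qed
  define r where "r = (1 / B) powr (1 / (2 * p))"
  have "frontier \<Omega> \<subseteq> sphere z r"
  proof
    fix x assume x: "x \<in> frontier \<Omega>"
    then have xO: "x \<in> - \<Omega>" using ext(3) by blast
    have "1 = B * norm (x - z) powr (2 * p)" using eq[OF xO] one[OF x] by (simp add: inner_self_powr)
    then have "norm (x - z) powr (2 * p) = 1 / B" using s(2) by (simp add: field_simps)
    then have "r = (norm (x - z) powr (2 * p)) powr (1 / (2 * p))" by (simp add: r_def)
    also have "\<dots> = norm (x - z)" using p xO z by (simp add: powr_powr)
    finally show "x \<in> sphere z r" by (simp add: dist_norm norm_minus_commute)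
  qed
  then have "\<Omega> = ball z r" using \<Omega> by (intro ball_of_frontier_subset_sphere) auto
  moreover have "r > 0" using s(2) by (simp add: r_def)
  moreover have "u x = B * ((dist z x)\<^sup>2) powr p" if "x \<in> - \<Omega>" for x
    using eq[OF that] by (simp add: dist_norm norm_minus_commute dot_square_norm)
  ultimately show ?thesis by blast
qed

text \<open>On a bounded component of the exterior the maximum principle forces \<open>u = 1\<close>, so the gradient
  vanishes there, against regularity. A bounded set has only one unbounded complementary component.\<close>

lemma connected_exterior_of_regular:
  fixes \<Omega> :: "'a::euclidean_space set" and u :: "'a \<Rightarrow> real"
  assumes dim: "DIM('a) \<ge> 2" and \<Omega>: "open \<Omega>" "bounded \<Omega>"
    and cont: "continuous_on (- \<Omega>) u" and h: "harmonic_on (- closure \<Omega>) u g"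
    and one: "\<And>x. x \<in> frontier \<Omega> \<Longrightarrow> u x = 1"
    and reg: "\<And>x. x \<in> - closure \<Omega> \<Longrightarrow> u x = 1 \<Longrightarrow> g x \<noteq> 0"
  shows "connected (- closure \<Omega>)"
proof -
  let ?O = "- closure \<Omega>"
  note ext = exterior_domain[OF \<Omega>(1)]
  have openO: "open ?O" by (rule open_Compl[OF closed_closure])
  have unb: "\<not> bounded C" if C: "C \<in> components ?O" for C
  proof
    assume b: "bounded C"
    have CO: "C \<subseteq> ?O" using C by (rule in_components_subset)
    have openC: "open C" using openO C by (rule open_components)
    have frC: "u x = 1" if "x \<in> frontier C" for x
      using frontier_of_components_subset[OF C] ext(2) that one by blast
    have cC: "continuous_on (closure C) u"
      using cont by (rule continuous_on_subset) (use closure_mono[OF CO] ext(1) in blast)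
    note hC = harmonic_on_subset[OF h CO]
    obtain R where R: "C \<subseteq> ball 0 R" using b bounded_subset_ballD by blast
    have cu: "c * u x \<le> c" if x: "x \<in> C" for x c
    proof (rule harmonic_le_boundary[OF openC harmonic_on_cmult[OF hC] _ _ _ x])
      show "continuous_on (closure C) (\<lambda>x. c * u x)" by (intro continuous_intros cC)
      show "c * u x \<le> c" if "x \<in> frontier C" for x using frC[OF that] by simp
      show "\<exists>R. \<forall>x\<in>C. R \<le> norm x \<longrightarrow> c * u x < c + e" for e
        using R by (intro exI[of _ R]) auto
    qed
    have u1: "u x = 1" if "x \<in> C" for x using cu[OF that, of 1] cu[OF that, of "- 1"] by simp
    obtain x where x: "x \<in> C" using in_components_nonempty[OF C] by blast
    have "((\<lambda>_. 1) has_derivative (\<lambda>w. g x \<bullet> w)) (at x)"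
      by (rule has_derivative_transform_within_open[OF harmonic_on_derivative[OF hC x] openC x]) (use u1 in auto)
    moreover have "((\<lambda>_. 1::real) has_derivative (\<lambda>w. 0 \<bullet> w)) (at x)" by simp
    ultimately have "g x = 0" by (rule gradient_unique)
    then show False using reg[of x] u1[OF x] x CO by blast
  qed
  have "bounded (- ?O)" using bounded_closure[OF \<Omega>(2)] by simp
  then have uniq: "C = C'" if "C \<in> components ?O" "C' \<in> components ?O" for C C'
    using cobounded_unique_unbounded_components[of ?O C' C] unb that dim by blast
  show ?thesis
    unfolding connected_iff_eq_connected_component_set
  proof
    fix x assume x: "x \<in> ?O"
    show "connected_component_set ?O x = ?O"
    proof
      show "connected_component_set ?O x \<subseteq> ?O" by (rule connected_component_subset)
      show "?O \<subseteq> connected_component_set ?O x"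
      proof
        fix y assume y: "y \<in> ?O"
        then have "connected_component_set ?O y = connected_component_set ?O x"
          using uniq x by (simp add: componentsI)
        then show "y \<in> connected_component_set ?O x" using y connected_component_refl_eq by fastforce
      qed
    qed
  qed
qed

lemma exterior_harmonic_le_one:
  fixes \<Omega> :: "'a::euclidean_space set" and u :: "'a \<Rightarrow> real"
  assumes \<Omega>: "open \<Omega>"
    and cont: "continuous_on (- \<Omega>) u" and h: "harmonic_on (- closure \<Omega>) u g"
    and one: "\<And>x. x \<in> frontier \<Omega> \<Longrightarrow> u x = 1" and lim: "(u \<longlongrightarrow> 0) at_infinity" and x: "x \<in> - closure \<Omega>"
  shows "u x \<le> 1"
proof -
  note ext = exterior_domain[OF \<Omega>]
  show ?thesis
  proof (rule harmonic_le_boundary[OF open_Compl[OF closed_closure] h continuous_on_subset[OF cont ext(1)] _ _ x])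
    show "u x \<le> 1" if "x \<in> frontier (- closure \<Omega>)" for x using one that ext(2) by fastforce
    fix e :: real assume "e > 0"
    then have "\<forall>\<^sub>F x in at_infinity. u x < 1 + e" by (intro order_tendstoD[OF lim]) simp
    then show "\<exists>R. \<forall>x\<in>- closure \<Omega>. R \<le> norm x \<longrightarrow> u x < 1 + e"
      unfolding eventually_at_infinity by blast
  qed
qed

text \<open>At a boundary point let \<open>q\<close> be the outer normal direction of \<open>\<Omega>\<close>. Since \<open>u \<le> 1\<close> outside, \<open>v \<bullet> w \<le> 0\<close>
  whenever \<open>q \<bullet> w > 0\<close>. Testing with \<open>w = q + v\<close> shows \<open>q \<bullet> v < 0\<close>, so \<open>- v\<close> points outwards.\<close>

lemma descending_ray_in_exterior:
  fixes \<Omega> :: "'a::euclidean_space set" and u :: "'a \<Rightarrow> real"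
  assumes sb: "smooth_boundary \<Omega>" "open \<Omega>" and p: "p \<in> - \<Omega>"
    and one: "\<And>x. x \<in> frontier \<Omega> \<Longrightarrow> u x = 1" and le: "\<And>x. x \<in> - closure \<Omega> \<Longrightarrow> u x \<le> 1"
    and d: "(u has_derivative (\<lambda>w. v \<bullet> w)) (at p within - \<Omega>)" and v: "v \<noteq> 0"
  shows "\<forall>\<^sub>F t in at_right 0. p - t *\<^sub>R v \<in> - \<Omega>"
proof (cases "p \<in> - closure \<Omega>")
  case True
  have "\<forall>\<^sub>F t in nhds 0. p + t *\<^sub>R (- v) \<in> - closure \<Omega>"
    by (rule eventually_line_in_open[OF open_Compl[OF closed_closure] True])
  then have "\<forall>\<^sub>F t in at_right 0. p + t *\<^sub>R (- v) \<in> - closure \<Omega>"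
    unfolding eventually_at_filter by eventually_elim simp
  then show ?thesis by eventually_elim (use closure_subset in auto)
next
  case False
  then have pf: "p \<in> frontier \<Omega>" using p exterior_domain(3)[OF sb(2)] by blast
  then obtain q where q: "q \<noteq> 0" "\<And>w. q \<bullet> w > 0 \<Longrightarrow> \<forall>\<^sub>F t in at_right 0. p + t *\<^sub>R w \<in> - closure \<Omega>"
    using smooth_boundary_exterior_cone[OF sb] by metis
  have vw: "v \<bullet> w \<le> 0" if w: "q \<bullet> w > 0" for w
  proof (rule ccontr)
    assume "\<not> v \<bullet> w \<le> 0"
    then have pos: "v \<bullet> w > 0" by simp
    have ev: "\<forall>\<^sub>F t in at_right 0. p + t *\<^sub>R w \<in> - \<Omega>"
      using q(2)[OF w] by eventually_elim (use closure_subset in auto)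
    have "((\<lambda>t. u (p + t *\<^sub>R w)) has_real_derivative v \<bullet> w) (at_right 0)"
      using has_derivative_along_ray[OF d ev] by (simp add: has_real_derivative_iff_has_vector_derivative)
    from has_real_derivative_pos_inc_right[OF this pos]
    obtain e where e: "e > 0" "\<And>t. t > 0 \<Longrightarrow> t < e \<Longrightarrow> u p < u (p + t *\<^sub>R w)" by auto
    have "\<forall>\<^sub>F t in at_right 0. u p < u (p + t *\<^sub>R w)" by (rule eventually_at_rightI[of 0 e]) (use e in auto)
    then have "\<forall>\<^sub>F t in at_right (0::real). False"
      using q(2)[OF w] by eventually_elim (use le one[OF pf] in force)
    then show False by simp
  qed
  have "q \<bullet> (- v) > 0"
  proof (rule ccontr)
    assume "\<not> q \<bullet> (- v) > 0"
    then have "q \<bullet> v \<ge> 0" by simp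
    then have "q \<bullet> (q + v) > 0" using q(1) by (simp add: inner_add_right add_pos_nonneg)
    from vw[OF this] have "v \<bullet> q + v \<bullet> v \<le> 0" by (simp add: inner_add_right)
    moreover have "v \<bullet> v > 0" using v by simp
    ultimately show False using \<open>q \<bullet> v \<ge> 0\<close> by (simp add: inner_commute)
  qed
  from q(2)[OF this] show ?thesis by eventually_elim (use closure_subset in auto)
qed

theorem corollary1p4:
  fixes \<Omega> :: "(real ^ 'n) set" and u :: "real ^ 'n \<Rightarrow> real" and c :: real
  assumes "CARD('n) \<ge> 3"
    and "open \<Omega>" and "connected \<Omega>" and "bounded \<Omega>" and "0 \<in> \<Omega>" and "smooth_boundary \<Omega>"
    and "continuous_on (- \<Omega>) u"
    and "Ck_on 2 (- closure \<Omega>) u"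
    and "\<forall>x \<in> - closure \<Omega>. - laplacian (- closure \<Omega>) u x = 0"
    and "\<forall>x \<in> frontier \<Omega>. u x = 1"
    and "(u \<longlongrightarrow> 0) at_infinity"
    and "0 < c" and "c \<le> 1"
    and "c = 1 \<longrightarrow> Ck_on 2 (- \<Omega>) u"
    and "c < 1 \<longrightarrow> connected (- closure \<Omega>)"
    and "regular_level_set (- \<Omega>) u c"
    and "\<forall>x \<in> level_set (- \<Omega>) u c.
           mean_curvature (- \<Omega>) u x / (real CARD('n) - 1)
             \<le> norm (grad (- \<Omega>) u x) / ((real CARD('n) - 2) * u x)"
  shows "\<exists>x0 r. r > 0 \<and> \<Omega> = ball x0 r \<and> (\<exists>f. \<forall>x \<in> - \<Omega>. u x = f (dist x0 x))"
proof -
  note \<Omega> = assms(2,4,5) and sb = assms(6,2) and cont = assms(7) and lim = assms(11)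
  have dim: "DIM(real ^ 'n) \<ge> 3" using assms(1) by simp
  let ?O = "- closure \<Omega>" and ?g = "grad (- \<Omega>) u"
  \<comment> \<open>On \<open>S\<close> the function \<open>u\<close> is twice continuously differentiable, up to the boundary if \<open>c = 1\<close>.\<close>
  define S where "S = (if c = 1 then - \<Omega> else ?O)"
  have openO: "open ?O" by (rule open_Compl[OF closed_closure])
  note ext = exterior_domain[OF assms(2)]
  have OS: "?O \<subseteq> - \<Omega>" using closure_subset by auto
  have one: "u x = 1" if "x \<in> frontier \<Omega>" for x using assms(10) that by blast
  have S: "?O \<subseteq> S" "S \<subseteq> - \<Omega>" using OS by (auto simp: S_def)
  have CS: "Ck_on 2 S u" using assms(8,14) by (simp add: S_def)
  have levS: "x \<in> S" if "x \<in> - \<Omega>" "u x \<le> c" for x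
    using that ext(3) one[of x] assms(13) by (auto simp: S_def)
  have atS: "at x within S = at x within - \<Omega>" if "x \<in> S" for x
  proof (cases "c = 1")
    case False
    then have x: "x \<in> ?O" using that by (simp add: S_def)
    show ?thesis
      unfolding at_within_interior[OF interiorI[OF openO x OS]]
        at_within_interior[OF interiorI[OF openO x S(1)]] ..
  qed (simp add: S_def)
  have pdS: "pd S b f x = pd (- \<Omega>) b f x" if "x \<in> S" for b f x
    using atS[OF that] by (simp add: pd_def)
  have gS: "grad S u x = ?g x" if "x \<in> S" for x using pdS[OF that] by (simp add: grad_def)
  have pdO: "pd ?O b u x = pd S' b u x" if "x \<in> ?O" "?O \<subseteq> S'" for b x S'
    by (rule pd_local[OF openO that(1) _ that(2)]) auto
  have gO: "?g x = grad ?O u x" if "x \<in> ?O" for x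
    using pdO[OF that OS] by (simp add: grad_def)
  have h: "harmonic_on ?O u ?g"
    by (rule harmonic_on_of_laplacian[OF openO assms(8) _ gO]) (use assms(9) in auto)
  \<comment> \<open>At boundary points, by continuity of the second derivatives.\<close>
  have lapS: "laplacian S u x = 0" if x: "x \<in> S" for x
  proof -
    have O: "laplacian S u x = 0" if x: "x \<in> ?O" for x
    proof -
      have "pd ?O b (pd ?O b u) x = pd S b (pd S b u) x" for b
        by (rule pd_local[OF openO x _ S(1)]) (use pdO S(1) in auto)
      then have "laplacian S u x = laplacian ?O u x" by (simp add: laplacian_def)
      then show ?thesis using assms(9) x by simp
    qed
    show ?thesis
    proof (cases "c = 1")
      case True
      have "closure ?O = S"
        using ext(1,3) frontier_subset_closure_exterior[OF sb] closure_subset[of ?O] True by (auto simp: S_def)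
      moreover have "continuous_on S (laplacian S u)"
        unfolding laplacian_def[abs_def] by (intro continuous_intros Ck_on_2D(3)[OF CS])
      ultimately show ?thesis
        using continuous_constant_on_closure[of ?O "laplacian S u" 0 x] O x by simp
    next
      case False
      then show ?thesis using O x by (simp add: S_def)
    qed
  qed
  have dg: "(?g has_derivative hess S u x) (at x within - \<Omega>)" if x: "x \<in> S" for x
  proof -
    have "(grad S u has_derivative hess S u x) (at x within - \<Omega>)"
      using has_derivative_grad_hess[OF CS x] atS[OF x] by simp
    then show ?thesis
    proof (cases "c = 1")
      case False
      then have "x \<in> ?O" using x by (simp add: S_def)
      then show ?thesis
        using has_derivative_transform_within_open[OF \<open>(grad S u has_derivative _) _\<close> openO] gS S(1) by blast
    qed (simp add: S_def)
  qed
  have du: "(u has_derivative (\<lambda>w. ?g x \<bullet> w)) (at x within - \<Omega>)" if x: "x \<in> S" for x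
  proof -
    have "u differentiable (at x within S)"
      using Ck_on_2D(1)[OF CS] x by (simp add: differentiable_on_def)
    then show ?thesis unfolding atS[OF x] by (rule has_derivative_gradient)
  qed
  have reg: "?g x \<noteq> 0" if "x \<in> - \<Omega>" "u x = c" for x
    using assms(16) that by (simp add: regular_level_set_def level_set_def)
  have cg: "continuous_on {x \<in> - \<Omega>. u x \<le> c} ?g"
  proof -
    have "continuous_on S (grad S u)"
      unfolding grad_def[abs_def]
      by (intro continuous_intros differentiable_imp_continuous_on Ck_on_2D(2)[OF CS])
    then have "continuous_on S ?g" by (rule continuous_on_eq) (rule gS)
    then show ?thesis by (rule continuous_on_subset) (use levS in auto)
  qed
  define n where "n = real CARD('n)"
  have n: "n > 2" using assms(1) by (simp add: n_def)
  have curv: "hess S u x (?g x) \<bullet> ?g x \<le> (n - 1) / (n - 2) * (?g x \<bullet> ?g x)\<^sup>2 / c"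
    if x: "x \<in> - \<Omega>" "u x = c" for x
  proof -
    have xS: "x \<in> S" using levS x by simp
    have tr: "(\<Sum>b\<in>Basis. hess S u x b \<bullet> b) = 0" using hess_trace[OF CS xS] lapS[OF xS] by simp
    let ?m = "norm (?g x)" and ?q = "hess S u x (?g x) \<bullet> ?g x"
    have m: "?m > 0" using reg[OF x] by simp
    have "x \<in> level_set (- \<Omega>) u c" using x by (simp add: level_set_def)
    then have "mean_curvature (- \<Omega>) u x / (n - 1) \<le> ?m / ((n - 2) * u x)"
      using assms(17) unfolding n_def by blast
    then have "?q / ?m ^ 3 / (n - 1) \<le> ?m / ((n - 2) * c)"
      unfolding mean_curvature_harmonic_level[OF sb x(1) dg[OF xS] reg[OF x] tr] x(2) .
    \<comment> \<open>Clear the denominators \<open>|Du|\<^sup>3\<close> and \<open>n - 1\<close>.\<close>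
    then have "(?q / ?m ^ 3 / (n - 1)) * (?m ^ 3 * (n - 1)) \<le> (?m / ((n - 2) * c)) * (?m ^ 3 * (n - 1))"
      using m n by (intro mult_right_mono) auto
    also have "(?q / ?m ^ 3 / (n - 1)) * (?m ^ 3 * (n - 1)) = ?q" using m n by simp
    also have "(?m / ((n - 2) * c)) * (?m ^ 3 * (n - 1)) = (n - 1) / (n - 2) * (?m ^ 4) / c"
      by (simp add: power3_eq_cube power4_eq_xxxx)
    also have "?m ^ 4 = (?g x \<bullet> ?g x)\<^sup>2" by (simp add: dot_square_norm)
    finally show ?thesis .
  qed
  have le1: "u x \<le> 1" if "x \<in> ?O" for x
    by (rule exterior_harmonic_le_one[OF assms(2) cont h one lim that])
  have ray: "\<forall>\<^sub>F t in at_right 0. x - t *\<^sub>R ?g x \<in> - \<Omega>" if x: "x \<in> - \<Omega>" "u x = c" for x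
    by (rule descending_ray_in_exterior[OF sb x(1) one le1 du reg[OF x]]) (use levS x in auto)
  have conn: "connected ?O"
  proof (cases "c = 1")
    case True
    show ?thesis
    proof (rule connected_exterior_of_regular[OF _ assms(2,4) cont h one])
      show "?g x \<noteq> 0" if "x \<in> ?O" "u x = 1" for x using reg[of x] that OS True by blast
    qed (use dim in auto)
  qed (use assms(13,15) in auto)
  have nD: "real DIM(real ^ 'n) = n" by (simp add: n_def)
  obtain y s z B where sB: "s > 0" "B > 0" "ball y s \<subseteq> ?O"
    and rad: "\<And>x. x \<in> ball y s \<Longrightarrow> x \<noteq> z \<and> u x = B * ((x - z) \<bullet> (x - z)) powr ((2 - real DIM(real ^ 'n)) / 2)"
  proof (rule locally_radial_of_curvature_bound[OF dim \<Omega> cont h one lim assms(12,13) cg])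
    show "hess S u x (?g x) \<bullet> ?g x \<le> (real DIM(real ^ 'n) - 1) / (real DIM(real ^ 'n) - 2) * (?g x \<bullet> ?g x)\<^sup>2 / c"
      if "x \<in> - \<Omega>" "u x = c" for x
      unfolding nD by (rule curv[OF that])
  qed (use reg du dg ray levS in \<open>blast intro: order_refl\<close>)+
  obtain r where r: "r > 0" "\<Omega> = ball z r"
    "\<And>x. x \<in> - \<Omega> \<Longrightarrow> u x = B * ((dist z x)\<^sup>2) powr ((2 - real DIM(real ^ 'n)) / 2)"
    using ball_of_locally_radial[OF dim \<Omega> assms(6) cont h conn one sB rad] by blast
  then show ?thesis
    by (intro exI[of _ z] exI[of _ r] conjI exI[of _ "\<lambda>d. B * (d\<^sup>2) powr ((2 - real DIM(real ^ 'n)) / 2)"]) auto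
qed

end
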